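(* Let $\emptyset$ be the empty 2-category and let $\mathsf{Bi}^{\mathsf{fsy}}_{\mathsf r}$ be the 2-category of flat small symmetric bimonoidal categories, robust symmetric bimonoidal functors, and bimonoidal natural transformations. The variant $\Sigma'$ of the finite ordinal category is a lax bicolimit of the unique 2-functor $\emptyset\to\mathsf{Bi}^{\mathsf{fsy}}_{\mathsf r}$. That is, $\Sigma'$ is an object of $\mathsf{Bi}^{\mathsf{fsy}}_{\mathsf r}$ and, for every flat small symmetric bimonoidal category $C$, the unique functor $\mathsf{Bi}^{\mathsf{fsy}}_{\mathsf r}(\Sigma',C)\to\mathbf 1$ to the terminal category is an equivalence of categories.
   Context: Write $AB$ for $A\otimes B$; $\otimes$ binds tighter than $\oplus$. A bimonoidal category is a category $C$ with a symmetric monoidal structure $(\oplus,0,\alpha^\oplus,\lambda^\oplus,\rho^\oplus,\zeta^\oplus)$, a monoidal structure $(\otimes,1,\alpha^\otimes,\lambda^\otimes,\rho^\otimes)$ (with $\alpha_{A,B,C}:(AB)C\to A(BC)$, $\lambda_A$, $\rho_A$ the left/right unit isomorphisms), natural isomorphisms $\lambda^\bullet_A:0A\to0$, $\rho^\bullet_A:A0\to 0$, and natural monomorphisms $\delta^l_{A,B,C}:A(B\oplus C)\to AB\oplus AC$, $\delta^r_{A,B,C}:(A\oplus B)C\to AC\oplus BC$, such that for all objects: $\delta^l_{A,C,B}(1\otimes\zeta^\oplus_{B,C})=\zeta^\oplus_{AB,AC}\delta^l_{A,B,C}$; $\delta^r_{B,A,C}(\zeta^\oplus_{A,B}\otimes1)=\zeta^\oplus_{AC,BC}\delta^r_{A,B,C}$;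 $\alpha^\oplus(\delta^r_{A,B,D}\oplus1)\delta^r_{A\oplus B,C,D}=(1\oplus\delta^r_{B,C,D})\delta^r_{A,B\oplus C,D}(\alpha^\oplus_{A,B,C}\otimes1)$; $\alpha^\oplus(\delta^l_{A,B,C}\oplus1)\delta^l_{A,B\oplus C,D}=(1\oplus\delta^l_{A,C,D})\delta^l_{A,B,C\oplus D}(1\otimes\alpha^\oplus_{B,C,D})$; $\delta^l_{A,BC,BD}(1\otimes\delta^l_{B,C,D})\alpha^\otimes_{A,B,C\oplus D}=(\alpha^\otimes_{A,B,C}\oplus\alpha^\otimes_{A,B,D})\delta^l_{AB,C,D}$; $(\alpha^\otimes_{A,C,D}\oplus\alpha^\otimes_{B,C,D})\delta^r_{AC,BC,D}(\delta^r_{A,B,C}\otimes1)=\delta^r_{A,B,CD}\alpha^\otimes_{A\oplus B,C,D}$; $(\alpha^\otimes_{A,B,D}\oplus\alpha^\otimes_{A,C,D})\delta^r_{AB,AC,D}(\delta^l_{A,B,C}\otimes1)=\delta^l_{A,BD,CD}(1\otimes\delta^r_{B,C,D})\alpha^\otimes_{A,B\oplus C,D}$; $\mu(\delta^l_{A,C,D}\oplus\delta^l_{B,C,D})\delta^r_{A,B,C\oplus D}=(\delta^r_{A,B,C}\oplus\delta^r_{A,B,D})\delta^l_{A\oplus B,C,D}$, where $\mu:(AC\oplus AD)\oplus(BC\oplus BD)\to(AC\oplus BC)\oplus(AD\oplus BD)$ is the coherence isomorphism exchanging the two middle summands; $\lambda^\bullet_0=\rho^\bullet_0$; $\lambda^\oplus_0(\lambda^\bullet_A\oplus\lambda^\bullet_B)\delta^l_{0,A,B}=\lambda^\bullet_{A\oplus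 B}$; $\lambda^\oplus_0(\rho^\bullet_A\oplus\rho^\bullet_B)\delta^r_{A,B,0}=\rho^\bullet_{A\oplus B}$; $\rho^\otimes_0=\lambda^\bullet_1$; $\lambda^\otimes_0=\rho^\bullet_1$; $\lambda^\bullet_{AB}\alpha^\otimes_{0,A,B}=\lambda^\bullet_B(\lambda^\bullet_A\otimes1)$; $\rho^\bullet_A(1\otimes\lambda^\bullet_B)\alpha^\otimes_{A,0,B}=\lambda^\bullet_B(\rho^\bullet_A\otimes1)$; $\rho^\bullet_A(1\otimes\rho^\bullet_B)\alpha^\otimes_{A,B,0}=\rho^\bullet_{AB}$; $\lambda^\oplus_{AB}(\rho^\bullet_A\oplus1)\delta^l_{A,0,B}=1\otimes\lambda^\oplus_B$; $\lambda^\oplus_{BA}(\lambda^\bullet_A\oplus1)\delta^r_{0,B,A}=\lambda^\oplus_B\otimes1$; $\rho^\oplus_{AB}(1\oplus\rho^\bullet_A)\delta^l_{A,B,0}=1\otimes\rho^\oplus_B$; $\rho^\oplus_{AB}(1\oplus\lambda^\bullet_B)\delta^r_{A,0,B}=\rho^\oplus_A\otimes1$; $(\lambda^\otimes_A\oplus\lambda^\otimes_B)\delta^l_{1,A,B}=\lambda^\otimes_{A\oplus B}$; $(\rho^\otimes_A\oplus\rho^\otimes_B)\delta^r_{A,B,1}=\rho^\otimes_{A\oplus B}$. A symmetric bimonoidal category is a bimonoidal category with a symmetry $\zeta^\otimes$ making $\otimes$ symmetric monoidal, such that $\delta^l_{C,A,B}\zeta^\otimes_{A\oplus B,C}=(\zeta^\otimes_{A,C}\oplus\zeta^\otimes_{B,C})\delta^r_{A,B,C}$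 and $\lambda^\bullet_A\zeta^\otimes_{A,0}=\rho^\bullet_A$. It is flat if every morphism in the following class is a monomorphism: the smallest class containing all components of $\delta^l,\delta^r$ and closed under $f\mapsto f\oplus1_A,\ 1_A\oplus f,\ f\otimes1_A,\ 1_A\otimes f$ for all objects $A$. A symmetric bimonoidal functor $F:C\to D$ is a functor with symmetric monoidal structures $(F^2_\oplus,F^0_\oplus)$ with respect to $\oplus$ and $(F^2_\otimes,F^0_\otimes)$ with respect to $\otimes$ (lax: $F^2_\otimes:FA\otimes FB\to F(A\otimes B)$, $F^0_\otimes:1\to F1$, similarly for $\oplus$) such that $F(\lambda^\bullet_A)F^2_\otimes(F^0_\oplus\otimes1_{FA})=F^0_\oplus\lambda^\bullet_{FA}$ and $F(\delta^l_{A,B,C})F^2_\otimes(1\otimes F^2_\oplus)=F^2_\oplus(F^2_\otimes\oplus F^2_\otimes)\delta^l_{FA,FB,FC}$. It is robust if $F^2_\oplus,F^0_\oplus,F^0_\otimes$ are isomorphisms. A bimonoidal natural transformation is a natural transformation that is monoidal with respect to both the $\oplus$ and the $\otimes$ structures. The category $\Sigma'$ has objects the integers $n\ge0$; $\Sigma'(n,n)$ is the symmetric group $\Sigma_n$ and there are no other morphisms. Sum: $m\oplus n=m+n$, block sum of permutations; $\zeta^\oplus_{m,n}$ swaps the two blocks. Product: $m\otimes n=mn$, where $(i,j)$ with $1\le i\le m$, $1\le j\le n$ is identified with $(i-1)n+j$, and $(\sigma\otimes\tau)(i,j)=(\sigma i,\tau j)$; $\zeta^\otimes_{m,n}(i,j)=(j,i)$.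 All associativity and unit isomorphisms, $\lambda^\bullet$, $\rho^\bullet$ and $\delta^r$ are identities; $\delta^l_{m,n,p}:m(n+p)\to mn+mp$ is the permutation sending $(i,j)$ with $j\le n$ to $(i-1)n+j$ and $(i,n+j)$ with $1\le j\le p$ to $mn+(i-1)p+j$. *)

theory Defs
  imports "HOL-Combinatorics.Permutations" "HOL-Library.FuncSet"
begin

section \<open>Categories, functors, natural transformations\<close>

text \<open>
  Categories are small: objects and arrows form sets of arbitrary types. Composition is written in applicative
  order. All structure maps are total functions on the ambient types; the axioms constrain them
  only on the carriers.
\<close>

record ('o, 'a) cat =
  Obj :: "'o set"
  Arr :: "'a set"
  Dom :: "'a \<Rightarrow> 'o"
  Cod :: "'a \<Rightarrow> 'o"
  Idn :: "'o \<Rightarrow> 'a"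
  Cmp :: "'a \<Rightarrow> 'a \<Rightarrow> 'a"  (infixr "\<cdot>\<index>" 55)

definition homset :: "('o, 'a, 'm) cat_scheme \<Rightarrow> 'o \<Rightarrow> 'o \<Rightarrow> 'a set" where
  "homset K A B = {f \<in> Arr K. Dom K f = A \<and> Cod K f = B}"

locale category =
  fixes K :: "('o, 'a, 'm) cat_scheme" (structure)
  assumes dom_obj: "f \<in> Arr K \<Longrightarrow> Dom K f \<in> Obj K"
    and cod_obj: "f \<in> Arr K \<Longrightarrow> Cod K f \<in> Obj K"
    and idn_hom: "A \<in> Obj K \<Longrightarrow> Idn K A \<in> homset K A A"
    and cmp_hom: "\<lbrakk>f \<in> homset K A B; g \<in> homset K B C\<rbrakk> \<Longrightarrow> g \<cdot> f \<in> homset K A C"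
    and cmp_assoc: "\<lbrakk>f \<in> homset K A B; g \<in> homset K B C; h \<in> homset K C D\<rbrakk>
      \<Longrightarrow> (h \<cdot> g) \<cdot> f = h \<cdot> (g \<cdot> f)"
    and idn_left: "f \<in> homset K A B \<Longrightarrow> Idn K B \<cdot> f = f"
    and idn_right: "f \<in> homset K A B \<Longrightarrow> f \<cdot> Idn K A = f"

definition inverse_arrows :: "('o, 'a, 'm) cat_scheme \<Rightarrow> 'a \<Rightarrow> 'a \<Rightarrow> bool" where
  "inverse_arrows K f g \<longleftrightarrow>
     f \<in> Arr K \<and> g \<in> homset K (Cod K f) (Dom K f) \<and>
     g \<cdot>\<^bsub>K\<^esub> f = Idn K (Dom K f) \<and> f \<cdot>\<^bsub>K\<^esub> g = Idn K (Cod K f)"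

definition is_iso :: "('o, 'a, 'm) cat_scheme \<Rightarrow> 'a \<Rightarrow> bool" where
  "is_iso K f \<longleftrightarrow> (\<exists>g. inverse_arrows K f g)"

definition inv_arr :: "('o, 'a, 'm) cat_scheme \<Rightarrow> 'a \<Rightarrow> 'a" where
  "inv_arr K f = (THE g. inverse_arrows K f g)"

definition is_mono :: "('o, 'a, 'm) cat_scheme \<Rightarrow> 'a \<Rightarrow> bool" where
  "is_mono K f \<longleftrightarrow> f \<in> Arr K \<and>
     (\<forall>X. \<forall>g \<in> homset K X (Dom K f). \<forall>h \<in> homset K X (Dom K f).
        f \<cdot>\<^bsub>K\<^esub> g = f \<cdot>\<^bsub>K\<^esub> h \<longrightarrow> g = h)"

text \<open>
  Functors and transformations are data on the carriers only, so they are required to be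
  \<open>undefined\<close> elsewhere: equality in HOL is then equality of functors
  (respectively transformations).
\<close>

record ('o, 'a, 'p, 'b) functor_data =
  FObj :: "'o \<Rightarrow> 'p"
  FArr :: "'a \<Rightarrow> 'b"

locale cat_functor = source: category K + target: category L
  for K :: "('o, 'a, 'm) cat_scheme" and L :: "('p, 'b, 'n) cat_scheme" +
  fixes F :: "('o, 'a, 'p, 'b, 'f) functor_data_scheme"
  assumes fobj: "A \<in> Obj K \<Longrightarrow> FObj F A \<in> Obj L"
    and farr: "f \<in> homset K A B \<Longrightarrow> FArr F f \<in> homset L (FObj F A) (FObj F B)"
    and fidn: "A \<in> Obj K \<Longrightarrow> FArr F (Idn K A) = Idn L (FObj F A)"
    and fcmp: "\<lbrakk>f \<in> homset K A B; g \<in> homset K B C\<rbrakk>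
      \<Longrightarrow> FArr F (g \<cdot>\<^bsub>K\<^esub> f) = FArr F g \<cdot>\<^bsub>L\<^esub> FArr F f"
    and fobj_ext: "FObj F \<in> extensional (Obj K)"
    and farr_ext: "FArr F \<in> extensional (Arr K)"

definition id_functor :: "('o, 'a, 'm) cat_scheme \<Rightarrow> ('o, 'a, 'o, 'a) functor_data" where
  "id_functor K = \<lparr>FObj = (\<lambda>A \<in> Obj K. A), FArr = (\<lambda>f \<in> Arr K. f)\<rparr>"

definition comp_functor :: "('o, 'a, 'm) cat_scheme \<Rightarrow> ('p, 'b, 'q, 'c) functor_data
    \<Rightarrow> ('o, 'a, 'p, 'b) functor_data \<Rightarrow> ('o, 'a, 'q, 'c) functor_data" where
  "comp_functor K G F =
     \<lparr>FObj = (\<lambda>A \<in> Obj K. FObj G (FObj F A)), FArr = (\<lambda>f \<in> Arr K. FArr G (FArr F f))\<rparr>"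

locale natural_transformation = F: cat_functor K L F + G: cat_functor K L G
  for K :: "('o, 'a, 'm) cat_scheme" and L :: "('p, 'b, 'n) cat_scheme"
    and F :: "('o, 'a, 'p, 'b, 'f) functor_data_scheme"
    and G :: "('o, 'a, 'p, 'b, 'g) functor_data_scheme" +
  fixes \<eta> :: "'o \<Rightarrow> 'b"
  assumes component: "A \<in> Obj K \<Longrightarrow> \<eta> A \<in> homset L (FObj F A) (FObj G A)"
    and naturality: "f \<in> homset K A B \<Longrightarrow> \<eta> B \<cdot>\<^bsub>L\<^esub> FArr F f = FArr G f \<cdot>\<^bsub>L\<^esub> \<eta> A"
    and component_ext: "\<eta> \<in> extensional (Obj K)"

locale natural_isomorphism = natural_transformation +
  assumes component_iso: "A \<in> Obj K \<Longrightarrow> is_iso L (\<eta> A)"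

definition equivalence_of_categories :: "('o, 'a, 'm) cat_scheme \<Rightarrow> ('p, 'b, 'n) cat_scheme
    \<Rightarrow> ('o, 'a, 'p, 'b) functor_data \<Rightarrow> bool" where
  "equivalence_of_categories K L F \<longleftrightarrow>
     cat_functor K L F \<and>
     (\<exists>G. cat_functor L K G \<and>
          (\<exists>\<eta>. natural_isomorphism K K (id_functor K) (comp_functor K G F) \<eta>) \<and>
          (\<exists>\<epsilon>. natural_isomorphism L L (comp_functor L F G) (id_functor L) \<epsilon>))"

definition terminal_cat :: "(unit, unit) cat" where
  "terminal_cat = \<lparr>Obj = UNIV, Arr = UNIV, Dom = (\<lambda>_. ()), Cod = (\<lambda>_. ()),
     Idn = (\<lambda>_. ()), Cmp = (\<lambda>_ _. ())\<rparr>"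


section \<open>Monoidal and symmetric monoidal categories\<close>

record ('o, 'a) monoidal_structure =
  TObj :: "'o \<Rightarrow> 'o \<Rightarrow> 'o"  (infixr "\<odot>\<index>" 70)
  TArr :: "'a \<Rightarrow> 'a \<Rightarrow> 'a"  (infixr "\<odot>\<^sub>a\<index>" 70)
  Unit :: "'o"
  Assoc :: "'o \<Rightarrow> 'o \<Rightarrow> 'o \<Rightarrow> 'a"
  LUnit :: "'o \<Rightarrow> 'a"
  RUnit :: "'o \<Rightarrow> 'a"

locale monoidal_category = category K
  for K :: "('o, 'a, 'm) cat_scheme" (structure) +
  fixes M :: "('o, 'a) monoidal_structure"
  assumes tobj: "\<lbrakk>A \<in> Obj K; B \<in> Obj K\<rbrakk> \<Longrightarrow> A \<odot>\<^bsub>M\<^esub> B \<in> Obj K"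
    and tarr: "\<lbrakk>f \<in> homset K A A'; g \<in> homset K B B'\<rbrakk>
      \<Longrightarrow> f \<odot>\<^sub>a\<^bsub>M\<^esub> g \<in> homset K (A \<odot>\<^bsub>M\<^esub> B) (A' \<odot>\<^bsub>M\<^esub> B')"
    and tidn: "\<lbrakk>A \<in> Obj K; B \<in> Obj K\<rbrakk>
      \<Longrightarrow> Idn K A \<odot>\<^sub>a\<^bsub>M\<^esub> Idn K B = Idn K (A \<odot>\<^bsub>M\<^esub> B)"
    and tcmp: "\<lbrakk>f \<in> homset K A A'; f' \<in> homset K A' A''; g \<in> homset K B B'; g' \<in> homset K B' B''\<rbrakk>
      \<Longrightarrow> (f' \<cdot> f) \<odot>\<^sub>a\<^bsub>M\<^esub> (g' \<cdot> g) = (f' \<odot>\<^sub>a\<^bsub>M\<^esub> g') \<cdot> (f \<odot>\<^sub>a\<^bsub>M\<^esub> g)"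
    and unit_obj: "Unit M \<in> Obj K"
    and assoc_hom: "\<lbrakk>A \<in> Obj K; B \<in> Obj K; C \<in> Obj K\<rbrakk>
      \<Longrightarrow> Assoc M A B C \<in> homset K ((A \<odot>\<^bsub>M\<^esub> B) \<odot>\<^bsub>M\<^esub> C) (A \<odot>\<^bsub>M\<^esub> (B \<odot>\<^bsub>M\<^esub> C))"
    and assoc_iso: "\<lbrakk>A \<in> Obj K; B \<in> Obj K; C \<in> Obj K\<rbrakk> \<Longrightarrow> is_iso K (Assoc M A B C)"
    and assoc_nat: "\<lbrakk>f \<in> homset K A A'; g \<in> homset K B B'; h \<in> homset K C C'\<rbrakk>
      \<Longrightarrow> Assoc M A' B' C' \<cdot> ((f \<odot>\<^sub>a\<^bsub>M\<^esub> g) \<odot>\<^sub>a\<^bsub>M\<^esub> h)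
        = (f \<odot>\<^sub>a\<^bsub>M\<^esub> (g \<odot>\<^sub>a\<^bsub>M\<^esub> h)) \<cdot> Assoc M A B C"
    and lunit_hom: "A \<in> Obj K \<Longrightarrow> LUnit M A \<in> homset K (Unit M \<odot>\<^bsub>M\<^esub> A) A"
    and lunit_iso: "A \<in> Obj K \<Longrightarrow> is_iso K (LUnit M A)"
    and lunit_nat: "f \<in> homset K A B
      \<Longrightarrow> LUnit M B \<cdot> (Idn K (Unit M) \<odot>\<^sub>a\<^bsub>M\<^esub> f) = f \<cdot> LUnit M A"
    and runit_hom: "A \<in> Obj K \<Longrightarrow> RUnit M A \<in> homset K (A \<odot>\<^bsub>M\<^esub> Unit M) A"
    and runit_iso: "A \<in> Obj K \<Longrightarrow> is_iso K (RUnit M A)"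
    and runit_nat: "f \<in> homset K A B
      \<Longrightarrow> RUnit M B \<cdot> (f \<odot>\<^sub>a\<^bsub>M\<^esub> Idn K (Unit M)) = f \<cdot> RUnit M A"
    and pentagon: "\<lbrakk>A \<in> Obj K; B \<in> Obj K; C \<in> Obj K; D \<in> Obj K\<rbrakk>
      \<Longrightarrow> (Idn K A \<odot>\<^sub>a\<^bsub>M\<^esub> Assoc M B C D) \<cdot> Assoc M A (B \<odot>\<^bsub>M\<^esub> C) D
            \<cdot> (Assoc M A B C \<odot>\<^sub>a\<^bsub>M\<^esub> Idn K D)
        = Assoc M A B (C \<odot>\<^bsub>M\<^esub> D) \<cdot> Assoc M (A \<odot>\<^bsub>M\<^esub> B) C D"
    and triangle: "\<lbrakk>A \<in> Obj K; B \<in> Obj K\<rbrakk>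
      \<Longrightarrow> (Idn K A \<odot>\<^sub>a\<^bsub>M\<^esub> LUnit M B) \<cdot> Assoc M A (Unit M) B = RUnit M A \<odot>\<^sub>a\<^bsub>M\<^esub> Idn K B"

locale symmetric_monoidal_category = monoidal_category K M
  for K :: "('o, 'a, 'm) cat_scheme" (structure) and M :: "('o, 'a) monoidal_structure" +
  fixes z :: "'o \<Rightarrow> 'o \<Rightarrow> 'a"
  assumes sym_hom: "\<lbrakk>A \<in> Obj K; B \<in> Obj K\<rbrakk> \<Longrightarrow> z A B \<in> homset K (A \<odot>\<^bsub>M\<^esub> B) (B \<odot>\<^bsub>M\<^esub> A)"
    and sym_nat: "\<lbrakk>f \<in> homset K A A'; g \<in> homset K B B'\<rbrakk>
      \<Longrightarrow> z A' B' \<cdot> (f \<odot>\<^sub>a\<^bsub>M\<^esub> g) = (g \<odot>\<^sub>a\<^bsub>M\<^esub> f) \<cdot> z A B"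
    and sym_inv: "\<lbrakk>A \<in> Obj K; B \<in> Obj K\<rbrakk> \<Longrightarrow> z B A \<cdot> z A B = Idn K (A \<odot>\<^bsub>M\<^esub> B)"
    and sym_unit: "A \<in> Obj K \<Longrightarrow> LUnit M A \<cdot> z A (Unit M) = RUnit M A"
    and hexagon: "\<lbrakk>A \<in> Obj K; B \<in> Obj K; C \<in> Obj K\<rbrakk>
      \<Longrightarrow> Assoc M B C A \<cdot> z A (B \<odot>\<^bsub>M\<^esub> C) \<cdot> Assoc M A B C
        = (Idn K B \<odot>\<^sub>a\<^bsub>M\<^esub> z A C) \<cdot> Assoc M B A C \<cdot> (z A B \<odot>\<^sub>a\<^bsub>M\<^esub> Idn K C)"

text \<open>Lax symmetric monoidal functors.\<close>

locale symmetric_monoidal_functor =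
  source: symmetric_monoidal_category K M z + target: symmetric_monoidal_category L N w +
  cat_functor K L F
  for K :: "('o, 'a, 'm) cat_scheme" and M z
    and L :: "('p, 'b, 'n) cat_scheme" and N w
    and F :: "('o, 'a, 'p, 'b, 'f) functor_data_scheme" +
  fixes F2 :: "'o \<Rightarrow> 'o \<Rightarrow> 'b" and F0 :: "'b"
  assumes F2_hom: "\<lbrakk>A \<in> Obj K; B \<in> Obj K\<rbrakk>
      \<Longrightarrow> F2 A B \<in> homset L (FObj F A \<odot>\<^bsub>N\<^esub> FObj F B) (FObj F (A \<odot>\<^bsub>M\<^esub> B))"
    and F0_hom: "F0 \<in> homset L (Unit N) (FObj F (Unit M))"
    and F2_nat: "\<lbrakk>f \<in> homset K A A'; g \<in> homset K B B'\<rbrakk>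
      \<Longrightarrow> FArr F (f \<odot>\<^sub>a\<^bsub>M\<^esub> g) \<cdot>\<^bsub>L\<^esub> F2 A B = F2 A' B' \<cdot>\<^bsub>L\<^esub> (FArr F f \<odot>\<^sub>a\<^bsub>N\<^esub> FArr F g)"
    and F2_assoc: "\<lbrakk>A \<in> Obj K; B \<in> Obj K; C \<in> Obj K\<rbrakk>
      \<Longrightarrow> FArr F (Assoc M A B C) \<cdot>\<^bsub>L\<^esub> F2 (A \<odot>\<^bsub>M\<^esub> B) C
            \<cdot>\<^bsub>L\<^esub> (F2 A B \<odot>\<^sub>a\<^bsub>N\<^esub> Idn L (FObj F C))
        = F2 A (B \<odot>\<^bsub>M\<^esub> C) \<cdot>\<^bsub>L\<^esub> (Idn L (FObj F A) \<odot>\<^sub>a\<^bsub>N\<^esub> F2 B C)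
            \<cdot>\<^bsub>L\<^esub> Assoc N (FObj F A) (FObj F B) (FObj F C)"
    and F2_lunit: "A \<in> Obj K
      \<Longrightarrow> FArr F (LUnit M A) \<cdot>\<^bsub>L\<^esub> F2 (Unit M) A \<cdot>\<^bsub>L\<^esub> (F0 \<odot>\<^sub>a\<^bsub>N\<^esub> Idn L (FObj F A))
        = LUnit N (FObj F A)"
    and F2_runit: "A \<in> Obj K
      \<Longrightarrow> FArr F (RUnit M A) \<cdot>\<^bsub>L\<^esub> F2 A (Unit M) \<cdot>\<^bsub>L\<^esub> (Idn L (FObj F A) \<odot>\<^sub>a\<^bsub>N\<^esub> F0)
        = RUnit N (FObj F A)"
    and F2_sym: "\<lbrakk>A \<in> Obj K; B \<in> Obj K\<rbrakk>
      \<Longrightarrow> FArr F (z A B) \<cdot>\<^bsub>L\<^esub> F2 A B = F2 B A \<cdot>\<^bsub>L\<^esub> w (FObj F A) (FObj F B)"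
    and F2_ext: "A \<notin> Obj K \<or> B \<notin> Obj K \<Longrightarrow> F2 A B = undefined"


section \<open>Bimonoidal categories\<close>

record ('o, 'a) bimonoidal = "('o, 'a) cat" +
  Plus :: "('o, 'a) monoidal_structure"
  PlusSym :: "'o \<Rightarrow> 'o \<Rightarrow> 'a"
  Times :: "('o, 'a) monoidal_structure"
  LNull :: "'o \<Rightarrow> 'a"
  RNull :: "'o \<Rightarrow> 'a"
  LDist :: "'o \<Rightarrow> 'o \<Rightarrow> 'o \<Rightarrow> 'a"
  RDist :: "'o \<Rightarrow> 'o \<Rightarrow> 'o \<Rightarrow> 'a"

record ('o, 'a) symmetric_bimonoidal = "('o, 'a) bimonoidal" +
  TimesSym :: "'o \<Rightarrow> 'o \<Rightarrow> 'a"

locale bimonoidal_notation =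
  fixes K :: "('o, 'a, 'm) bimonoidal_scheme" (structure)
begin

abbreviation sum_obj (infixr "\<oplus>" 65) where "A \<oplus> B \<equiv> A \<odot>\<^bsub>Plus K\<^esub> B"
abbreviation sum_arr (infixr "\<oplus>\<^sub>a" 65) where "f \<oplus>\<^sub>a g \<equiv> f \<odot>\<^sub>a\<^bsub>Plus K\<^esub> g"
abbreviation prod_obj (infixr "\<otimes>" 70) where "A \<otimes> B \<equiv> A \<odot>\<^bsub>Times K\<^esub> B"
abbreviation prod_arr (infixr "\<otimes>\<^sub>a" 70) where "f \<otimes>\<^sub>a g \<equiv> f \<odot>\<^sub>a\<^bsub>Times K\<^esub> g"
abbreviation zero_obj ("\<zero>") where "\<zero> \<equiv> Unit (Plus K)"
abbreviation one_obj ("\<one>") where "\<one> \<equiv> Unit (Times K)"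
abbreviation identity ("\<iota>") where "\<iota> \<equiv> Idn K"
abbreviation alpha_plus ("\<alpha>\<^sup>\<oplus>") where "\<alpha>\<^sup>\<oplus> \<equiv> Assoc (Plus K)"
abbreviation lambda_plus ("\<lambda>\<^sup>\<oplus>") where "\<lambda>\<^sup>\<oplus> \<equiv> LUnit (Plus K)"
abbreviation rho_plus ("\<rho>\<^sup>\<oplus>") where "\<rho>\<^sup>\<oplus> \<equiv> RUnit (Plus K)"
abbreviation zeta_plus ("\<zeta>\<^sup>\<oplus>") where "\<zeta>\<^sup>\<oplus> \<equiv> PlusSym K"
abbreviation alpha_times ("\<alpha>\<^sup>\<otimes>") where "\<alpha>\<^sup>\<otimes> \<equiv> Assoc (Times K)"
abbreviation lambda_times ("\<lambda>\<^sup>\<otimes>") where "\<lambda>\<^sup>\<otimes> \<equiv> LUnit (Times K)"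
abbreviation rho_times ("\<rho>\<^sup>\<otimes>") where "\<rho>\<^sup>\<otimes> \<equiv> RUnit (Times K)"
abbreviation lambda_null ("\<lambda>\<^sup>\<bullet>") where "\<lambda>\<^sup>\<bullet> \<equiv> LNull K"
abbreviation rho_null ("\<rho>\<^sup>\<bullet>") where "\<rho>\<^sup>\<bullet> \<equiv> RNull K"
abbreviation delta_left ("\<delta>\<^sup>l") where "\<delta>\<^sup>l \<equiv> LDist K"
abbreviation delta_right ("\<delta>\<^sup>r") where "\<delta>\<^sup>r \<equiv> RDist K"

text \<open>
  The coherence isomorphism
  \<open>(W \<oplus> X) \<oplus> (Y \<oplus> Z) \<rightarrow> (W \<oplus> Y) \<oplus> (X \<oplus> Z)\<close> exchanging the middle summands.
\<close>

definition mid_swap :: "'o \<Rightarrow> 'o \<Rightarrow> 'o \<Rightarrow> 'o \<Rightarrow> 'a" ("\<mu>") where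
  "\<mu> W X Y Z =
     inv_arr K (\<alpha>\<^sup>\<oplus> W Y (X \<oplus> Z))
     \<cdot> (\<iota> W \<oplus>\<^sub>a (\<alpha>\<^sup>\<oplus> Y X Z \<cdot> (\<zeta>\<^sup>\<oplus> X Y \<oplus>\<^sub>a \<iota> Z) \<cdot> inv_arr K (\<alpha>\<^sup>\<oplus> X Y Z)))
     \<cdot> \<alpha>\<^sup>\<oplus> W X (Y \<oplus> Z)"

end

locale bimonoidal_category = bimonoidal_notation K +
  plus: symmetric_monoidal_category K "Plus K" "PlusSym K" +
  times: monoidal_category K "Times K"
  for K :: "('o, 'a, 'm) bimonoidal_scheme" (structure) +
  assumes lnull_hom: "A \<in> Obj K \<Longrightarrow> \<lambda>\<^sup>\<bullet> A \<in> homset K (\<zero> \<otimes> A) \<zero>"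
    and lnull_iso: "A \<in> Obj K \<Longrightarrow> is_iso K (\<lambda>\<^sup>\<bullet> A)"
    and lnull_nat: "f \<in> homset K A B \<Longrightarrow> \<lambda>\<^sup>\<bullet> B \<cdot> (\<iota> \<zero> \<otimes>\<^sub>a f) = \<lambda>\<^sup>\<bullet> A"
    and rnull_hom: "A \<in> Obj K \<Longrightarrow> \<rho>\<^sup>\<bullet> A \<in> homset K (A \<otimes> \<zero>) \<zero>"
    and rnull_iso: "A \<in> Obj K \<Longrightarrow> is_iso K (\<rho>\<^sup>\<bullet> A)"
    and rnull_nat: "f \<in> homset K A B \<Longrightarrow> \<rho>\<^sup>\<bullet> B \<cdot> (f \<otimes>\<^sub>a \<iota> \<zero>) = \<rho>\<^sup>\<bullet> A"
    and ldist_hom: "\<lbrakk>A \<in> Obj K; B \<in> Obj K; C \<in> Obj K\<rbrakk>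
      \<Longrightarrow> \<delta>\<^sup>l A B C \<in> homset K (A \<otimes> (B \<oplus> C)) (A \<otimes> B \<oplus> A \<otimes> C)"
    and ldist_mono: "\<lbrakk>A \<in> Obj K; B \<in> Obj K; C \<in> Obj K\<rbrakk> \<Longrightarrow> is_mono K (\<delta>\<^sup>l A B C)"
    and ldist_nat: "\<lbrakk>f \<in> homset K A A'; g \<in> homset K B B'; h \<in> homset K C C'\<rbrakk>
      \<Longrightarrow> \<delta>\<^sup>l A' B' C' \<cdot> (f \<otimes>\<^sub>a (g \<oplus>\<^sub>a h)) = (f \<otimes>\<^sub>a g \<oplus>\<^sub>a f \<otimes>\<^sub>a h) \<cdot> \<delta>\<^sup>l A B C"
    and rdist_hom: "\<lbrakk>A \<in> Obj K; B \<in> Obj K; C \<in> Obj K\<rbrakk>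
      \<Longrightarrow> \<delta>\<^sup>r A B C \<in> homset K ((A \<oplus> B) \<otimes> C) (A \<otimes> C \<oplus> B \<otimes> C)"
    and rdist_mono: "\<lbrakk>A \<in> Obj K; B \<in> Obj K; C \<in> Obj K\<rbrakk> \<Longrightarrow> is_mono K (\<delta>\<^sup>r A B C)"
    and rdist_nat: "\<lbrakk>f \<in> homset K A A'; g \<in> homset K B B'; h \<in> homset K C C'\<rbrakk>
      \<Longrightarrow> \<delta>\<^sup>r A' B' C' \<cdot> ((f \<oplus>\<^sub>a g) \<otimes>\<^sub>a h) = (f \<otimes>\<^sub>a h \<oplus>\<^sub>a g \<otimes>\<^sub>a h) \<cdot> \<delta>\<^sup>r A B C"
    and ldist_sym: "\<lbrakk>A \<in> Obj K; B \<in> Obj K; C \<in> Obj K\<rbrakk>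
      \<Longrightarrow> \<delta>\<^sup>l A C B \<cdot> (\<iota> A \<otimes>\<^sub>a \<zeta>\<^sup>\<oplus> B C) = \<zeta>\<^sup>\<oplus> (A \<otimes> B) (A \<otimes> C) \<cdot> \<delta>\<^sup>l A B C"
    and rdist_sym: "\<lbrakk>A \<in> Obj K; B \<in> Obj K; C \<in> Obj K\<rbrakk>
      \<Longrightarrow> \<delta>\<^sup>r B A C \<cdot> (\<zeta>\<^sup>\<oplus> A B \<otimes>\<^sub>a \<iota> C) = \<zeta>\<^sup>\<oplus> (A \<otimes> C) (B \<otimes> C) \<cdot> \<delta>\<^sup>r A B C"
    and rdist_plus_assoc: "\<lbrakk>A \<in> Obj K; B \<in> Obj K; C \<in> Obj K; D \<in> Obj K\<rbrakk>
      \<Longrightarrow> \<alpha>\<^sup>\<oplus> (A \<otimes> D) (B \<otimes> D) (C \<otimes> D) \<cdot> (\<delta>\<^sup>r A B D \<oplus>\<^sub>a \<iota> (C \<otimes> D)) \<cdot> \<delta>\<^sup>r (A \<oplus> B) C D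
        = (\<iota> (A \<otimes> D) \<oplus>\<^sub>a \<delta>\<^sup>r B C D) \<cdot> \<delta>\<^sup>r A (B \<oplus> C) D \<cdot> (\<alpha>\<^sup>\<oplus> A B C \<otimes>\<^sub>a \<iota> D)"
    and ldist_plus_assoc: "\<lbrakk>A \<in> Obj K; B \<in> Obj K; C \<in> Obj K; D \<in> Obj K\<rbrakk>
      \<Longrightarrow> \<alpha>\<^sup>\<oplus> (A \<otimes> B) (A \<otimes> C) (A \<otimes> D) \<cdot> (\<delta>\<^sup>l A B C \<oplus>\<^sub>a \<iota> (A \<otimes> D)) \<cdot> \<delta>\<^sup>l A (B \<oplus> C) D
        = (\<iota> (A \<otimes> B) \<oplus>\<^sub>a \<delta>\<^sup>l A C D) \<cdot> \<delta>\<^sup>l A B (C \<oplus> D) \<cdot> (\<iota> A \<otimes>\<^sub>a \<alpha>\<^sup>\<oplus> B C D)"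
    and ldist_times_assoc: "\<lbrakk>A \<in> Obj K; B \<in> Obj K; C \<in> Obj K; D \<in> Obj K\<rbrakk>
      \<Longrightarrow> \<delta>\<^sup>l A (B \<otimes> C) (B \<otimes> D) \<cdot> (\<iota> A \<otimes>\<^sub>a \<delta>\<^sup>l B C D) \<cdot> \<alpha>\<^sup>\<otimes> A B (C \<oplus> D)
        = (\<alpha>\<^sup>\<otimes> A B C \<oplus>\<^sub>a \<alpha>\<^sup>\<otimes> A B D) \<cdot> \<delta>\<^sup>l (A \<otimes> B) C D"
    and rdist_times_assoc: "\<lbrakk>A \<in> Obj K; B \<in> Obj K; C \<in> Obj K; D \<in> Obj K\<rbrakk>
      \<Longrightarrow> (\<alpha>\<^sup>\<otimes> A C D \<oplus>\<^sub>a \<alpha>\<^sup>\<otimes> B C D) \<cdot> \<delta>\<^sup>r (A \<otimes> C) (B \<otimes> C) D \<cdot> (\<delta>\<^sup>r A B C \<otimes>\<^sub>a \<iota> D)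
        = \<delta>\<^sup>r A B (C \<otimes> D) \<cdot> \<alpha>\<^sup>\<otimes> (A \<oplus> B) C D"
    and dist_times_assoc: "\<lbrakk>A \<in> Obj K; B \<in> Obj K; C \<in> Obj K; D \<in> Obj K\<rbrakk>
      \<Longrightarrow> (\<alpha>\<^sup>\<otimes> A B D \<oplus>\<^sub>a \<alpha>\<^sup>\<otimes> A C D) \<cdot> \<delta>\<^sup>r (A \<otimes> B) (A \<otimes> C) D \<cdot> (\<delta>\<^sup>l A B C \<otimes>\<^sub>a \<iota> D)
        = \<delta>\<^sup>l A (B \<otimes> D) (C \<otimes> D) \<cdot> (\<iota> A \<otimes>\<^sub>a \<delta>\<^sup>r B C D) \<cdot> \<alpha>\<^sup>\<otimes> A (B \<oplus> C) D"
    and dist_dist: "\<lbrakk>A \<in> Obj K; B \<in> Obj K; C \<in> Obj K; D \<in> Obj K\<rbrakk>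
      \<Longrightarrow> \<mu> (A \<otimes> C) (A \<otimes> D) (B \<otimes> C) (B \<otimes> D)
            \<cdot> (\<delta>\<^sup>l A C D \<oplus>\<^sub>a \<delta>\<^sup>l B C D) \<cdot> \<delta>\<^sup>r A B (C \<oplus> D)
        = (\<delta>\<^sup>r A B C \<oplus>\<^sub>a \<delta>\<^sup>r A B D) \<cdot> \<delta>\<^sup>l (A \<oplus> B) C D"
    and null_zero: "\<lambda>\<^sup>\<bullet> \<zero> = \<rho>\<^sup>\<bullet> \<zero>"
    and lnull_plus: "\<lbrakk>A \<in> Obj K; B \<in> Obj K\<rbrakk>
      \<Longrightarrow> \<lambda>\<^sup>\<oplus> \<zero> \<cdot> (\<lambda>\<^sup>\<bullet> A \<oplus>\<^sub>a \<lambda>\<^sup>\<bullet> B) \<cdot> \<delta>\<^sup>l \<zero> A B = \<lambda>\<^sup>\<bullet> (A \<oplus> B)"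
    and rnull_plus: "\<lbrakk>A \<in> Obj K; B \<in> Obj K\<rbrakk>
      \<Longrightarrow> \<lambda>\<^sup>\<oplus> \<zero> \<cdot> (\<rho>\<^sup>\<bullet> A \<oplus>\<^sub>a \<rho>\<^sup>\<bullet> B) \<cdot> \<delta>\<^sup>r A B \<zero> = \<rho>\<^sup>\<bullet> (A \<oplus> B)"
    and lnull_one: "\<rho>\<^sup>\<otimes> \<zero> = \<lambda>\<^sup>\<bullet> \<one>"
    and rnull_one: "\<lambda>\<^sup>\<otimes> \<zero> = \<rho>\<^sup>\<bullet> \<one>"
    and lnull_times: "\<lbrakk>A \<in> Obj K; B \<in> Obj K\<rbrakk>
      \<Longrightarrow> \<lambda>\<^sup>\<bullet> (A \<otimes> B) \<cdot> \<alpha>\<^sup>\<otimes> \<zero> A B = \<lambda>\<^sup>\<bullet> B \<cdot> (\<lambda>\<^sup>\<bullet> A \<otimes>\<^sub>a \<iota> B)"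
    and null_times: "\<lbrakk>A \<in> Obj K; B \<in> Obj K\<rbrakk>
      \<Longrightarrow> \<rho>\<^sup>\<bullet> A \<cdot> (\<iota> A \<otimes>\<^sub>a \<lambda>\<^sup>\<bullet> B) \<cdot> \<alpha>\<^sup>\<otimes> A \<zero> B = \<lambda>\<^sup>\<bullet> B \<cdot> (\<rho>\<^sup>\<bullet> A \<otimes>\<^sub>a \<iota> B)"
    and rnull_times: "\<lbrakk>A \<in> Obj K; B \<in> Obj K\<rbrakk>
      \<Longrightarrow> \<rho>\<^sup>\<bullet> A \<cdot> (\<iota> A \<otimes>\<^sub>a \<rho>\<^sup>\<bullet> B) \<cdot> \<alpha>\<^sup>\<otimes> A B \<zero> = \<rho>\<^sup>\<bullet> (A \<otimes> B)"
    and ldist_zero_left: "\<lbrakk>A \<in> Obj K; B \<in> Obj K\<rbrakk>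
      \<Longrightarrow> \<lambda>\<^sup>\<oplus> (A \<otimes> B) \<cdot> (\<rho>\<^sup>\<bullet> A \<oplus>\<^sub>a \<iota> (A \<otimes> B)) \<cdot> \<delta>\<^sup>l A \<zero> B = \<iota> A \<otimes>\<^sub>a \<lambda>\<^sup>\<oplus> B"
    and rdist_zero_left: "\<lbrakk>A \<in> Obj K; B \<in> Obj K\<rbrakk>
      \<Longrightarrow> \<lambda>\<^sup>\<oplus> (B \<otimes> A) \<cdot> (\<lambda>\<^sup>\<bullet> A \<oplus>\<^sub>a \<iota> (B \<otimes> A)) \<cdot> \<delta>\<^sup>r \<zero> B A = \<lambda>\<^sup>\<oplus> B \<otimes>\<^sub>a \<iota> A"
    and ldist_zero_right: "\<lbrakk>A \<in> Obj K; B \<in> Obj K\<rbrakk>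
      \<Longrightarrow> \<rho>\<^sup>\<oplus> (A \<otimes> B) \<cdot> (\<iota> (A \<otimes> B) \<oplus>\<^sub>a \<rho>\<^sup>\<bullet> A) \<cdot> \<delta>\<^sup>l A B \<zero> = \<iota> A \<otimes>\<^sub>a \<rho>\<^sup>\<oplus> B"
    and rdist_zero_right: "\<lbrakk>A \<in> Obj K; B \<in> Obj K\<rbrakk>
      \<Longrightarrow> \<rho>\<^sup>\<oplus> (A \<otimes> B) \<cdot> (\<iota> (A \<otimes> B) \<oplus>\<^sub>a \<lambda>\<^sup>\<bullet> B) \<cdot> \<delta>\<^sup>r A \<zero> B = \<rho>\<^sup>\<oplus> A \<otimes>\<^sub>a \<iota> B"
    and ldist_one: "\<lbrakk>A \<in> Obj K; B \<in> Obj K\<rbrakk>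
      \<Longrightarrow> (\<lambda>\<^sup>\<otimes> A \<oplus>\<^sub>a \<lambda>\<^sup>\<otimes> B) \<cdot> \<delta>\<^sup>l \<one> A B = \<lambda>\<^sup>\<otimes> (A \<oplus> B)"
    and rdist_one: "\<lbrakk>A \<in> Obj K; B \<in> Obj K\<rbrakk>
      \<Longrightarrow> (\<rho>\<^sup>\<otimes> A \<oplus>\<^sub>a \<rho>\<^sup>\<otimes> B) \<cdot> \<delta>\<^sup>r A B \<one> = \<rho>\<^sup>\<otimes> (A \<oplus> B)"

locale symmetric_bimonoidal_category = bimonoidal_category K +
  times: symmetric_monoidal_category K "Times K" "TimesSym K"
  for K :: "('o, 'a, 'm) symmetric_bimonoidal_scheme" (structure) +
  assumes dist_times_sym: "\<lbrakk>A \<in> Obj K; B \<in> Obj K; C \<in> Obj K\<rbrakk>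
      \<Longrightarrow> \<delta>\<^sup>l C A B \<cdot> TimesSym K (A \<oplus> B) C
        = (TimesSym K A C \<oplus>\<^sub>a TimesSym K B C) \<cdot> \<delta>\<^sup>r A B C"
    and null_times_sym: "A \<in> Obj K \<Longrightarrow> \<lambda>\<^sup>\<bullet> A \<cdot> TimesSym K A \<zero> = \<rho>\<^sup>\<bullet> A"

inductive_set flat_class :: "('o, 'a, 'm) bimonoidal_scheme \<Rightarrow> 'a set"
  for K :: "('o, 'a, 'm) bimonoidal_scheme" where
  ldist: "\<lbrakk>A \<in> Obj K; B \<in> Obj K; C \<in> Obj K\<rbrakk> \<Longrightarrow> LDist K A B C \<in> flat_class K"
| rdist: "\<lbrakk>A \<in> Obj K; B \<in> Obj K; C \<in> Obj K\<rbrakk> \<Longrightarrow> RDist K A B C \<in> flat_class K"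
| plus_right: "\<lbrakk>f \<in> flat_class K; A \<in> Obj K\<rbrakk> \<Longrightarrow> f \<odot>\<^sub>a\<^bsub>Plus K\<^esub> Idn K A \<in> flat_class K"
| plus_left: "\<lbrakk>f \<in> flat_class K; A \<in> Obj K\<rbrakk> \<Longrightarrow> Idn K A \<odot>\<^sub>a\<^bsub>Plus K\<^esub> f \<in> flat_class K"
| times_right: "\<lbrakk>f \<in> flat_class K; A \<in> Obj K\<rbrakk> \<Longrightarrow> f \<odot>\<^sub>a\<^bsub>Times K\<^esub> Idn K A \<in> flat_class K"
| times_left: "\<lbrakk>f \<in> flat_class K; A \<in> Obj K\<rbrakk> \<Longrightarrow> Idn K A \<odot>\<^sub>a\<^bsub>Times K\<^esub> f \<in> flat_class K"

locale flat_symmetric_bimonoidal_category = symmetric_bimonoidal_category +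
  assumes flat: "f \<in> flat_class K \<Longrightarrow> is_mono K f"


section \<open>Bimonoidal functors and transformations\<close>

record ('o, 'a, 'p, 'b) bifunctor_data = "('o, 'a, 'p, 'b) functor_data" +
  F2Plus :: "'o \<Rightarrow> 'o \<Rightarrow> 'b"
  F0Plus :: "'b"
  F2Times :: "'o \<Rightarrow> 'o \<Rightarrow> 'b"
  F0Times :: "'b"

locale symmetric_bimonoidal_functor =
  source: symmetric_bimonoidal_category K + target: symmetric_bimonoidal_category L +
  plus: symmetric_monoidal_functor K "Plus K" "PlusSym K" L "Plus L" "PlusSym L"
    F "F2Plus F" "F0Plus F" +
  times: symmetric_monoidal_functor K "Times K" "TimesSym K" L "Times L" "TimesSym L"
    F "F2Times F" "F0Times F"
  for K :: "('o, 'a, 'm) symmetric_bimonoidal_scheme"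
    and L :: "('p, 'b, 'n) symmetric_bimonoidal_scheme"
    and F :: "('o, 'a, 'p, 'b) bifunctor_data" +
  assumes preserves_lnull: "A \<in> Obj K
      \<Longrightarrow> FArr F (LNull K A) \<cdot>\<^bsub>L\<^esub> F2Times F (Unit (Plus K)) A
            \<cdot>\<^bsub>L\<^esub> (F0Plus F \<odot>\<^sub>a\<^bsub>Times L\<^esub> Idn L (FObj F A))
        = F0Plus F \<cdot>\<^bsub>L\<^esub> LNull L (FObj F A)"
    and preserves_ldist: "\<lbrakk>A \<in> Obj K; B \<in> Obj K; C \<in> Obj K\<rbrakk>
      \<Longrightarrow> FArr F (LDist K A B C) \<cdot>\<^bsub>L\<^esub> F2Times F A (B \<odot>\<^bsub>Plus K\<^esub> C)
            \<cdot>\<^bsub>L\<^esub> (Idn L (FObj F A) \<odot>\<^sub>a\<^bsub>Times L\<^esub> F2Plus F B C)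
        = F2Plus F (A \<odot>\<^bsub>Times K\<^esub> B) (A \<odot>\<^bsub>Times K\<^esub> C)
            \<cdot>\<^bsub>L\<^esub> (F2Times F A B \<odot>\<^sub>a\<^bsub>Plus L\<^esub> F2Times F A C)
            \<cdot>\<^bsub>L\<^esub> LDist L (FObj F A) (FObj F B) (FObj F C)"

locale robust_symmetric_bimonoidal_functor = symmetric_bimonoidal_functor +
  assumes F2Plus_iso: "\<lbrakk>A \<in> Obj K; B \<in> Obj K\<rbrakk> \<Longrightarrow> is_iso L (F2Plus F A B)"
    and F0Plus_iso: "is_iso L (F0Plus F)"
    and F0Times_iso: "is_iso L (F0Times F)"

locale bimonoidal_transformation =
  F: symmetric_bimonoidal_functor K L F + G: symmetric_bimonoidal_functor K L G +
  natural_transformation K L F G \<eta>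
  for K :: "('o, 'a, 'm) symmetric_bimonoidal_scheme"
    and L :: "('p, 'b, 'n) symmetric_bimonoidal_scheme" and F G \<eta> +
  assumes plus_2: "\<lbrakk>A \<in> Obj K; B \<in> Obj K\<rbrakk>
      \<Longrightarrow> \<eta> (A \<odot>\<^bsub>Plus K\<^esub> B) \<cdot>\<^bsub>L\<^esub> F2Plus F A B = F2Plus G A B \<cdot>\<^bsub>L\<^esub> (\<eta> A \<odot>\<^sub>a\<^bsub>Plus L\<^esub> \<eta> B)"
    and plus_0: "\<eta> (Unit (Plus K)) \<cdot>\<^bsub>L\<^esub> F0Plus F = F0Plus G"
    and times_2: "\<lbrakk>A \<in> Obj K; B \<in> Obj K\<rbrakk>
      \<Longrightarrow> \<eta> (A \<odot>\<^bsub>Times K\<^esub> B) \<cdot>\<^bsub>L\<^esub> F2Times F A B = F2Times G A B \<cdot>\<^bsub>L\<^esub> (\<eta> A \<odot>\<^sub>a\<^bsub>Times L\<^esub> \<eta> B)"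
    and times_0: "\<eta> (Unit (Times K)) \<cdot>\<^bsub>L\<^esub> F0Times F = F0Times G"

text \<open>
  The category of robust symmetric bimonoidal functors \<open>K \<rightarrow> L\<close> and bimonoidal
  transformations, under vertical composition. An arrow records its source and target.
\<close>

definition robust_functor_cat :: "('o, 'a) symmetric_bimonoidal \<Rightarrow> ('p, 'b) symmetric_bimonoidal \<Rightarrow>
    (('o, 'a, 'p, 'b) bifunctor_data,
     ('o, 'a, 'p, 'b) bifunctor_data \<times> ('o \<Rightarrow> 'b) \<times> ('o, 'a, 'p, 'b) bifunctor_data) cat" where
  "robust_functor_cat K L =
     \<lparr>Obj = {F. robust_symmetric_bimonoidal_functor K L F},
      Arr = {(F, \<eta>, G). robust_symmetric_bimonoidal_functor K L F \<and>
               robust_symmetric_bimonoidal_functor K L G \<and> bimonoidal_transformation K L F G \<eta>},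
      Dom = (\<lambda>(F, \<eta>, G). F),
      Cod = (\<lambda>(F, \<eta>, G). G),
      Idn = (\<lambda>F. (F, (\<lambda>A \<in> Obj K. Idn L (FObj F A)), F)),
      Cmp = (\<lambda>(G', \<theta>, H) (F, \<eta>, G). (F, (\<lambda>A \<in> Obj K. \<theta> A \<cdot>\<^bsub>L\<^esub> \<eta> A), H))\<rparr>"


section \<open>The finite ordinal category\<close>

text \<open>
  An arrow \<open>n \<rightarrow> n\<close> is a pair \<open>(n, \<sigma>)\<close> with \<open>\<sigma>\<close> permuting \<open>{1..n}\<close> and fixing every
  other number. The pair \<open>(i, j)\<close> in \<open>{1..m} \<times> {1..n}\<close> is identified with
  \<open>(i - 1) * n + j\<close>; \<open>row n\<close> and \<open>col n\<close> recover \<open>i\<close> and \<open>j\<close>.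
\<close>

definition perm_arr :: "nat \<Rightarrow> (nat \<Rightarrow> nat) \<Rightarrow> nat \<times> (nat \<Rightarrow> nat)" where
  "perm_arr n f = (n, \<lambda>k. if k \<in> {1..n} then f k else k)"

definition pair_ix :: "nat \<Rightarrow> nat \<Rightarrow> nat \<Rightarrow> nat" where
  "pair_ix n i j = (i - 1) * n + j"

definition row :: "nat \<Rightarrow> nat \<Rightarrow> nat" where
  "row n k = (k - 1) div n + 1"

definition col :: "nat \<Rightarrow> nat \<Rightarrow> nat" where
  "col n k = (k - 1) mod n + 1"

definition block_sum :: "nat \<times> (nat \<Rightarrow> nat) \<Rightarrow> nat \<times> (nat \<Rightarrow> nat) \<Rightarrow> nat \<times> (nat \<Rightarrow> nat)" where
  "block_sum = (\<lambda>(m, \<sigma>) (n, \<tau>).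
     perm_arr (m + n) (\<lambda>k. if k \<le> m then \<sigma> k else m + \<tau> (k - m)))"

definition block_swap :: "nat \<Rightarrow> nat \<Rightarrow> nat \<times> (nat \<Rightarrow> nat)" where
  "block_swap m n = perm_arr (m + n) (\<lambda>k. if k \<le> m then n + k else k - m)"

definition perm_prod :: "nat \<times> (nat \<Rightarrow> nat) \<Rightarrow> nat \<times> (nat \<Rightarrow> nat) \<Rightarrow> nat \<times> (nat \<Rightarrow> nat)" where
  "perm_prod = (\<lambda>(m, \<sigma>) (n, \<tau>).
     perm_arr (m * n) (\<lambda>k. pair_ix n (\<sigma> (row n k)) (\<tau> (col n k))))"

definition pair_swap :: "nat \<Rightarrow> nat \<Rightarrow> nat \<times> (nat \<Rightarrow> nat)" where
  "pair_swap m n = perm_arr (m * n) (\<lambda>k. pair_ix m (col n k) (row n k))"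

definition left_distr :: "nat \<Rightarrow> nat \<Rightarrow> nat \<Rightarrow> nat \<times> (nat \<Rightarrow> nat)" where
  "left_distr m n p = perm_arr (m * (n + p)) (\<lambda>k.
     let i = row (n + p) k; j = col (n + p) k
     in if j \<le> n then pair_ix n i j else m * n + pair_ix p i (j - n))"

definition finord :: "(nat, nat \<times> (nat \<Rightarrow> nat)) symmetric_bimonoidal" where
  "finord =
     \<lparr>Obj = UNIV,
      Arr = {(n, \<sigma>). \<sigma> permutes {1..n}},
      Dom = fst,
      Cod = fst,
      Idn = (\<lambda>n. (n, id)),
      Cmp = (\<lambda>(n, \<sigma>) (m, \<tau>). (m, \<sigma> \<circ> \<tau>)),
      Plus = \<lparr>TObj = (+), TArr = block_sum, Unit = 0,
        Assoc = (\<lambda>m n p. (m + n + p, id)), LUnit = (\<lambda>n. (n, id)), RUnit = (\<lambda>n. (n, id))\<rparr>,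
      PlusSym = block_swap,
      Times = \<lparr>TObj = (*), TArr = perm_prod, Unit = 1,
        Assoc = (\<lambda>m n p. (m * n * p, id)), LUnit = (\<lambda>n. (n, id)), RUnit = (\<lambda>n. (n, id))\<rparr>,
      LNull = (\<lambda>n. (0, id)),
      RNull = (\<lambda>n. (0, id)),
      LDist = left_distr,
      RDist = (\<lambda>m n p. ((m + n) * p, id)),
      TimesSym = pair_swap\<rparr>"

end

theory Submission
  imports Defs
begin

text \<open>
  Two facts carry the proof: there is a robust symmetric bimonoidal functor from \<open>finord\<close> to
  \<open>C\<close> (\<open>numeral_functor_robust\<close>), and between any two such functors there is exactly
  one bimonoidal transformation (\<open>unique_bimonoidal_transformation\<close>). A category with an object
  and exactly one arrow in every hom set is equivalent to the terminal category
  (\<open>equivalence_to_terminal\<close>).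

  Existence. Send \<open>n\<close> to the right-bracketed sum \<open>1 \<oplus> (1 \<oplus> \<dots> \<oplus> 0)\<close> of
  \<open>n\<close> copies of the multiplicative unit. The adjacent transpositions act by the symmetry of the
  sum, and these arrows satisfy the Coxeter relations: an adjacent transposition squares to the
  identity because the symmetry does, the braid relation is the Yang-Baxter equation, which
  comes from the hexagon (\<open>yang_baxter\<close>), and distant transpositions commute by naturality.
  Two words in the adjacent transpositions with the same permutation can be rewritten to a common
  word by these relations (\<open>perm_of_faithful\<close>), so every permutation acts. Together with
  rebracketing this is a symmetric monoidal functor for the sum
  (\<open>free_symmetric_monoidal_functor\<close>). The comparison \<open>mul m n\<close> of the products is defined
  by recursion on \<open>m\<close> from the right distributivity. The axioms about it are proved by
  induction on \<open>m\<close> from the axiom of \<open>C\<close> that relates the right distributivity to the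
  structure in question, and naturality needs to be checked only on generators. The matching
  recursion for the permutations of \<open>finord\<close> is the same axiom read in \<open>finord\<close>.

  Uniqueness. A transformation is known at 0 and 1 by its unit axioms, hence at every
  \<open>n = 1 + \<dots> + 1\<close> by compatibility with sums. Taking this as a definition, naturality holds
  because composition and sum generate all arrows of \<open>finord\<close> from identities and one
  transposition (\<open>finord_induct\<close>). Compatibility with products at \<open>(m, n + p)\<close> follows from
  \<open>(m, n)\<close> and \<open>(m, p)\<close> by the left distributivity, which is invertible in
  \<open>finord\<close>, so only products with 0 and 1 remain, where the null and unit axioms decide.
\<close>

section \<open>Equational reasoning in monoidal categories\<close>

lemma homset_iff: "f \<in> homset K A B \<longleftrightarrow> f \<in> Arr K \<and> Dom K f = A \<and> Cod K f = B"
  by (auto simp: homset_def)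

context category begin

lemma cmp_arr [simp]: "\<lbrakk>f \<in> Arr K; g \<in> Arr K; Cod K f = Dom K g\<rbrakk> \<Longrightarrow> g \<cdot> f \<in> Arr K"
  and dom_cmp [simp]: "\<lbrakk>f \<in> Arr K; g \<in> Arr K; Cod K f = Dom K g\<rbrakk> \<Longrightarrow> Dom K (g \<cdot> f) = Dom K f"
  and cod_cmp [simp]: "\<lbrakk>f \<in> Arr K; g \<in> Arr K; Cod K f = Dom K g\<rbrakk> \<Longrightarrow> Cod K (g \<cdot> f) = Cod K g"
  using cmp_hom[of f "Dom K f" "Cod K f" g "Cod K g"] by (auto simp: homset_iff)

lemma idn_arr [simp]: "A \<in> Obj K \<Longrightarrow> Idn K A \<in> Arr K"
  and dom_idn [simp]: "A \<in> Obj K \<Longrightarrow> Dom K (Idn K A) = A"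
  and cod_idn [simp]: "A \<in> Obj K \<Longrightarrow> Cod K (Idn K A) = A"
  using idn_hom[of A] by (auto simp: homset_iff)

lemmas [simp] = dom_obj cod_obj

lemma assoc [simp]: "\<lbrakk>f \<in> Arr K; g \<in> Arr K; h \<in> Arr K; Cod K f = Dom K g; Cod K g = Dom K h\<rbrakk>
  \<Longrightarrow> (h \<cdot> g) \<cdot> f = h \<cdot> g \<cdot> f"
  using cmp_assoc[of f "Dom K f" "Dom K g" g "Dom K h" h "Cod K h"] by (auto simp: homset_iff)

lemma idl [simp]: "\<lbrakk>f \<in> Arr K; Cod K f = A\<rbrakk> \<Longrightarrow> Idn K A \<cdot> f = f"
  and idr [simp]: "\<lbrakk>f \<in> Arr K; Dom K f = A\<rbrakk> \<Longrightarrow> f \<cdot> Idn K A = f"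
  using idn_left idn_right by (auto simp: homset_iff)

text \<open>Composites are normalised by associating to the right; an equation between two-fold
  composites is then applied inside a longer one through this rule.\<close>

lemma in_chain:
  assumes "g \<cdot> f = k" "f \<in> Arr K" "g \<in> Arr K" "Cod K f = Dom K g" "x \<in> Arr K" "Cod K x = Dom K f"
  shows "g \<cdot> f \<cdot> x = k \<cdot> x"
  using assms assoc[of x f g] by simp

lemma inverse_arrows_unique:
  assumes "inverse_arrows K f g" "inverse_arrows K f h"
  shows "g = h"
proof -
  have "(g \<cdot> f) \<cdot> h = g \<cdot> f \<cdot> h"
    using assms by (intro assoc) (auto simp: inverse_arrows_def homset_iff)
  then show ?thesis using assms by (simp add: inverse_arrows_def homset_iff)
qed

lemma inv_inverse: "is_iso K f \<Longrightarrow> inverse_arrows K f (inv_arr K f)"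
  unfolding is_iso_def inv_arr_def using inverse_arrows_unique by (metis theI)

lemma iso_arr [simp]: "is_iso K f \<Longrightarrow> f \<in> Arr K"
  by (auto simp: is_iso_def inverse_arrows_def)

lemma inv_arr_arr [simp]: "is_iso K f \<Longrightarrow> inv_arr K f \<in> Arr K"
  and dom_inv [simp]: "is_iso K f \<Longrightarrow> Dom K (inv_arr K f) = Cod K f"
  and cod_inv [simp]: "is_iso K f \<Longrightarrow> Cod K (inv_arr K f) = Dom K f"
  and inv_left [simp]: "is_iso K f \<Longrightarrow> inv_arr K f \<cdot> f = Idn K (Dom K f)"
  and inv_right [simp]: "is_iso K f \<Longrightarrow> f \<cdot> inv_arr K f = Idn K (Cod K f)"
  using inv_inverse[of f] by (auto simp: inverse_arrows_def homset_iff)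

lemma inv_left_chain [simp]: "\<lbrakk>is_iso K f; x \<in> Arr K; Cod K x = Dom K f\<rbrakk> \<Longrightarrow> inv_arr K f \<cdot> f \<cdot> x = x"
  and inv_right_chain [simp]: "\<lbrakk>is_iso K f; y \<in> Arr K; Cod K y = Cod K f\<rbrakk> \<Longrightarrow> f \<cdot> inv_arr K f \<cdot> y = y"
  by (simp_all add: in_chain[OF inv_left] in_chain[OF inv_right])

lemma isoI: "\<lbrakk>f \<in> Arr K; g \<in> Arr K; Dom K g = Cod K f; Cod K g = Dom K f;
    g \<cdot> f = Idn K (Dom K f); f \<cdot> g = Idn K (Cod K f)\<rbrakk> \<Longrightarrow> is_iso K f"
  unfolding is_iso_def inverse_arrows_def by (auto simp: homset_iff)

lemma inv_eqI: "\<lbrakk>f \<in> Arr K; g \<in> Arr K; Dom K g = Cod K f; Cod K g = Dom K f;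
    g \<cdot> f = Idn K (Dom K f); f \<cdot> g = Idn K (Cod K f)\<rbrakk> \<Longrightarrow> inv_arr K f = g"
  using inverse_arrows_unique[OF inv_inverse[OF isoI[of f g]], of g]
  by (simp add: inverse_arrows_def homset_iff)

lemma iso_idn [simp]: "A \<in> Obj K \<Longrightarrow> is_iso K (Idn K A)"
  by (rule isoI[of _ "Idn K A"]) auto

lemma inv_idn [simp]: "A \<in> Obj K \<Longrightarrow> inv_arr K (Idn K A) = Idn K A"
  by (rule inv_eqI) auto

lemma iso_inv [simp]: "is_iso K f \<Longrightarrow> is_iso K (inv_arr K f)"
  by (rule isoI[of _ f]) auto

lemma iso_cmp [simp]: "\<lbrakk>is_iso K f; is_iso K g; Cod K f = Dom K g\<rbrakk> \<Longrightarrow> is_iso K (g \<cdot> f)"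
  by (rule isoI[of _ "inv_arr K f \<cdot> inv_arr K g"]) auto

lemma iso_cancel_left: 
  assumes "f \<cdot> g = f \<cdot> h" "is_iso K f" "g \<in> Arr K" "h \<in> Arr K" "Cod K g = Dom K f" "Cod K h = Dom K f" 
  shows "g = h"
proof -
  have "inv_arr K f \<cdot> f \<cdot> g = inv_arr K f \<cdot> f \<cdot> h" using assms(1) by simp
  then show ?thesis using assms(2-) by simp
qed

lemma iso_cancel_right: 
  assumes "g \<cdot> f = h \<cdot> f" "is_iso K f" "g \<in> Arr K" "h \<in> Arr K" "Dom K g = Cod K f" "Dom K h = Cod K f" 
  shows "g = h"
proof -
  have "(g \<cdot> f) \<cdot> inv_arr K f = (h \<cdot> f) \<cdot> inv_arr K f" using assms(1) by simp
  then show ?thesis using assms(2-) by simp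
qed

lemma move_inv_left:
  assumes "f \<cdot> g = h" "is_iso K f" "g \<in> Arr K" "Cod K g = Dom K f"
  shows "g = inv_arr K f \<cdot> h"
  using assms by auto

end

context monoidal_category begin

lemmas [simp] = tobj unit_obj tidn assoc_iso lunit_iso runit_iso

lemma tarr_arr [simp]: "\<lbrakk>f \<in> Arr K; g \<in> Arr K\<rbrakk> \<Longrightarrow> f \<odot>\<^sub>a\<^bsub>M\<^esub> g \<in> Arr K"
  and dom_tarr [simp]: "\<lbrakk>f \<in> Arr K; g \<in> Arr K\<rbrakk> \<Longrightarrow> Dom K (f \<odot>\<^sub>a\<^bsub>M\<^esub> g) = Dom K f \<odot>\<^bsub>M\<^esub> Dom K g"
  and cod_tarr [simp]: "\<lbrakk>f \<in> Arr K; g \<in> Arr K\<rbrakk> \<Longrightarrow> Cod K (f \<odot>\<^sub>a\<^bsub>M\<^esub> g) = Cod K f \<odot>\<^bsub>M\<^esub> Cod K g"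
  using tarr[of f "Dom K f" "Cod K f" g "Dom K g" "Cod K g"] by (auto simp: homset_iff)

text \<open>Interchange is read in the merging direction, so that a right-associated chain shrinks to one
  tensor product of chains wherever no structural arrow intervenes.\<close>

lemma merge: "\<lbrakk>f \<in> Arr K; f' \<in> Arr K; g \<in> Arr K; g' \<in> Arr K; Cod K f = Dom K f'; Cod K g = Dom K g'\<rbrakk>
  \<Longrightarrow> (f' \<odot>\<^sub>a\<^bsub>M\<^esub> g') \<cdot> (f \<odot>\<^sub>a\<^bsub>M\<^esub> g) = (f' \<cdot> f) \<odot>\<^sub>a\<^bsub>M\<^esub> (g' \<cdot> g)"
  using tcmp[of f "Dom K f" "Cod K f" f' "Cod K f'" g "Dom K g" "Cod K g" g' "Cod K g'"]
  by (auto simp: homset_iff)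

lemma merge_chain: "\<lbrakk>f \<in> Arr K; f' \<in> Arr K; g \<in> Arr K; g' \<in> Arr K; Cod K f = Dom K f'; Cod K g = Dom K g';
  x \<in> Arr K; Cod K x = Dom K f \<odot>\<^bsub>M\<^esub> Dom K g\<rbrakk>
  \<Longrightarrow> (f' \<odot>\<^sub>a\<^bsub>M\<^esub> g') \<cdot> (f \<odot>\<^sub>a\<^bsub>M\<^esub> g) \<cdot> x = ((f' \<cdot> f) \<odot>\<^sub>a\<^bsub>M\<^esub> (g' \<cdot> g)) \<cdot> x"
  by (simp add: in_chain[OF merge])

lemma assoc_arr [simp]: "\<lbrakk>A \<in> Obj K; B \<in> Obj K; C \<in> Obj K\<rbrakk> \<Longrightarrow> Assoc M A B C \<in> Arr K"
  and dom_assoc [simp]: "\<lbrakk>A \<in> Obj K; B \<in> Obj K; C \<in> Obj K\<rbrakk>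
      \<Longrightarrow> Dom K (Assoc M A B C) = (A \<odot>\<^bsub>M\<^esub> B) \<odot>\<^bsub>M\<^esub> C"
  and cod_assoc [simp]: "\<lbrakk>A \<in> Obj K; B \<in> Obj K; C \<in> Obj K\<rbrakk>
      \<Longrightarrow> Cod K (Assoc M A B C) = A \<odot>\<^bsub>M\<^esub> (B \<odot>\<^bsub>M\<^esub> C)"
  using assoc_hom[of A B C] by (auto simp: homset_iff)

lemma lunit_arr [simp]: "A \<in> Obj K \<Longrightarrow> LUnit M A \<in> Arr K"
  and dom_lunit [simp]: "A \<in> Obj K \<Longrightarrow> Dom K (LUnit M A) = Unit M \<odot>\<^bsub>M\<^esub> A"
  and cod_lunit [simp]: "A \<in> Obj K \<Longrightarrow> Cod K (LUnit M A) = A"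
  and runit_arr [simp]: "A \<in> Obj K \<Longrightarrow> RUnit M A \<in> Arr K"
  and dom_runit [simp]: "A \<in> Obj K \<Longrightarrow> Dom K (RUnit M A) = A \<odot>\<^bsub>M\<^esub> Unit M"
  and cod_runit [simp]: "A \<in> Obj K \<Longrightarrow> Cod K (RUnit M A) = A"
  using lunit_hom[of A] runit_hom[of A] by (auto simp: homset_iff)

lemma nat_assoc: "\<lbrakk>f \<in> Arr K; g \<in> Arr K; h \<in> Arr K; Cod K f = A; Cod K g = B; Cod K h = C\<rbrakk>
  \<Longrightarrow> Assoc M A B C \<cdot> ((f \<odot>\<^sub>a\<^bsub>M\<^esub> g) \<odot>\<^sub>a\<^bsub>M\<^esub> h)
    = (f \<odot>\<^sub>a\<^bsub>M\<^esub> (g \<odot>\<^sub>a\<^bsub>M\<^esub> h)) \<cdot> Assoc M (Dom K f) (Dom K g) (Dom K h)"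
  using assoc_nat[of f "Dom K f" A g "Dom K g" B h "Dom K h" C] by (auto simp: homset_iff)

lemma nat_lunit: "\<lbrakk>f \<in> Arr K; Cod K f = A\<rbrakk>
  \<Longrightarrow> LUnit M A \<cdot> (Idn K (Unit M) \<odot>\<^sub>a\<^bsub>M\<^esub> f) = f \<cdot> LUnit M (Dom K f)"
  and nat_runit: "\<lbrakk>f \<in> Arr K; Cod K f = A\<rbrakk>
  \<Longrightarrow> RUnit M A \<cdot> (f \<odot>\<^sub>a\<^bsub>M\<^esub> Idn K (Unit M)) = f \<cdot> RUnit M (Dom K f)"
  using lunit_nat[of f "Dom K f" A] runit_nat[of f "Dom K f" A] by (auto simp: homset_iff)

lemma iso_tarr [simp]: "\<lbrakk>is_iso K f; is_iso K g\<rbrakk> \<Longrightarrow> is_iso K (f \<odot>\<^sub>a\<^bsub>M\<^esub> g)"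
  by (rule isoI[of _ "inv_arr K f \<odot>\<^sub>a\<^bsub>M\<^esub> inv_arr K g"]) (auto simp: merge)

lemma unit_left_faithful:
  assumes "Idn K (Unit M) \<odot>\<^sub>a\<^bsub>M\<^esub> f = Idn K (Unit M) \<odot>\<^sub>a\<^bsub>M\<^esub> g" "f \<in> Arr K" "g \<in> Arr K"
    "Dom K f = Dom K g" "Cod K f = Cod K g"
  shows "f = g"
  using nat_lunit[of f "Cod K f"] nat_lunit[of g "Cod K g"] assms
  by (intro iso_cancel_right[of f "LUnit M (Dom K f)" g]) auto

lemma unit_right_faithful:
  assumes "f \<odot>\<^sub>a\<^bsub>M\<^esub> Idn K (Unit M) = g \<odot>\<^sub>a\<^bsub>M\<^esub> Idn K (Unit M)" "f \<in> Arr K" "g \<in> Arr K"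
    "Dom K f = Dom K g" "Cod K f = Cod K g"
  shows "f = g"
  using nat_runit[of f "Cod K f"] nat_runit[of g "Cod K g"] assms
  by (intro iso_cancel_right[of f "RUnit M (Dom K f)" g]) auto

text \<open>Kelly's argument: tensoring with the unit is faithful, and after tensoring both sides agree
  once the isomorphism on the right of the pentagon for \<open>I, I, A, B\<close> is cancelled.\<close>

lemma lunit_tensor:
  assumes [simp]: "A \<in> Obj K" "B \<in> Obj K"
  shows "LUnit M (A \<odot>\<^bsub>M\<^esub> B) \<cdot> Assoc M (Unit M) A B = LUnit M A \<odot>\<^sub>a\<^bsub>M\<^esub> Idn K B"
proof (rule unit_left_faithful)
  let ?I = "Unit M" and ?P = "Assoc M (Unit M) (Unit M \<odot>\<^bsub>M\<^esub> A) B \<cdot> (Assoc M (Unit M) (Unit M) A \<odot>\<^sub>a\<^bsub>M\<^esub> Idn K B)"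
  show "Idn K ?I \<odot>\<^sub>a\<^bsub>M\<^esub> (LUnit M (A \<odot>\<^bsub>M\<^esub> B) \<cdot> Assoc M ?I A B) =
    Idn K ?I \<odot>\<^sub>a\<^bsub>M\<^esub> LUnit M A \<odot>\<^sub>a\<^bsub>M\<^esub> Idn K B"
  proof (rule iso_cancel_right[of _ ?P])
    have "(Idn K ?I \<odot>\<^sub>a\<^bsub>M\<^esub> (LUnit M (A \<odot>\<^bsub>M\<^esub> B) \<cdot> Assoc M ?I A B)) \<cdot> ?P
      = (Idn K ?I \<odot>\<^sub>a\<^bsub>M\<^esub> LUnit M (A \<odot>\<^bsub>M\<^esub> B)) \<cdot> (Idn K ?I \<odot>\<^sub>a\<^bsub>M\<^esub> Assoc M ?I A B) \<cdot> ?P"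
      by (simp add: merge_chain)
    also have "\<dots> = ((Idn K ?I \<odot>\<^sub>a\<^bsub>M\<^esub> LUnit M (A \<odot>\<^bsub>M\<^esub> B)) \<cdot> Assoc M ?I ?I (A \<odot>\<^bsub>M\<^esub> B)) \<cdot> Assoc M (?I \<odot>\<^bsub>M\<^esub> ?I) A B"
      by (simp add: pentagon)
    also have "\<dots> = (RUnit M ?I \<odot>\<^sub>a\<^bsub>M\<^esub> (Idn K A \<odot>\<^sub>a\<^bsub>M\<^esub> Idn K B)) \<cdot> Assoc M (?I \<odot>\<^bsub>M\<^esub> ?I) A B"
      by (simp add: triangle del: assoc)
    also have "\<dots> = Assoc M ?I A B \<cdot> ((RUnit M ?I \<odot>\<^sub>a\<^bsub>M\<^esub> Idn K A) \<odot>\<^sub>a\<^bsub>M\<^esub> Idn K B)"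
      by (subst nat_assoc) auto
    also have "\<dots> = Assoc M ?I A B \<cdot> (((Idn K ?I \<odot>\<^sub>a\<^bsub>M\<^esub> LUnit M A)\<cdot> Assoc M ?I ?I A) \<odot>\<^sub>a\<^bsub>M\<^esub> (Idn K B \<cdot> Idn K B))"
      by (simp add: triangle)
    also have "\<dots> = (Assoc M ?I A B \<cdot> ((Idn K ?I \<odot>\<^sub>a\<^bsub>M\<^esub> LUnit M A) \<odot>\<^sub>a\<^bsub>M\<^esub> Idn K B)) \<cdot> (Assoc M ?I ?I A \<odot>\<^sub>a\<^bsub>M\<^esub> Idn K B)"
      by (simp add: merge del: idl idr)
    also have "\<dots> = (Idn K ?I \<odot>\<^sub>a\<^bsub>M\<^esub> LUnit M A \<odot>\<^sub>a\<^bsub>M\<^esub> Idn K B) \<cdot> ?P"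
      by (subst nat_assoc) auto
    finally show "(Idn K ?I \<odot>\<^sub>a\<^bsub>M\<^esub> (LUnit M (A \<odot>\<^bsub>M\<^esub> B) \<cdot> Assoc M ?I A B)) \<cdot> ?P
      = (Idn K ?I \<odot>\<^sub>a\<^bsub>M\<^esub> LUnit M A \<odot>\<^sub>a\<^bsub>M\<^esub> Idn K B) \<cdot> ?P" .
  qed auto
qed auto

text \<open>The mirror image of the previous argument, with the pentagon for \<open>A, B, I, I\<close>.\<close>

lemma runit_tensor:
  assumes [simp]: "A \<in> Obj K" "B \<in> Obj K"
  shows "(Idn K A \<odot>\<^sub>a\<^bsub>M\<^esub> RUnit M B) \<cdot> Assoc M A B (Unit M) = RUnit M (A \<odot>\<^bsub>M\<^esub> B)"
proof (rule unit_right_faithful)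
  let ?I = "Unit M" and ?P = "Assoc M A (B \<odot>\<^bsub>M\<^esub> Unit M) (Unit M) \<cdot> (Assoc M A B (Unit M) \<odot>\<^sub>a\<^bsub>M\<^esub> Idn K (Unit M))"
  show "((Idn K A \<odot>\<^sub>a\<^bsub>M\<^esub> RUnit M B) \<cdot> Assoc M A B ?I) \<odot>\<^sub>a\<^bsub>M\<^esub> Idn K ?I = RUnit M (A \<odot>\<^bsub>M\<^esub> B) \<odot>\<^sub>a\<^bsub>M\<^esub> Idn K ?I"
  proof (rule iso_cancel_left[of "Assoc M A B ?I"])
    have "Assoc M A B ?I \<cdot> (((Idn K A \<odot>\<^sub>a\<^bsub>M\<^esub> RUnit M B) \<cdot> Assoc M A B ?I) \<odot>\<^sub>a\<^bsub>M\<^esub> (Idn K ?I \<cdot> Idn K ?I))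
      = (Assoc M A B ?I \<cdot> ((Idn K A \<odot>\<^sub>a\<^bsub>M\<^esub> RUnit M B) \<odot>\<^sub>a\<^bsub>M\<^esub> Idn K ?I)) \<cdot> (Assoc M A B ?I \<odot>\<^sub>a\<^bsub>M\<^esub> Idn K ?I)"
      by (simp add: merge del: idl idr)
    also have "\<dots> = (Idn K A \<odot>\<^sub>a\<^bsub>M\<^esub> (RUnit M B \<odot>\<^sub>a\<^bsub>M\<^esub> Idn K ?I)) \<cdot> ?P"
      by (subst nat_assoc) auto
    also have "\<dots> = (Idn K A \<odot>\<^sub>a\<^bsub>M\<^esub> (Idn K B \<odot>\<^sub>a\<^bsub>M\<^esub> LUnit M ?I)) \<cdot> (Idn K A \<odot>\<^sub>a\<^bsub>M\<^esub> Assoc M B ?I ?I) \<cdot> ?P"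
      by (simp add: merge_chain triangle)
    also have "\<dots> = ((Idn K A \<odot>\<^sub>a\<^bsub>M\<^esub> (Idn K B \<odot>\<^sub>a\<^bsub>M\<^esub> LUnit M ?I)) \<cdot> Assoc M A B (?I \<odot>\<^bsub>M\<^esub> ?I)) \<cdot> Assoc M (A \<odot>\<^bsub>M\<^esub> B) ?I ?I"
      by (simp add: pentagon)
    also have "\<dots> = (Assoc M A B ?I \<cdot> ((Idn K A \<odot>\<^sub>a\<^bsub>M\<^esub> Idn K B) \<odot>\<^sub>a\<^bsub>M\<^esub> LUnit M ?I)) \<cdot> Assoc M (A \<odot>\<^bsub>M\<^esub> B) ?I ?I"
      by (subst nat_assoc) auto
    also have "\<dots> = Assoc M A B ?I \<cdot> (RUnit M (A \<odot>\<^bsub>M\<^esub> B) \<odot>\<^sub>a\<^bsub>M\<^esub> Idn K ?I)"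
      by (simp add: triangle)
    finally show "Assoc M A B ?I \<cdot> (((Idn K A \<odot>\<^sub>a\<^bsub>M\<^esub> RUnit M B) \<cdot> Assoc M A B ?I) \<odot>\<^sub>a\<^bsub>M\<^esub> Idn K ?I)
      = Assoc M A B ?I \<cdot> (RUnit M (A \<odot>\<^bsub>M\<^esub> B) \<odot>\<^sub>a\<^bsub>M\<^esub> Idn K ?I)"
      by simp
  qed auto
qed auto

lemma lunit_unit: "LUnit M (Unit M) = RUnit M (Unit M)"
proof (rule unit_right_faithful)
  let ?I = "Unit M"
  have "LUnit M (?I \<odot>\<^bsub>M\<^esub> ?I) = Idn K ?I \<odot>\<^sub>a\<^bsub>M\<^esub> LUnit M ?I"
    by (rule iso_cancel_left[of "LUnit M ?I"]) (simp_all add: nat_lunit)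
  then show "LUnit M ?I \<odot>\<^sub>a\<^bsub>M\<^esub> Idn K ?I = RUnit M ?I \<odot>\<^sub>a\<^bsub>M\<^esub> Idn K ?I"
    using lunit_tensor[of ?I ?I] triangle[of ?I ?I] by simp
qed auto

end

context symmetric_monoidal_category begin

lemma sym_arr [simp]: "\<lbrakk>A \<in> Obj K; B \<in> Obj K\<rbrakk> \<Longrightarrow> z A B \<in> Arr K"
  and dom_sym [simp]: "\<lbrakk>A \<in> Obj K; B \<in> Obj K\<rbrakk> \<Longrightarrow> Dom K (z A B) = A \<odot>\<^bsub>M\<^esub> B"
  and cod_sym [simp]: "\<lbrakk>A \<in> Obj K; B \<in> Obj K\<rbrakk> \<Longrightarrow> Cod K (z A B) = B \<odot>\<^bsub>M\<^esub> A"
  using sym_hom[of A B] by (auto simp: homset_iff)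

lemma nat_sym: "\<lbrakk>f \<in> Arr K; g \<in> Arr K; Cod K f = A; Cod K g = B\<rbrakk>
  \<Longrightarrow> z A B \<cdot> (f \<odot>\<^sub>a\<^bsub>M\<^esub> g) = (g \<odot>\<^sub>a\<^bsub>M\<^esub> f) \<cdot> z (Dom K f) (Dom K g)"
  using sym_nat[of f "Dom K f" A g "Dom K g" B] by (auto simp: homset_iff)

lemmas [simp] = sym_inv

lemma sym_iso [simp]: "\<lbrakk>A \<in> Obj K; B \<in> Obj K\<rbrakk> \<Longrightarrow> is_iso K (z A B)"
  by (rule isoI[of _ "z B A"]) auto

lemma sym_unit_right: 
  assumes "A \<in> Obj K" shows "RUnit M A \<cdot> z (Unit M) A = LUnit M A"
  using assms by (simp add: sym_unit[symmetric])

end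

section \<open>The exchange of two summands and the Yang-Baxter equation\<close>
context monoidal_category begin

lemma nat_assoc_inv: 
  assumes [simp]: "f \<in> Arr K" "g \<in> Arr K" "h \<in> Arr K" "Dom K f = A" "Dom K g = B" "Dom K h = C"
  shows "inv_arr K (Assoc M (Cod K f) (Cod K g) (Cod K h)) \<cdot> (f \<odot>\<^sub>a\<^bsub>M\<^esub> (g \<odot>\<^sub>a\<^bsub>M\<^esub> h))
    = ((f \<odot>\<^sub>a\<^bsub>M\<^esub> g) \<odot>\<^sub>a\<^bsub>M\<^esub> h) \<cdot> inv_arr K (Assoc M A B C)"
proof -
  have [simp]: "A \<in> Obj K" "B \<in> Obj K" "C \<in> Obj K" using assms dom_obj by blast+
  have "((f \<odot>\<^sub>a\<^bsub>M\<^esub> g) \<odot>\<^sub>a\<^bsub>M\<^esub> h) =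
    inv_arr K (Assoc M (Cod K f) (Cod K g) (Cod K h)) \<cdot> ((f \<odot>\<^sub>a\<^bsub>M\<^esub> (g \<odot>\<^sub>a\<^bsub>M\<^esub> h)) \<cdot> Assoc M A B C)"
    by (rule move_inv_left) (auto simp: nat_assoc)
  then show ?thesis by simp
qed

end

context symmetric_monoidal_category begin

text \<open>The exchange of \<open>A\<close> and \<open>B\<close> in a product bracketed to the right. It acts on the first
  two factors of a right-bracketed power without any further reassociation.\<close>

definition braid where
  "braid A B X = Assoc M B A X \<cdot> (z A B \<odot>\<^sub>a\<^bsub>M\<^esub> Idn K X) \<cdot> inv_arr K (Assoc M A B X)"

lemma braid_arr [simp]: "\<lbrakk>A \<in> Obj K; B \<in> Obj K; X \<in> Obj K\<rbrakk> \<Longrightarrow> braid A B X \<in> Arr K"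
  and dom_braid [simp]: "\<lbrakk>A \<in> Obj K; B \<in> Obj K; X \<in> Obj K\<rbrakk>
      \<Longrightarrow> Dom K (braid A B X) = A \<odot>\<^bsub>M\<^esub> (B \<odot>\<^bsub>M\<^esub> X)"
  and cod_braid [simp]: "\<lbrakk>A \<in> Obj K; B \<in> Obj K; X \<in> Obj K\<rbrakk>
      \<Longrightarrow> Cod K (braid A B X) = B \<odot>\<^bsub>M\<^esub> (A \<odot>\<^bsub>M\<^esub> X)"
  by (simp_all add: braid_def)

lemma braid_braid:
  assumes [simp]: "A \<in> Obj K" "B \<in> Obj K" "X \<in> Obj K"
  shows "braid B A X \<cdot> braid A B X = Idn K (A \<odot>\<^bsub>M\<^esub> (B \<odot>\<^bsub>M\<^esub> X))"
  by (simp add: braid_def merge_chain)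

lemma nat_braid:
  assumes [simp]: "f \<in> Arr K" "g \<in> Arr K" "h \<in> Arr K" "Cod K f = A" "Cod K g = B" "Cod K h = C"
  shows "braid A B C \<cdot> (f \<odot>\<^sub>a\<^bsub>M\<^esub> (g \<odot>\<^sub>a\<^bsub>M\<^esub> h))
    = (g \<odot>\<^sub>a\<^bsub>M\<^esub> (f \<odot>\<^sub>a\<^bsub>M\<^esub> h)) \<cdot> braid (Dom K f) (Dom K g) (Dom K h)"
proof -
  have [simp]: "A \<in> Obj K" "B \<in> Obj K" "C \<in> Obj K" using assms cod_obj by blast+
  have "braid A B C \<cdot> (f \<odot>\<^sub>a\<^bsub>M\<^esub> (g \<odot>\<^sub>a\<^bsub>M\<^esub> h)) = Assoc M B A C \<cdot> (z A B \<odot>\<^sub>a\<^bsub>M\<^esub> Idn K C) 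
     \<cdot> ((f \<odot>\<^sub>a\<^bsub>M\<^esub> g) \<odot>\<^sub>a\<^bsub>M\<^esub> h) \<cdot> inv_arr K (Assoc M (Dom K f) (Dom K g) (Dom K h))"
    using nat_assoc_inv[of f g h] by (simp add: braid_def)
  also have "\<dots> = (Assoc M B A C \<cdot> ((g \<odot>\<^sub>a\<^bsub>M\<^esub> f) \<odot>\<^sub>a\<^bsub>M\<^esub> h)) \<cdot> (z (Dom K f) (Dom K g) \<odot>\<^sub>a\<^bsub>M\<^esub> Idn K (Dom K h))
     \<cdot> inv_arr K (Assoc M (Dom K f) (Dom K g) (Dom K h))"
    by (simp add: merge_chain nat_sym)
  also have "\<dots> = (g \<odot>\<^sub>a\<^bsub>M\<^esub> (f \<odot>\<^sub>a\<^bsub>M\<^esub> h)) \<cdot> braid (Dom K f) (Dom K g) (Dom K h)"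
    by (simp add: nat_assoc braid_def)
  finally show ?thesis .
qed

text \<open>The hexagon, carried by two pentagons to products bracketed to the right: to pass \<open>B \<odot> C\<close>
  is to pass \<open>B\<close> and then \<open>C\<close>.\<close>

lemma braid_hexagon:
  assumes [simp]: "A \<in> Obj K" "B \<in> Obj K" "C \<in> Obj K" "X \<in> Obj K"
  shows "(Idn K B \<odot>\<^sub>a\<^bsub>M\<^esub> braid A C X) \<cdot> braid A B (C \<odot>\<^bsub>M\<^esub> X) 
    = Assoc M B C (A \<odot>\<^bsub>M\<^esub> X) \<cdot> braid A (B \<odot>\<^bsub>M\<^esub> C) X \<cdot> (Idn K A \<odot>\<^sub>a\<^bsub>M\<^esub> inv_arr K (Assoc M B C X))"
  (is "?l = ?r")
proof (rule iso_cancel_right)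
  let ?P = "Assoc M A B (C \<odot>\<^bsub>M\<^esub> X) \<cdot> Assoc M (A \<odot>\<^bsub>M\<^esub> B) C X"
  let ?N = "(Idn K B \<odot>\<^sub>a\<^bsub>M\<^esub> Assoc M C A X) \<cdot> Assoc M B (C \<odot>\<^bsub>M\<^esub> A) X
    \<cdot> (((Idn K B \<odot>\<^sub>a\<^bsub>M\<^esub> z A C) \<cdot> Assoc M B A C \<cdot> (z A B \<odot>\<^sub>a\<^bsub>M\<^esub> Idn K C)) \<odot>\<^sub>a\<^bsub>M\<^esub> Idn K X)"
  have "?r \<cdot> ?P = ?r \<cdot> (Idn K A \<odot>\<^sub>a\<^bsub>M\<^esub> Assoc M B C X) \<cdot> Assoc M A (B \<odot>\<^bsub>M\<^esub> C) X \<cdot> (Assoc M A B C \<odot>\<^sub>a\<^bsub>M\<^esub> Idn K X)"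
    by (simp add: pentagon)
  also have "\<dots> = (Assoc M B C (A \<odot>\<^bsub>M\<^esub> X) \<cdot> Assoc M (B \<odot>\<^bsub>M\<^esub> C) A X)
      \<cdot> ((z A (B \<odot>\<^bsub>M\<^esub> C) \<cdot> Assoc M A B C) \<odot>\<^sub>a\<^bsub>M\<^esub> Idn K X)"
    by (simp add: merge_chain merge braid_def)
  also have "\<dots> = (Idn K B \<odot>\<^sub>a\<^bsub>M\<^esub> Assoc M C A X) \<cdot> Assoc M B (C \<odot>\<^bsub>M\<^esub> A) X
      \<cdot> ((Assoc M B C A \<cdot> z A (B \<odot>\<^bsub>M\<^esub> C) \<cdot> Assoc M A B C) \<odot>\<^sub>a\<^bsub>M\<^esub> Idn K X)"
    by (simp add: merge pentagon[symmetric])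
  also have "\<dots> = ?N" by (simp add: hexagon)
  finally have r: "?r \<cdot> ?P = ?N" .
  have "?l \<cdot> ?P = (Idn K B \<odot>\<^sub>a\<^bsub>M\<^esub> braid A C X) \<cdot> Assoc M B A (C \<odot>\<^bsub>M\<^esub> X) 
     \<cdot> (z A B \<odot>\<^sub>a\<^bsub>M\<^esub> (Idn K C \<odot>\<^sub>a\<^bsub>M\<^esub> Idn K X)) \<cdot> Assoc M (A \<odot>\<^bsub>M\<^esub> B) C X"
    by (simp add: braid_def)
  also have "\<dots> = (Idn K B \<odot>\<^sub>a\<^bsub>M\<^esub> braid A C X) \<cdot> Assoc M B A (C \<odot>\<^bsub>M\<^esub> X) 
     \<cdot> (Assoc M (B \<odot>\<^bsub>M\<^esub> A) C X \<cdot> ((z A B \<odot>\<^sub>a\<^bsub>M\<^esub> Idn K C) \<odot>\<^sub>a\<^bsub>M\<^esub> Idn K X))"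
    by (subst nat_assoc) auto
  also have "\<dots> = (Idn K B \<odot>\<^sub>a\<^bsub>M\<^esub> braid A C X) \<cdot> (Assoc M B A (C \<odot>\<^bsub>M\<^esub> X) \<cdot> Assoc M (B \<odot>\<^bsub>M\<^esub> A) C X) 
    \<cdot> ((z A B \<odot>\<^sub>a\<^bsub>M\<^esub> Idn K C) \<odot>\<^sub>a\<^bsub>M\<^esub> Idn K X)"
    by simp
  also have "\<dots> = (Idn K B \<odot>\<^sub>a\<^bsub>M\<^esub> Assoc M C A X) \<cdot> ((Idn K B \<odot>\<^sub>a\<^bsub>M\<^esub> (z A C \<odot>\<^sub>a\<^bsub>M\<^esub> Idn K X)) \<cdot> Assoc M B (A \<odot>\<^bsub>M\<^esub> C) X) 
      \<cdot> ((Assoc M B A C \<cdot> (z A B \<odot>\<^sub>a\<^bsub>M\<^esub> Idn K C)) \<odot>\<^sub>a\<^bsub>M\<^esub> Idn K X)"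
    unfolding pentagon[symmetric, OF assms(2,1,3,4)]
    by (simp add: merge_chain merge braid_def)
  also have "\<dots> = (Idn K B \<odot>\<^sub>a\<^bsub>M\<^esub> Assoc M C A X) \<cdot> (Assoc M B (C \<odot>\<^bsub>M\<^esub> A) X \<cdot> ((Idn K B \<odot>\<^sub>a\<^bsub>M\<^esub> z A C) \<odot>\<^sub>a\<^bsub>M\<^esub> Idn K X)) 
      \<cdot> ((Assoc M B A C \<cdot> (z A B \<odot>\<^sub>a\<^bsub>M\<^esub> Idn K C)) \<odot>\<^sub>a\<^bsub>M\<^esub> Idn K X)"
    by (subst nat_assoc) auto
  also have "\<dots> = ?N" by (simp add: merge)
  finally show "?l \<cdot> ?P = ?r \<cdot> ?P" using r by simp
qed auto

text \<open>Both sides move \<open>A\<close> past \<open>B\<close> and \<open>C\<close> and exchange \<open>B\<close> with \<open>C\<close>. In the form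
  of the hexagon above they differ only by the naturality of the exchange in the pair that is passed.\<close>

lemma yang_baxter:
  assumes [simp]: "A \<in> Obj K" "B \<in> Obj K" "C \<in> Obj K" "X \<in> Obj K"
  shows "(Idn K C \<odot>\<^sub>a\<^bsub>M\<^esub> braid A B X) \<cdot> braid A C (B \<odot>\<^bsub>M\<^esub> X) \<cdot> (Idn K A \<odot>\<^sub>a\<^bsub>M\<^esub> braid B C X)
    = braid B C (A \<odot>\<^bsub>M\<^esub> X) \<cdot> (Idn K B \<odot>\<^sub>a\<^bsub>M\<^esub> braid A C X) \<cdot> braid A B (C \<odot>\<^bsub>M\<^esub> X)" (is "?l = ?r")
proof -
  have "?l = ((Idn K C \<odot>\<^sub>a\<^bsub>M\<^esub> braid A B X) \<cdot> braid A C (B \<odot>\<^bsub>M\<^esub> X)) \<cdot> (Idn K A \<odot>\<^sub>a\<^bsub>M\<^esub> braid B C X)"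
    by simp
  also have "\<dots> = Assoc M C B (A \<odot>\<^bsub>M\<^esub> X) \<cdot> (braid A (C \<odot>\<^bsub>M\<^esub> B) X
      \<cdot> (Idn K A \<odot>\<^sub>a\<^bsub>M\<^esub> (z B C \<odot>\<^sub>a\<^bsub>M\<^esub> Idn K X))) \<cdot> (Idn K A \<odot>\<^sub>a\<^bsub>M\<^esub> inv_arr K (Assoc M B C X))"
    by (simp add: braid_hexagon merge braid_def[of B C])
  also have "\<dots> = Assoc M C B (A \<odot>\<^bsub>M\<^esub> X) \<cdot> ((z B C \<odot>\<^sub>a\<^bsub>M\<^esub> (Idn K A \<odot>\<^sub>a\<^bsub>M\<^esub> Idn K X)) \<cdot> braid A (B \<odot>\<^bsub>M\<^esub> C) X)
      \<cdot> (Idn K A \<odot>\<^sub>a\<^bsub>M\<^esub> inv_arr K (Assoc M B C X))"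
    by (subst nat_braid) auto
  also have "\<dots> = ?r" by (simp add: braid_hexagon braid_def[of B C])
  finally show ?thesis .
qed

lemma braid_tensor:
  assumes [simp]: "A \<in> Obj K" "B \<in> Obj K" "X \<in> Obj K" "Y \<in> Obj K"
  shows "braid A B (X \<odot>\<^bsub>M\<^esub> Y) \<cdot> (Idn K A \<odot>\<^sub>a\<^bsub>M\<^esub> Assoc M B X Y) \<cdot> Assoc M A (B \<odot>\<^bsub>M\<^esub> X) Y
    = (Idn K B \<odot>\<^sub>a\<^bsub>M\<^esub> Assoc M A X Y) \<cdot> Assoc M B (A \<odot>\<^bsub>M\<^esub> X) Y \<cdot> (braid A B X \<odot>\<^sub>a\<^bsub>M\<^esub> Idn K Y)" (is "?l = ?r")
proof (rule iso_cancel_right)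
  let ?P = "Assoc M A B X \<odot>\<^sub>a\<^bsub>M\<^esub> Idn K Y"
  have "?l \<cdot> ?P = braid A B (X \<odot>\<^bsub>M\<^esub> Y) \<cdot> (Assoc M A B (X \<odot>\<^bsub>M\<^esub> Y) \<cdot> Assoc M (A \<odot>\<^bsub>M\<^esub> B) X Y)"
    by (simp add: pentagon)
  also have "\<dots> = Assoc M B A (X \<odot>\<^bsub>M\<^esub> Y) \<cdot> (z A B \<odot>\<^sub>a\<^bsub>M\<^esub> (Idn K X \<odot>\<^sub>a\<^bsub>M\<^esub> Idn K Y)) \<cdot> Assoc M (A \<odot>\<^bsub>M\<^esub> B) X Y"
    by (simp add: braid_def)
  also have "\<dots> = Assoc M B A (X \<odot>\<^bsub>M\<^esub> Y) \<cdot> (Assoc M (B \<odot>\<^bsub>M\<^esub> A) X Y \<cdot> ((z A B \<odot>\<^sub>a\<^bsub>M\<^esub> Idn K X) \<odot>\<^sub>a\<^bsub>M\<^esub> Idn K Y))"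
    by (subst nat_assoc) auto
  also have "\<dots> = (Assoc M B A (X \<odot>\<^bsub>M\<^esub> Y) \<cdot> Assoc M (B \<odot>\<^bsub>M\<^esub> A) X Y) \<cdot> ((z A B \<odot>\<^sub>a\<^bsub>M\<^esub> Idn K X) \<odot>\<^sub>a\<^bsub>M\<^esub> Idn K Y)"
    by simp
  also have "\<dots> = ?r \<cdot> ?P"
    unfolding pentagon[symmetric, OF assms(2,1,3,4)]
    by (simp add: merge braid_def)
  finally show "?l \<cdot> ?P = ?r \<cdot> ?P" .
qed auto

end

section \<open>The Coxeter presentation of the symmetric groups\<close>
text \<open>The letter \<open>k\<close> stands for the exchange of places \<open>k\<close> and \<open>k + 1\<close>, counted from 0. The
  relation is directed: words with the same permutation are compared by rewriting both of them to
  a common word, so a symmetry rule would only burden the inductions.\<close>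

inductive coxeter :: "nat list \<Rightarrow> nat list \<Rightarrow> bool" where
  same: "coxeter w w"
| chain: "\<lbrakk>coxeter u v; coxeter v w\<rbrakk> \<Longrightarrow> coxeter u w"
| within: "coxeter u v \<Longrightarrow> coxeter (x @ u @ y) (x @ v @ y)"
| square: "coxeter [k, k] []"
| triple: "coxeter [k, Suc k, k] [Suc k, k, Suc k]"
| far: "Suc k < l \<or> Suc l < k \<Longrightarrow> coxeter [k, l] [l, k]"

definition letters_below :: "nat \<Rightarrow> nat list \<Rightarrow> bool" where
  "letters_below n w \<longleftrightarrow> (\<forall>k \<in> set w. Suc k < n)"

lemma letters_below_simps [simp]:
  "letters_below n []" 
  "letters_below n (k # w) \<longleftrightarrow> Suc k < n \<and> letters_below n w"
  "letters_below n (v @ w) \<longleftrightarrow> letters_below n v \<and> letters_below n w"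
  "letters_below (Suc n) (map Suc w) \<longleftrightarrow> letters_below n w"
  by (auto simp: letters_below_def)

lemma coxeter_letters_below: "coxeter u v \<Longrightarrow> letters_below n u \<Longrightarrow> letters_below n v"
  by (induction rule: coxeter.induct) auto

lemma coxeter_Cons: "coxeter u v \<Longrightarrow> coxeter (k # u) (k # v)"
  using coxeter.within[of u v "[k]" "[]"] by simp

lemma coxeter_append: "coxeter u v \<Longrightarrow> coxeter (u @ y) (v @ y)"
  using coxeter.within[of u v "[]" y] by simp

lemma coxeter_prepend: "coxeter u v \<Longrightarrow> coxeter (x @ u) (x @ v)"
  using coxeter.within[of u v x "[]"] by simp

lemma coxeter_map_Suc: "coxeter u v \<Longrightarrow> coxeter (map Suc u) (map Suc v)"
  by (induction rule: coxeter.induct) (auto intro: coxeter.intros)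

text \<open>The word that carries place 0 to place \<open>i\<close> and keeps the order of the other places.\<close>

primrec insertion :: "nat \<Rightarrow> nat list" where
  "insertion 0 = []"
| "insertion (Suc i) = i # insertion i"

lemma coxeter_commute_insertion_above: "i < k \<Longrightarrow> coxeter (k # insertion i) (insertion i @ [k])"
proof (induction i)
  case (Suc i)
  have "coxeter (k # i # insertion i) (i # k # insertion i)"
    using coxeter_append[OF coxeter.far[of k i], of "insertion i"] Suc.prems by simp
  also have "coxeter \<dots> (i # insertion i @ [k])" using Suc by (intro coxeter_Cons) simp
  finally (coxeter.chain) show ?case by simp
qed (simp add: coxeter.same)

text \<open>The insertion lowers the places \<open>k + 1\<close> and \<open>k + 2\<close> by one, so the exchange of \<open>k\<close> and
  \<open>k + 1\<close> after it is the exchange of \<open>k + 1\<close> and \<open>k + 2\<close> before it. A single braid relation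
  is used, where the insertion contains the letters \<open>k + 1\<close> and \<open>k\<close>.\<close>

lemma coxeter_commute_insertion_below: "Suc k < i \<Longrightarrow> coxeter (k # insertion i) (insertion i @ [Suc k])"
proof (induction i)
  case (Suc i)
  show ?case
  proof (cases "Suc k = i")
    case True
    have "coxeter (k # Suc k # k # insertion k) (Suc k # k # Suc k # insertion k)"
      using coxeter_append[OF coxeter.triple[of k], of "insertion k"] by simp
    also have "coxeter \<dots> (Suc k # k # insertion k @ [Suc k])"
      by (intro coxeter_Cons coxeter_commute_insertion_above) simp
    finally (coxeter.chain) show ?thesis using True by auto
  next
    case False
    have "coxeter (k # i # insertion i) (i # k # insertion i)"
      using coxeter_append[OF coxeter.far[of k i], of "insertion i"] Suc.prems False by simp
    also have "coxeter \<dots> (i # insertion i @ [Suc k])" using Suc False by (intro coxeter_Cons) simp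
    finally (coxeter.chain) show ?thesis by simp
  qed
qed simp

text \<open>A letter in front of an insertion lengthens it, cancels its first letter, or passes through to
  the places other than 0.\<close>

lemma coxeter_normal_form:
  "letters_below (Suc n) w \<Longrightarrow> \<exists>i v. i \<le> n \<and> letters_below n v \<and> coxeter w (insertion i @ map Suc v)"
proof (induction w)
  case Nil
  then show ?case by (intro exI[of _ 0] exI[of _ "[]"]) (simp add: coxeter.same)
next
  case (Cons k w)
  then obtain i v where iv: "i \<le> n" "letters_below n v" "coxeter w (insertion i @ map Suc v)" by auto
  have k: "k < n" using Cons.prems by simp
  have w: "coxeter (k # w) ((k # insertion i) @ map Suc v)" using coxeter_Cons[OF iv(3)] by simp
  consider "k = i" | "Suc k = i" | "Suc k < i" | "i < k" by linarith
  then show ?case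
  proof cases
    case 1
    then show ?thesis using w iv k by (intro exI[of _ "Suc i"] exI[of _ v]) simp
  next
    case 2
    have "coxeter (k # insertion i) (insertion k)"
      using coxeter_append[OF coxeter.square[of k], of "insertion k"] 2 by auto
    then have "coxeter (k # w) (insertion k @ map Suc v)" using w coxeter_append coxeter.chain by blast
    then show ?thesis using iv k by (intro exI[of _ k] exI[of _ v]) simp
  next
    case 3
    then have "coxeter (k # w) ((insertion i @ [Suc k]) @ map Suc v)"
      using w coxeter_append coxeter_commute_insertion_below coxeter.chain by blast
    then show ?thesis using iv 3 by (intro exI[of _ i] exI[of _ "k # v"]) simp
  next
    case 4
    then obtain l where l: "k = Suc l" by (cases k) auto
    have "coxeter (k # w) ((insertion i @ [k]) @ map Suc v)"
      using w coxeter_append coxeter_commute_insertion_above[OF 4] coxeter.chain by blast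
    then show ?thesis using iv 4 k l by (intro exI[of _ i] exI[of _ "l # v"]) simp
  qed
qed

primrec perm_of :: "nat list \<Rightarrow> nat \<Rightarrow> nat" where
  "perm_of [] = id"
| "perm_of (k # w) = transpose (Suc k) (Suc (Suc k)) \<circ> perm_of w"

lemma perm_of_append: "perm_of (v @ w) = perm_of v \<circ> perm_of w"
  by (induction v) (auto simp: comp_assoc)

lemma perm_of_permutes: "letters_below n w \<Longrightarrow> perm_of w permutes {1..n}"
  by (induction w) (auto intro!: permutes_id permutes_compose permutes_swap_id)

lemma perm_of_0 [simp]: "perm_of w 0 = 0"
  by (induction w) (auto simp: transpose_def)

lemma perm_of_map_Suc: "perm_of (map Suc w) k = (if k \<le> 1 then k else Suc (perm_of w (k - 1)))"
  by (induction w arbitrary: k) (auto simp: transpose_def)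

lemma inj_perm_of: "inj (perm_of w)"
proof (induction w)
  case (Cons k w)
  then show ?case by (simp only: perm_of.simps) (intro inj_compose inj_transpose)
qed simp

lemma perm_of_insertion: "perm_of (insertion i) (Suc 0) = Suc i"
  by (induction i) auto

lemma coxeter_perm_of: "coxeter u v \<Longrightarrow> perm_of u = perm_of v"
proof (induction rule: coxeter.induct)
  case (within u v x y)
  then show ?case by (simp add: perm_of_append)
qed (auto simp: fun_eq_iff transpose_def)

text \<open>The insertions in the two normal forms are equal since both are determined by the image of the
  first place. They cancel, and the tails represent the same permutation of one place fewer.\<close>

lemma perm_of_faithful:
  "\<lbrakk>letters_below n u; letters_below n v; perm_of u = perm_of v\<rbrakk> \<Longrightarrow> \<exists>w. coxeter u w \<and> coxeter v w"
proof (induction n arbitrary: u v)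
  case 0
  then have "u = []" "v = []" by (auto simp: letters_below_def)
  then show ?case using coxeter.same by blast
next
  case (Suc n)
  obtain i u' where u: "letters_below n u'" "coxeter u (insertion i @ map Suc u')"
    using coxeter_normal_form[OF Suc.prems(1)] by blast
  obtain j v' where v: "letters_below n v'" "coxeter v (insertion j @ map Suc v')"
    using coxeter_normal_form[OF Suc.prems(2)] by blast
  have eq: "perm_of (insertion i) \<circ> perm_of (map Suc u') = perm_of (insertion j) \<circ> perm_of (map Suc v')"
    using coxeter_perm_of[OF u(2)] coxeter_perm_of[OF v(2)] Suc.prems(3) unfolding perm_of_append by metis
  have "i = j" using fun_cong[OF eq, of "Suc 0"] by (simp add: perm_of_map_Suc perm_of_insertion)
  have "perm_of (map Suc u') = perm_of (map Suc v')"
    using eq unfolding \<open>i = j\<close> by (simp add: fun_eq_iff inj_eq[OF inj_perm_of])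
  then have "perm_of u' k = perm_of v' k" for k
    by (cases k) (auto dest: fun_cong[of _ _ "Suc k"] simp: perm_of_map_Suc)
  then obtain w where w: "coxeter u' w" "coxeter v' w" using Suc.IH[OF u(1) v(1)] by auto
  show ?case
  proof (intro exI conjI)
    show "coxeter u (insertion i @ map Suc w)"
      using u(2) coxeter_prepend[OF coxeter_map_Suc[OF w(1)]] coxeter.chain by blast
    show "coxeter v (insertion i @ map Suc w)"
      using v(2) coxeter_prepend[OF coxeter_map_Suc[OF w(2)]] coxeter.chain unfolding \<open>i = j\<close> by blast
  qed
qed

lemma transpose_word: "\<lbrakk>a < b; b < n\<rbrakk> \<Longrightarrow> \<exists>w. letters_below n w \<and> perm_of w = transpose (Suc a) (Suc b)"
proof (induction b)
  case (Suc b)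
  show ?case
  proof (cases "a = b")
    case True
    then show ?thesis using Suc.prems by (intro exI[of _ "[b]"]) auto
  next
    case False
    then obtain w where w: "letters_below n w" "perm_of w = transpose (Suc a) (Suc b)"
      using Suc by auto
    have "a < b" using False Suc.prems by simp
    then have "perm_of (b # w @ [b]) = transpose (Suc a) (Suc (Suc b))"
      by (auto simp: perm_of_append w(2) fun_eq_iff transpose_def)
    then show ?thesis using w Suc.prems by (intro exI[of _ "b # w @ [b]"]) auto
  qed
qed simp

lemma permutation_word:
  assumes s: "\<sigma> permutes {1..n}" shows "\<exists>w. letters_below n w \<and> perm_of w = \<sigma>"
proof (rule permutes_induct[OF s])
  show "\<exists>w. letters_below n w \<and> perm_of w = id" by (intro exI[of _ "[]"]) auto
next
  fix a b p assume ab: "a \<in> {1..n}" "b \<in> {1..n}" and "\<exists>w. letters_below n w \<and> perm_of w = p"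
  then obtain w where w: "letters_below n w" "perm_of w = p" by blast
  have "\<exists>v. letters_below n v \<and> perm_of v = transpose a b"
  proof (cases a b rule: linorder_cases)
    case less
    then show ?thesis using transpose_word[of "a - 1" "b - 1" n] ab by auto
  next
    case equal
    then show ?thesis by (intro exI[of _ "[]"]) auto
  next
    case greater
    then show ?thesis using transpose_word[of "b - 1" "a - 1" n] ab by (auto simp: transpose_commute)
  qed
  then obtain v where "letters_below n v" "perm_of v = transpose a b" by blast
  then show "\<exists>w. letters_below n w \<and> perm_of w = transpose a b \<circ> p"
    using w by (intro exI[of _ "v @ w"]) (auto simp: perm_of_append)
qed simp

section \<open>The finite ordinal category is flat symmetric bimonoidal\<close>
lemma finord_simps [simp]:
  "Obj finord = UNIV" "Dom finord = fst" "Cod finord = fst" "Idn finord n = (n, id)"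
  "TObj (Plus finord) = (+)" "TArr (Plus finord) = block_sum" "Unit (Plus finord) = 0"
  "Assoc (Plus finord) m n p = (m + n + p, id)" "LUnit (Plus finord) n = (n, id)"
  "RUnit (Plus finord) n = (n, id)" "PlusSym finord = block_swap"
  "TObj (Times finord) = (*)" "TArr (Times finord) = perm_prod" "Unit (Times finord) = Suc 0"
  "Assoc (Times finord) m n p = (m * n * p, id)" "LUnit (Times finord) n = (n, id)"
  "RUnit (Times finord) n = (n, id)" "LNull finord n = (0, id)" "RNull finord n = (0, id)"
  "LDist finord = left_distr" "RDist finord m n p = ((m + n) * p, id)"
  "TimesSym finord = pair_swap"
  by (auto simp: finord_def)

lemma finord_cmp: "Cmp finord g f = (fst f, snd g \<circ> snd f)"
  by (cases f; cases g) (simp add: finord_def)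

lemma fst_finord_cmp [simp]: "fst (Cmp finord g f) = fst f"
  and snd_finord_cmp: "snd (Cmp finord g f) k = snd g (snd f k)"
  by (simp_all add: finord_cmp)

lemma finord_Arr: "f \<in> Arr finord \<longleftrightarrow> snd f permutes {1..fst f}"
  by (auto simp: finord_def)

interpretation finord: category finord
  by unfold_locales
    (auto simp: homset_iff finord_Arr finord_cmp comp_assoc intro: permutes_id permutes_compose)

lemma finord_arr_eqI:
  assumes "f \<in> Arr finord" "g \<in> Arr finord" "fst f = fst g"
    "\<And>k. 1 \<le> k \<Longrightarrow> k \<le> fst g \<Longrightarrow> snd f k = snd g k"
  shows "f = g"
proof (rule prod_eqI)
  show "snd f = snd g"
  proof
    fix k
    show "snd f k = snd g k"
    proof (cases "k \<in> {1..fst g}")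
      case False
      then show ?thesis
        using assms permutes_not_in[of "snd f" "{1..fst g}" k] permutes_not_in[of "snd g" "{1..fst g}" k]
        by (simp add: finord_Arr)
    qed (use assms in auto)
  qed
qed fact

text \<open>An arrow fixes 0 and everything above its object, so these equivalences need no bound on \<open>k\<close>.\<close>

lemma snd_bounds:
  assumes "f \<in> Arr finord"
  shows "snd f 0 = 0" "0 < snd f k \<longleftrightarrow> 0 < k" "snd f k = 0 \<longleftrightarrow> k = 0"
    and "fst f = n \<Longrightarrow> snd f k \<le> n \<longleftrightarrow> k \<le> n"
proof -
  have p: "snd f permutes {1..fst f}" using assms by (simp add: finord_Arr)
  show 0: "snd f 0 = 0" using permutes_not_in[OF p] by simp
  show 1: "snd f k = 0 \<longleftrightarrow> k = 0" using permutes_inj[OF p] 0 by (metis injD)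
  then show "0 < snd f k \<longleftrightarrow> 0 < k" by auto
  show "fst f = n \<Longrightarrow> snd f k \<le> n \<longleftrightarrow> k \<le> n"
    using permutes_in_image[OF p, of k] permutes_not_in[OF p, of k] 1 by fastforce
qed

lemma finord_is_iso: 
  assumes "f \<in> Arr finord" shows "is_iso finord f"
proof (rule finord.isoI)
  have p: "snd f permutes {1..fst f}" using assms by (simp add: finord_Arr)
  show "(fst f, inv (snd f)) \<in> Arr finord" using permutes_inv[OF p] by (simp add: finord_Arr)
qed (use assms in \<open>auto simp: finord_cmp finord_Arr permutes_inv_o\<close>)

lemma finord_is_mono: 
  assumes "f \<in> Arr finord" shows "is_mono finord f"
  using assms finord.iso_cancel_left[OF _ finord_is_iso[OF assms]]
  by (auto simp: is_mono_def homset_iff)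

lemma perm_arr_Arr:
  assumes "\<And>k. 1 \<le> k \<Longrightarrow> k \<le> n \<Longrightarrow> 1 \<le> f k \<and> f k \<le> n"
    and "\<And>k l. \<lbrakk>1 \<le> k; k \<le> n; 1 \<le> l; l \<le> n; f k = f l\<rbrakk> \<Longrightarrow> k = l"
  shows "perm_arr n f \<in> Arr finord"
proof -
  let ?g = "\<lambda>k. if k \<in> {1..n} then f k else k"
  have inj: "inj_on ?g {1..n}" using assms(2) by (auto intro!: inj_onI)
  have "?g ` {1..n} = {1..n}"
    by (rule endo_inj_surj[OF _ _ inj]) (use assms(1) in auto)
  with inj have "?g permutes {1..n}" by (intro bij_imp_permutes) (auto simp: bij_betw_def)
  then show ?thesis by (simp add: finord_Arr perm_arr_def)
qed

lemma fst_perm_arr [simp]: "fst (perm_arr n f) = n"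
  and snd_perm_arr: "1 \<le> k \<Longrightarrow> k \<le> n \<Longrightarrow> snd (perm_arr n f) k = f k"
  by (auto simp: perm_arr_def)

lemma finord_cmp_id [simp]:
  "fst f = n \<Longrightarrow> (n, id) \<cdot>\<^bsub>finord\<^esub> f = f" "fst f = n \<Longrightarrow> f \<cdot>\<^bsub>finord\<^esub> (n, id) = f"
  by (auto simp: finord_cmp)

lemma finord_inv_id [simp]: "inv_arr finord (n, id) = (n, id)"
  using finord.inv_idn[of n] by simp

subsection \<open>Sums\<close>

lemma fst_block [simp]:
  "fst (block_sum f g) = fst f + fst g" "fst (block_swap m n) = m + n"
  by (auto simp: block_sum_def block_swap_def split_beta)

lemma snd_block_sum:
  assumes "f \<in> Arr finord" "g \<in> Arr finord"
  shows "snd (block_sum f g) k = (if k \<le> fst f then snd f k else fst f + snd g (k - fst f))"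
proof (cases "k \<le> fst f + fst g")
  case False
  then have "\<not> k - fst f \<le> fst g" by linarith
  then have "snd g (k - fst f) = k - fst f"
    using assms permutes_not_in[of "snd g" "{1..fst g}" "k - fst f"] by (simp add: finord_Arr)
  then show ?thesis using False by (auto simp: block_sum_def split_beta perm_arr_def)
qed (use snd_bounds(1)[OF assms(1)] in \<open>cases k; auto simp: block_sum_def split_beta perm_arr_def\<close>)

lemma snd_block_swap:
  "0 < k \<Longrightarrow> k \<le> m + n \<Longrightarrow> snd (block_swap m n) k = (if k \<le> m then n + k else k - m)"
  by (auto simp: block_swap_def snd_perm_arr Suc_le_eq)

lemma snd_inj: "f \<in> Arr finord \<Longrightarrow> snd f k = snd f l \<longleftrightarrow> k = l"
  by (auto simp: finord_Arr dest: permutes_inj injD)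

lemma block_sum_Arr [simp]:
  assumes f: "f \<in> Arr finord" and g: "g \<in> Arr finord" shows "block_sum f g \<in> Arr finord"
  unfolding block_sum_def split_beta
proof (rule perm_arr_Arr)
  fix k assume k: "1 \<le> k" "k \<le> fst f + fst g"
  then show "1 \<le> (if k \<le> fst f then snd f k else fst f + snd g (k - fst f)) \<and>
     (if k \<le> fst f then snd f k else fst f + snd g (k - fst f)) \<le> fst f + fst g"
    using snd_bounds[OF f] snd_bounds(2)[OF g, of "k - fst f"] snd_bounds(4)[OF g refl, of "k - fst f"]
    by (auto simp: Suc_le_eq trans_le_add1)
next
  fix k l assume "1 \<le> k" "k \<le> fst f + fst g" "1 \<le> l" "l \<le> fst f + fst g" and
    eq: "(if k \<le> fst f then snd f k else fst f + snd g (k - fst f)) = 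
      (if l \<le> fst f then snd f l else fst f + snd g (l - fst f))"
  have mixed: "snd f i \<noteq> fst f + snd g (j - fst f)" if "i \<le> fst f" "\<not> j \<le> fst f" for i j
    using snd_bounds(4)[OF f, of "fst f" i] snd_bounds(2)[OF g, of "j - fst f"] that by auto
  show "k = l"
    using eq mixed[of k l] mixed[of l k] snd_inj[OF f, of k l] snd_inj[OF g, of "k - fst f" "l - fst f"]
    by (auto split: if_splits)
qed

lemma block_swap_Arr [simp]: "block_swap m n \<in> Arr finord"
  unfolding block_swap_def by (rule perm_arr_Arr) (auto split: if_splits)

lemma finord_idn_Arr [simp]: "(n, id) \<in> Arr finord"
  using finord.idn_arr[of n] by simp

lemmas finord_value = snd_finord_cmp snd_block_sum snd_block_swap snd_bounds Suc_le_eq trans_le_add1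

interpretation finord_plus: symmetric_monoidal_category finord "Plus finord" "PlusSym finord"
proof unfold_locales
  fix f g h A A' B B' C C'
  assume *: "f \<in> homset finord A A'" "g \<in> homset finord B B'" "h \<in> homset finord C C'"
  show "Assoc (Plus finord) A' B' C' \<cdot>\<^bsub>finord\<^esub> ((f \<odot>\<^sub>a\<^bsub>Plus finord\<^esub> g) \<odot>\<^sub>a\<^bsub>Plus finord\<^esub> h) =
    (f \<odot>\<^sub>a\<^bsub>Plus finord\<^esub> g \<odot>\<^sub>a\<^bsub>Plus finord\<^esub> h) \<cdot>\<^bsub>finord\<^esub> Assoc (Plus finord) A B C"
    by (rule finord_arr_eqI) (use * in \<open>auto simp: homset_iff finord_value\<close>)
next
  fix f f' g g' A A' A'' B B' B''
  assume *: "f \<in> homset finord A A'" "f' \<in> homset finord A' A''" "g \<in> homset finord B B'" "g' \<in> homset finord B' B''"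
  show "(f' \<cdot>\<^bsub>finord\<^esub> f) \<odot>\<^sub>a\<^bsub>Plus finord\<^esub> (g' \<cdot>\<^bsub>finord\<^esub> g) = (f' \<odot>\<^sub>a\<^bsub>Plus finord\<^esub> g') \<cdot>\<^bsub>finord\<^esub> (f \<odot>\<^sub>a\<^bsub>Plus finord\<^esub> g)"
    by (rule finord_arr_eqI) (use * in \<open>auto simp: homset_iff finord_value\<close>)
next
  fix f g A A' B B'
  assume *: "f \<in> homset finord A A'" "g \<in> homset finord B B'"
  show "PlusSym finord A' B' \<cdot>\<^bsub>finord\<^esub> (f \<odot>\<^sub>a\<^bsub>Plus finord\<^esub> g) = (g \<odot>\<^sub>a\<^bsub>Plus finord\<^esub> f) \<cdot>\<^bsub>finord\<^esub> PlusSym finord A B"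
    by (rule finord_arr_eqI) (use * in \<open>auto simp: homset_iff finord_value\<close>)
qed (auto simp: homset_iff finord_value finord_is_iso intro!: finord_arr_eqI)

subsection \<open>Products\<close>

lemma pair_ix_bounds:
  assumes "0 < i" "i \<le> m" "0 < j" "j \<le> n"
  shows "0 < pair_ix n i j" "pair_ix n i j \<le> m * n"
proof -
  obtain i' where i: "i = Suc i'" using assms by (cases i) auto
  then have "Suc i' * n \<le> m * n" using assms by (intro mult_le_mono1) simp
  then show "pair_ix n i j \<le> m * n" using assms i by (simp add: pair_ix_def)
qed (use assms in \<open>simp add: pair_ix_def\<close>)

lemma row_pair_ix: "\<lbrakk>0 < i; 0 < j; j \<le> n\<rbrakk> \<Longrightarrow> row n (pair_ix n i j) = i"
  and col_pair_ix: "\<lbrakk>0 < i; 0 < j; j \<le> n\<rbrakk> \<Longrightarrow> col n (pair_ix n i j) = j"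
proof -
  assume "0 < i" "0 < j" "j \<le> n"
  then obtain i' j' where [simp]: "i = Suc i'" "j = Suc j'" and "j' < n"
    by (metis Suc_le_eq gr0_conv_Suc)
  then show "row n (pair_ix n i j) = i" "col n (pair_ix n i j) = j"
    by (simp_all add: pair_ix_def row_def col_def)
qed

lemma pair_ix_cases:
  assumes "Suc 0 \<le> k" "k \<le> m * n"
  obtains i j where "0 < i" "i \<le> m" "0 < j" "j \<le> n" "k = pair_ix n i j"
proof
  have "0 < n" using assms by (cases n) auto
  show "k = pair_ix n (row n k) (col n k)"
    using assms by (simp add: pair_ix_def row_def col_def)
  have "(k - 1) div n < m" using assms by (intro less_mult_imp_div_less) auto
  then show "row n k \<le> m" by (simp add: row_def)
  show "col n k \<le> n" using \<open>0 < n\<close> by (simp add: col_def Suc_le_eq)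
qed (auto simp: row_def col_def)

lemma pair_ix_eq_iff:
  "\<lbrakk>0 < i; 0 < j; j \<le> n; 0 < i'; 0 < j'; j' \<le> n\<rbrakk> \<Longrightarrow> pair_ix n i j = pair_ix n i' j' \<longleftrightarrow> i = i' \<and> j = j'"
  by (metis row_pair_ix col_pair_ix)

lemma pair_ix_assoc: "\<lbrakk>0 < i; 0 < j\<rbrakk> \<Longrightarrow> pair_ix (n * p) i (pair_ix p j l) = pair_ix p (pair_ix n i j) l"
  by (cases i; cases j) (auto simp: pair_ix_def algebra_simps)

lemma pair_ix_add: "0 < i \<Longrightarrow> pair_ix p (m + i) j = m * p + pair_ix p i j"
  by (cases i) (auto simp: pair_ix_def algebra_simps)

lemma pair_ix_one [simp]: "pair_ix n (Suc 0) j = j" "0 < i \<Longrightarrow> pair_ix (Suc 0) i (Suc 0) = i"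
  by (auto simp: pair_ix_def)

lemma finord_prod_eqI:
  assumes "f \<in> Arr finord" "g \<in> Arr finord" "fst f = m * n" "fst g = m * n"
    "\<And>i j. \<lbrakk>0 < i; i \<le> m; 0 < j; j \<le> n\<rbrakk> \<Longrightarrow> snd f (pair_ix n i j) = snd g (pair_ix n i j)"
  shows "f = g"
proof (rule finord_arr_eqI)
  fix k assume "1 \<le> k" "k \<le> fst g"
  then obtain i j where "0 < i" "i \<le> m" "0 < j" "j \<le> n" "k = pair_ix n i j"
    using assms(4) by (auto elim: pair_ix_cases[of k m n])
  then show "snd f k = snd g k" using assms(5) by simp
qed (use assms in auto)

lemma fst_products [simp]:
  "fst (perm_prod f g) = fst f * fst g" "fst (pair_swap m n) = m * n" 
  "fst (left_distr m n p) = m * (n + p)"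
  by (auto simp: perm_prod_def pair_swap_def left_distr_def split_beta)

lemma snd_perm_prod:
  "\<lbrakk>fst g = n; 0 < i; i \<le> fst f; 0 < j; j \<le> n\<rbrakk> \<Longrightarrow>
    snd (perm_prod f g) (pair_ix n i j) = pair_ix n (snd f i) (snd g j)"
  using pair_ix_bounds[of i "fst f" j n]
  by (auto simp: perm_prod_def split_beta snd_perm_arr Suc_le_eq row_pair_ix col_pair_ix)

lemma snd_pair_swap:
  "\<lbrakk>0 < i; i \<le> m; 0 < j; j \<le> n\<rbrakk> \<Longrightarrow> snd (pair_swap m n) (pair_ix n i j) = pair_ix m j i"
  using pair_ix_bounds[of i m j n]
  by (auto simp: pair_swap_def snd_perm_arr Suc_le_eq row_pair_ix col_pair_ix)

lemma pair_ix_pos: "0 < j \<Longrightarrow> pair_ix n i j \<noteq> 0"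
  by (simp add: pair_ix_def)

lemma snd_left_distr:
  "\<lbrakk>q = n + p; 0 < i; i \<le> m; 0 < j; j \<le> q\<rbrakk> \<Longrightarrow> snd (left_distr m n p) (pair_ix q i j) = 
    (if j \<le> n then pair_ix n i j else m * n + pair_ix p i (j - n))"
  using pair_ix_bounds[of i m j "n + p"]
  by (auto simp: left_distr_def snd_perm_arr Suc_le_eq row_pair_ix col_pair_ix)

lemma perm_prod_Arr [simp]:
  assumes f: "f \<in> Arr finord" and g: "g \<in> Arr finord" shows "perm_prod f g \<in> Arr finord"
  unfolding perm_prod_def split_beta
proof (rule perm_arr_Arr)
  fix k assume "1 \<le> k" "k \<le> fst f * fst g"
  then obtain i j where "0 < i" "i \<le> fst f" "0 < j" "j \<le> fst g" "k = pair_ix (fst g) i j"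
    by (auto elim: pair_ix_cases[of k "fst f" "fst g"])
  then show "1 \<le> pair_ix (fst g) (snd f (row (fst g) k)) (snd g (col (fst g) k)) \<and>
     pair_ix (fst g) (snd f (row (fst g) k)) (snd g (col (fst g) k)) \<le> fst f * fst g"
    using snd_bounds[OF f] snd_bounds[OF g]
      pair_ix_bounds[of "snd f i" "fst f" "snd g j" "fst g"]
    by (simp add: row_pair_ix col_pair_ix Suc_le_eq)
next
  fix k l assume "1 \<le> k" "k \<le> fst f * fst g" "1 \<le> l" "l \<le> fst f * fst g" and 
    eq: "pair_ix (fst g) (snd f (row (fst g) k)) (snd g (col (fst g) k)) 
      = pair_ix (fst g) (snd f (row (fst g) l)) (snd g (col (fst g) l))"
  then obtain i j i' j' where "0 < i" "i \<le> fst f" "0 < j" "j \<le> fst g" "k = pair_ix (fst g) i j"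
    "0 < i'" "i' \<le> fst f" "0 < j'" "j' \<le> fst g" "l = pair_ix (fst g) i' j'"
    by (auto elim!: pair_ix_cases[of k "fst f" "fst g"] pair_ix_cases[of l "fst f" "fst g"])
  then show "k = l"
    using eq snd_bounds[OF f] snd_bounds[OF g]
    by (simp add: row_pair_ix col_pair_ix pair_ix_eq_iff snd_inj[OF f] snd_inj[OF g])
qed

lemma pair_swap_Arr [simp]: "pair_swap m n \<in> Arr finord"
  unfolding pair_swap_def
proof (rule perm_arr_Arr)
  fix k assume "1 \<le> k" "k \<le> m * n"
  then obtain i j where "0 < i" "i \<le> m" "0 < j" "j \<le> n" "k = pair_ix n i j"
    by (auto elim: pair_ix_cases[of k m n])
  then show "1 \<le> pair_ix m (col n k) (row n k) \<and> pair_ix m (col n k) (row n k) \<le> m * n"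
    using pair_ix_bounds[of j n i m] by (simp add: row_pair_ix col_pair_ix Suc_le_eq mult.commute)
next
  fix k l assume "1 \<le> k" "k \<le> m * n" "1 \<le> l" "l \<le> m * n" and 
    eq: "pair_ix m (col n k) (row n k) = pair_ix m (col n l) (row n l)"
  then obtain i j i' j' where "0 < i" "i \<le> m" "0 < j" "j \<le> n" "k = pair_ix n i j"
    "0 < i'" "i' \<le> m" "0 < j'" "j' \<le> n" "l = pair_ix n i' j'"
    by (auto elim!: pair_ix_cases[of k m n] pair_ix_cases[of l m n])
  then show "k = l" using eq by (simp add: row_pair_ix col_pair_ix pair_ix_eq_iff)
qed

lemma left_distr_Arr [simp]: "left_distr m n p \<in> Arr finord"
  unfolding left_distr_def Let_def
proof (rule perm_arr_Arr)
  let ?f = "\<lambda>k. if col (n + p) k \<le> n then pair_ix n (row (n + p) k) (col (n + p) k)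
    else m * n + pair_ix p (row (n + p) k) (col (n + p) k - n)"
  {
    fix k assume "1 \<le> k" "k \<le> m * (n + p)"
    then obtain i j where ij: "0 < i" "i \<le> m" "0 < j" "j \<le> n + p" "k = pair_ix (n + p) i j"
      by (auto elim: pair_ix_cases[of k m "n + p"])
    then show "1 \<le> ?f k \<and> ?f k \<le> m * (n + p)"
      using pair_ix_bounds[of i m j n] pair_ix_bounds[of i m "j - n" p]
      by (cases "j \<le> n") (auto simp: row_pair_ix col_pair_ix Suc_le_eq algebra_simps)
  }
  fix k l assume "1 \<le> k" "k \<le> m * (n + p)" "1 \<le> l" "l \<le> m * (n + p)" and eq: "?f k = ?f l"
  then obtain i j i' j' where ij: "0 < i" "i \<le> m" "0 < j" "j \<le> n + p" "k = pair_ix (n + p) i j"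
    "0 < i'" "i' \<le> m" "0 < j'" "j' \<le> n + p" "l = pair_ix (n + p) i' j'"
    by (auto elim!: pair_ix_cases[of k m "n + p"] pair_ix_cases[of l m "n + p"])
  have mixed: "pair_ix n a b \<noteq> m * n + pair_ix p c d" 
    if "0 < a" "a \<le> m" "0 < b" "b \<le> n" "0 < d" for a b c d
    using pair_ix_bounds[of a m b n] that by (simp add: pair_ix_def)
  show "k = l"
    using eq ij mixed[of i j "j' - n" i'] mixed[of i' j' "j - n" i]
    by (auto simp: row_pair_ix col_pair_ix pair_ix_eq_iff split: if_splits)
qed

lemma finord_triple_eqI:
  assumes "f \<in> Arr finord" "g \<in> Arr finord" "fst f = m * n * p" "fst g = m * n * p"
    "\<And>i j k. \<lbrakk>0 < i; i \<le> m; 0 < j; j \<le> n; 0 < k; k \<le> p\<rbrakk>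
      \<Longrightarrow> snd f (pair_ix p (pair_ix n i j) k) = snd g (pair_ix p (pair_ix n i j) k)"
  shows "f = g"
proof (rule finord_prod_eqI[OF assms(1-4)])
  fix l k assume l: "0 < l" "l \<le> m * n" and k: "0 < k" "k \<le> p"
  then obtain i j where "0 < i" "i \<le> m" "0 < j" "j \<le> n" "l = pair_ix n i j"
    using pair_ix_cases[of l m n] by (metis Suc_leI)
  then show "snd f (pair_ix p l k) = snd g (pair_ix p l k)" using assms(5) k by simp
qed

lemma snd_perm_prod_assoc:
  assumes "f \<in> Arr finord" "g \<in> Arr finord" "h \<in> Arr finord" "fst g = n" "fst h = p"
    "0 < i" "i \<le> fst f" "0 < j" "j \<le> n" "0 < k" "k \<le> p"
  shows "snd (perm_prod f (perm_prod g h)) (pair_ix p (pair_ix n i j) k)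
     = pair_ix p (pair_ix n (snd f i) (snd g j)) (snd h k)"
  using assms
  by (simp add: pair_ix_assoc[symmetric] snd_perm_prod pair_ix_bounds snd_bounds)

lemma snd_perm_prod_assoc':
  assumes "f \<in> Arr finord" "g \<in> Arr finord" "h \<in> Arr finord" "fst g = n" "fst h = p"
    "0 < i" "i \<le> fst f" "0 < j" "j \<le> n" "0 < k" "k \<le> p"
  shows "snd (perm_prod (perm_prod f g) h) (pair_ix p (pair_ix n i j) k)
     = pair_ix p (pair_ix n (snd f i) (snd g j)) (snd h k)"
  using assms by (simp add: snd_perm_prod pair_ix_bounds)

lemma one_perm_prod: 
  assumes "f \<in> Arr finord" shows "perm_prod (Suc 0, id) f = f"
proof (rule finord_prod_eqI[of _ _ "Suc 0" "fst f"])
  fix i j assume "0 < i" "i \<le> Suc 0" "0 < j" "j \<le> fst f"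
  then have "i = Suc 0" "0 < j" "j \<le> fst f" by auto
  then show "snd (perm_prod (Suc 0, id) f) (pair_ix (fst f) i j) = snd f (pair_ix (fst f) i j)"
    using snd_perm_prod[of f "fst f" "Suc 0" "(Suc 0, id)" j] by simp
qed (use assms in auto)

lemma perm_prod_one: 
  assumes "f \<in> Arr finord" shows "perm_prod f (Suc 0, id) = f"
proof (rule finord_prod_eqI[of _ _ "fst f" "Suc 0"])
  fix i j assume "0 < i" "i \<le> fst f" "0 < j" "j \<le> Suc 0"
  then have j: "j = Suc 0" and i: "0 < i" "i \<le> fst f" by auto
  have "snd (perm_prod f (Suc 0, id)) (pair_ix (Suc 0) i (Suc 0)) = pair_ix (Suc 0) (snd f i) (Suc 0)"
    using i by (subst snd_perm_prod) auto
  then show "snd (perm_prod f (Suc 0, id)) (pair_ix (Suc 0) i j) = snd f (pair_ix (Suc 0) i j)"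
    using i snd_bounds[OF assms] j by simp
qed (use assms in auto)

lemma perm_prod_id [simp]: "perm_prod (m, id) (n, id) = (m * n, id)"
  by (rule finord_prod_eqI[of _ _ m n]) (auto simp: snd_perm_prod)

lemma pair_swap_one: "pair_swap n (Suc 0) = (n, id)"
proof (rule finord_prod_eqI[of _ _ n "Suc 0"])
  fix i j assume "0 < i" "i \<le> n" "0 < j" "j \<le> Suc 0"
  then have "j = Suc 0" "0 < i" "i \<le> n" by auto
  then show "snd (pair_swap n (Suc 0)) (pair_ix (Suc 0) i j) = snd (n, id) (pair_ix (Suc 0) i j)"
    using snd_pair_swap[of i n "Suc 0" "Suc 0"] by simp
qed auto

lemma pair_swap_swap: "pair_swap n m \<cdot>\<^bsub>finord\<^esub> pair_swap m n = (m * n, id)"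
  by (rule finord_prod_eqI[of _ _ m n]) (auto simp: snd_finord_cmp snd_pair_swap)

interpretation finord_times: symmetric_monoidal_category finord "Times finord" "TimesSym finord"
proof unfold_locales
  fix f g h A A' B B' C C'
  assume *: "f \<in> homset finord A A'" "g \<in> homset finord B B'" "h \<in> homset finord C C'"
  show "Assoc (Times finord) A' B' C' \<cdot>\<^bsub>finord\<^esub> ((f \<odot>\<^sub>a\<^bsub>Times finord\<^esub> g) \<odot>\<^sub>a\<^bsub>Times finord\<^esub> h) =
    (f \<odot>\<^sub>a\<^bsub>Times finord\<^esub> g \<odot>\<^sub>a\<^bsub>Times finord\<^esub> h) \<cdot>\<^bsub>finord\<^esub> Assoc (Times finord) A B C"
    by (rule finord_triple_eqI[of _ _ A B C])
      (use * in \<open>auto simp: homset_iff snd_finord_cmp snd_perm_prod_assoc snd_perm_prod_assoc'\<close>)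
next
  fix f f' g g' A A' A'' B B' B''
  assume *: "f \<in> homset finord A A'" "f' \<in> homset finord A' A''" "g \<in> homset finord B B'" "g' \<in> homset finord B' B''"
  show "(f' \<cdot>\<^bsub>finord\<^esub> f) \<odot>\<^sub>a\<^bsub>Times finord\<^esub> (g' \<cdot>\<^bsub>finord\<^esub> g) = (f' \<odot>\<^sub>a\<^bsub>Times finord\<^esub> g') \<cdot>\<^bsub>finord\<^esub> (f \<odot>\<^sub>a\<^bsub>Times finord\<^esub> g)"
    by (rule finord_prod_eqI[of _ _ A B])
      (use * in \<open>auto simp: homset_iff snd_finord_cmp snd_perm_prod snd_bounds\<close>)
next
  fix f g A A' B B'
  assume *: "f \<in> homset finord A A'" "g \<in> homset finord B B'"
  show "TimesSym finord A' B' \<cdot>\<^bsub>finord\<^esub> (f \<odot>\<^sub>a\<^bsub>Times finord\<^esub> g) = (g \<odot>\<^sub>a\<^bsub>Times finord\<^esub> f) \<cdot>\<^bsub>finord\<^esub> TimesSym finord A B"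
    by (rule finord_prod_eqI[of _ _ A B])
      (use * in \<open>auto simp: homset_iff snd_finord_cmp snd_perm_prod snd_bounds snd_pair_swap\<close>)
next
  fix f A B assume "f \<in> homset finord A B"
  then show "LUnit (Times finord) B \<cdot>\<^bsub>finord\<^esub> (Idn finord (Unit (Times finord)) \<odot>\<^sub>a\<^bsub>Times finord\<^esub> f) = f \<cdot>\<^bsub>finord\<^esub> LUnit (Times finord) A"
    by (auto simp: homset_iff one_perm_prod)
next
  fix f A B assume "f \<in> homset finord A B"
  then show "RUnit (Times finord) B \<cdot>\<^bsub>finord\<^esub> (f \<odot>\<^sub>a\<^bsub>Times finord\<^esub> Idn finord (Unit (Times finord))) = f \<cdot>\<^bsub>finord\<^esub> RUnit (Times finord) A"
    by (auto simp: homset_iff perm_prod_one)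
next
  fix A B C :: nat
  show "Assoc (Times finord) B C A \<cdot>\<^bsub>finord\<^esub> TimesSym finord A (B \<odot>\<^bsub>Times finord\<^esub> C) \<cdot>\<^bsub>finord\<^esub> Assoc (Times finord) A B C =
       (Idn finord B \<odot>\<^sub>a\<^bsub>Times finord\<^esub> TimesSym finord A C) \<cdot>\<^bsub>finord\<^esub> Assoc (Times finord) B A C
       \<cdot>\<^bsub>finord\<^esub> (TimesSym finord A B \<odot>\<^sub>a\<^bsub>Times finord\<^esub> Idn finord C)"
  proof (rule finord_triple_eqI[of _ _ A B C])
    fix i j k assume *: "0 < i" "i \<le> A" "0 < j" "j \<le> B" "0 < k" "k \<le> C"
    have "snd (perm_prod (B, id) (pair_swap A C)) (pair_ix C (pair_ix A j i) k)
      = pair_ix A (pair_ix C j k) i"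
      using * by (simp add: pair_ix_assoc[of j i A C, symmetric] snd_perm_prod snd_pair_swap
          pair_ix_bounds pair_ix_assoc[of j k C A, symmetric] mult.commute)
    moreover have "snd (pair_swap A (B * C)) (pair_ix C (pair_ix B i j) k)
      = pair_ix A (pair_ix C j k) i"
      using * by (simp add: pair_ix_assoc[of i j B C, symmetric] snd_pair_swap pair_ix_bounds)
    ultimately show "snd (Assoc (Times finord) B C A \<cdot>\<^bsub>finord\<^esub> TimesSym finord A (B \<odot>\<^bsub>Times finord\<^esub> C) \<cdot>\<^bsub>finord\<^esub> Assoc (Times finord) A B C) (pair_ix C (pair_ix B i j) k) =
       snd ((Idn finord B \<odot>\<^sub>a\<^bsub>Times finord\<^esub> TimesSym finord A C) \<cdot>\<^bsub>finord\<^esub> Assoc (Times finord) B A C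
       \<cdot>\<^bsub>finord\<^esub> (TimesSym finord A B \<odot>\<^sub>a\<^bsub>Times finord\<^esub> Idn finord C)) (pair_ix C (pair_ix B i j) k)"
      using * by (simp add: snd_finord_cmp snd_perm_prod snd_pair_swap pair_ix_bounds ac_simps)
  qed (auto simp: ac_simps)
qed (auto simp: homset_iff finord_is_iso pair_swap_one pair_swap_swap ac_simps)

lemma finord_tensor_id [simp]:
  "block_sum (m, id) (n, id) = (m + n, id)"
  using finord_plus.tidn[of m n] by auto

lemma finord_mid_swap: "bimonoidal_notation.mid_swap finord W X Y Z =
  block_sum (W, id) (block_sum (block_swap X Y) (Z, id))"
  unfolding bimonoidal_notation.mid_swap_def
  by (simp add: ac_simps)

lemma finord_lsum_eqI:
  assumes "f \<in> Arr finord" "g \<in> Arr finord" "fst f = m * (n + p)" "fst g = m * (n + p)"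
    "\<And>i j. \<lbrakk>0 < i; i \<le> m; 0 < j; j \<le> n\<rbrakk> \<Longrightarrow> snd f (pair_ix (n + p) i j) = snd g (pair_ix (n + p) i j)"
    "\<And>i j. \<lbrakk>0 < i; i \<le> m; 0 < j; j \<le> p\<rbrakk> \<Longrightarrow> snd f (pair_ix (n + p) i (n + j)) = snd g (pair_ix (n + p) i (n + j))"
  shows "f = g"
proof (rule finord_prod_eqI[OF assms(1-4)])
  fix i j assume "0 < i" "i \<le> m" "0 < j" "j \<le> n + p"
  then show "snd f (pair_ix (n + p) i j) = snd g (pair_ix (n + p) i j)" 
    using assms(5)[of i j] assms(6)[of i "j - n"] by (cases "j \<le> n") auto
qed

lemma finord_rsum_eqI:
  assumes "f \<in> Arr finord" "g \<in> Arr finord" "fst f = (m + n) * p" "fst g = (m + n) * p"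
    "\<And>i j. \<lbrakk>0 < i; i \<le> m; 0 < j; j \<le> p\<rbrakk> \<Longrightarrow> snd f (pair_ix p i j) = snd g (pair_ix p i j)"
    "\<And>i j. \<lbrakk>0 < i; i \<le> n; 0 < j; j \<le> p\<rbrakk> \<Longrightarrow> snd f (m * p + pair_ix p i j) = snd g (m * p + pair_ix p i j)"
  shows "f = g"
proof (rule finord_prod_eqI[OF assms(1-4)])
  fix i j assume "0 < i" "i \<le> m + n" "0 < j" "j \<le> p"
  then show "snd f (pair_ix p i j) = snd g (pair_ix p i j)" 
    using assms(5)[of i j] assms(6)[of "i - m" j] pair_ix_add[of "i - m" p m j] by (cases "i \<le> m") auto
qed

lemma snd_perm_prod_add:
  "\<lbrakk>fst g = p; 0 < i; m + i \<le> fst f; 0 < j; j \<le> p\<rbrakk> \<Longrightarrow>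
    snd (perm_prod f g) (m * p + pair_ix p i j) = pair_ix p (snd f (m + i)) (snd g j)"
  using snd_perm_prod[of g p "m + i" f j] by (simp add: pair_ix_add)

lemmas fin_value = snd_finord_cmp pair_ix_pos trans_le_add1 snd_block_sum snd_block_swap snd_perm_prod snd_perm_prod_add
  snd_pair_swap snd_left_distr pair_ix_bounds pair_ix_add snd_bounds

lemma snd_left_distr_add:
  "\<lbrakk>q = n + p; 0 < i; l + i \<le> m; 0 < j; j \<le> q\<rbrakk> \<Longrightarrow> snd (left_distr m n p) (l * q + pair_ix q i j) = 
    (if j \<le> n then l * n + pair_ix n i j else m * n + (l * p + pair_ix p i (j - n)))"
  using snd_left_distr[of q n p "l + i" m j] by (simp add: pair_ix_add)

lemma finord_zero: "f \<in> Arr finord \<Longrightarrow> fst f = 0 \<Longrightarrow> f = (0, id)"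
  by (rule finord_arr_eqI) auto

lemma left_distr_zero:
  "left_distr 0 n p = (0, id)" "left_distr m 0 p = (m * p, id)" "left_distr m n 0 = (m * n, id)"
proof -
  show "left_distr 0 n p = (0, id)" by (rule finord_zero) auto
  show "left_distr m 0 p = (m * p, id)" 
    by (rule finord_prod_eqI[of _ _ m p]) (auto simp: snd_left_distr)
  show "left_distr m n 0 = (m * n, id)" 
    by (rule finord_prod_eqI[of _ _ m n]) (auto simp: snd_left_distr)
qed

lemma snd_pair_swap_add:
  "\<lbrakk>0 < i; l + i \<le> m; 0 < j; j \<le> n\<rbrakk> \<Longrightarrow> snd (pair_swap m n) (l * n + pair_ix n i j) = pair_ix m j (l + i)"
  using snd_pair_swap[of "l + i" m j n] by (simp add: pair_ix_add)

lemma left_distr_one: "left_distr (Suc 0) n p = (n + p, id)"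
proof (rule finord_arr_eqI)
  fix k assume "1 \<le> k" "k \<le> fst (n + p, id :: nat \<Rightarrow> nat)"
  then show "snd (left_distr (Suc 0) n p) k = snd (n + p, id) k"
    using snd_left_distr[of "n + p" n p "Suc 0" "Suc 0" k] by auto
qed auto

lemma left_distr_add:
  "block_sum (left_distr m n p) (m * q, id) \<cdot>\<^bsub>finord\<^esub> left_distr m (n + p) q
    = block_sum (m * n, id) (left_distr m p q) \<cdot>\<^bsub>finord\<^esub> left_distr m n (p + q)" (is "?l = ?r")
proof (rule finord_prod_eqI[of _ _ m "n + p + q"])
  fix i j assume ij: "0 < i" "i \<le> m" "0 < j" "j \<le> n + p + q"
  then have "snd (left_distr m (n + p) q) (pair_ix (n + p + q) i j)
      = (if j \<le> n + p then pair_ix (n + p) i j else m * (n + p) + pair_ix q i (j - (n + p)))"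
    by (intro snd_left_distr) auto
  moreover have "snd (left_distr m n (p + q)) (pair_ix (n + p + q) i j)
      = (if j \<le> n then pair_ix n i j else m * n + pair_ix (p + q) i (j - n))"
    using ij by (intro snd_left_distr) auto
  ultimately show "snd ?l (pair_ix (n + p + q) i j) = snd ?r (pair_ix (n + p + q) i j)"
    using ij pair_ix_bounds[of i m "j - n" p] pair_ix_bounds[of i m "j - (n + p)" q]
    by (auto simp: fin_value, simp_all add: distrib_left)
qed (auto simp: distrib_left)

lemma left_distr_mult:
  "left_distr m (n * p) (n * q) \<cdot>\<^bsub>finord\<^esub> perm_prod (m, id) (left_distr n p q) = left_distr (m * n) p q"
  (is "?l = ?r")
proof (rule finord_triple_eqI[of _ _ m n "p + q"])
  fix i j k assume ij: "0 < i" "i \<le> m" "0 < j" "j \<le> n" "0 < k" "k \<le> p + q"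
  let ?x = "if k \<le> p then pair_ix p j k else n * p + pair_ix q j (k - p)"
  have x: "0 < ?x" "?x \<le> n * (p + q)"
    using ij pair_ix_bounds[of j n k p] pair_ix_bounds[of j n "k - p" q] by (auto simp: distrib_left)
  have "snd (perm_prod (m, id) (left_distr n p q)) (pair_ix (p + q) (pair_ix n i j) k)
    = pair_ix (n * (p + q)) i ?x"
    using ij by (simp add: pair_ix_assoc[symmetric] snd_perm_prod snd_left_distr pair_ix_bounds)
  moreover have "snd (left_distr m (n * p) (n * q)) (pair_ix (n * (p + q)) i ?x)
    = (if ?x \<le> n * p then pair_ix (n * p) i ?x else m * (n * p) + pair_ix (n * q) i (?x - n * p))"
    using ij x by (intro snd_left_distr) (auto simp: distrib_left)
  moreover have "\<dots> = (if k \<le> p then pair_ix p (pair_ix n i j) k 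
      else m * (n * p) + pair_ix q (pair_ix n i j) (k - p))"
  proof (cases "k \<le> p")
    case True
    then show ?thesis using ij pair_ix_bounds[of j n k p] by (simp add: pair_ix_assoc)
  next
    case False
    then have "0 < k - p" "k - p \<le> q" using ij by auto
    then show ?thesis using False ij by (simp add: pair_ix_assoc pair_ix_pos)
  qed
  ultimately show "snd ?l (pair_ix (p + q) (pair_ix n i j) k) = snd ?r (pair_ix (p + q) (pair_ix n i j) k)"
    using ij by (simp add: snd_finord_cmp snd_left_distr pair_ix_bounds)
qed (auto simp: distrib_left)

lemma perm_prod_left_distr:
  "perm_prod (left_distr m n p) (q, id) = left_distr m (n * q) (p * q)"
proof (rule finord_triple_eqI[of _ _ m "n + p" q])
  fix i j k assume ij: "0 < i" "i \<le> m" "0 < j" "j \<le> n + p" "0 < k" "k \<le> q"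
  have bounds: "0 < pair_ix q j k" "pair_ix q j k \<le> (n + p) * q" using ij pair_ix_bounds by auto
  have "snd (left_distr m (n * q) (p * q)) (pair_ix ((n + p) * q) i (pair_ix q j k)) =
    (if pair_ix q j k \<le> n * q then pair_ix (n * q) i (pair_ix q j k)
     else m * (n * q) + pair_ix (p * q) i (pair_ix q j k - n * q))"
    using ij bounds by (intro snd_left_distr) (auto simp: distrib_right)
  moreover have "pair_ix q j k \<le> n * q \<longleftrightarrow> j \<le> n" "j > n \<Longrightarrow> pair_ix q j k = n * q + pair_ix q (j - n) k"
    using ij pair_ix_bounds[of j n k q] pair_ix_add[of "j - n" q n k] pair_ix_pos[of k q "j - n"] 
    by (cases "j \<le> n"; force)+
  ultimately show "snd (perm_prod (left_distr m n p) (q, id)) (pair_ix q (pair_ix (n + p) i j) k) =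
      snd (left_distr m (n * q) (p * q)) (pair_ix q (pair_ix (n + p) i j) k)"
    using ij by (simp add: pair_ix_assoc snd_perm_prod snd_left_distr pair_ix_bounds pair_ix_add)
qed (auto simp: distrib_left distrib_right)

interpretation finord_bi: bimonoidal_category finord
proof unfold_locales
  fix f g h A A' B B' C C'
  assume *: "f \<in> homset finord A A'" "g \<in> homset finord B B'" "h \<in> homset finord C C'"
  show "LDist finord A' B' C' \<cdot>\<^bsub>finord\<^esub> (f \<odot>\<^sub>a\<^bsub>Times finord\<^esub> (g \<odot>\<^sub>a\<^bsub>Plus finord\<^esub> h)) =
    ((f \<odot>\<^sub>a\<^bsub>Times finord\<^esub> g) \<odot>\<^sub>a\<^bsub>Plus finord\<^esub> (f \<odot>\<^sub>a\<^bsub>Times finord\<^esub> h)) \<cdot>\<^bsub>finord\<^esub> LDist finord A B C"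
    by (rule finord_lsum_eqI[of _ _ A B C])
      (use * in \<open>auto simp: homset_iff fin_value distrib_left distrib_right\<close>)
  show "RDist finord A' B' C' \<cdot>\<^bsub>finord\<^esub> ((f \<odot>\<^sub>a\<^bsub>Plus finord\<^esub> g) \<odot>\<^sub>a\<^bsub>Times finord\<^esub> h) =
    ((f \<odot>\<^sub>a\<^bsub>Times finord\<^esub> h) \<odot>\<^sub>a\<^bsub>Plus finord\<^esub> (g \<odot>\<^sub>a\<^bsub>Times finord\<^esub> h)) \<cdot>\<^bsub>finord\<^esub> RDist finord A B C"
    by (rule finord_rsum_eqI[of _ _ A B C])
      (use * in \<open>auto simp: homset_iff fin_value distrib_left distrib_right\<close>)
next
  fix A B C :: nat
  show "LDist finord A C B \<cdot>\<^bsub>finord\<^esub> (Idn finord A \<odot>\<^sub>a\<^bsub>Times finord\<^esub> PlusSym finord B C) 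
     = PlusSym finord (A \<odot>\<^bsub>Times finord\<^esub> B) (A \<odot>\<^bsub>Times finord\<^esub> C) \<cdot>\<^bsub>finord\<^esub> LDist finord A B C"
    by (rule finord_lsum_eqI[of _ _ A B C]) (auto simp: fin_value distrib_left distrib_right)
  show "RDist finord B A C \<cdot>\<^bsub>finord\<^esub> (PlusSym finord A B \<odot>\<^sub>a\<^bsub>Times finord\<^esub> Idn finord C) 
     = PlusSym finord (A \<odot>\<^bsub>Times finord\<^esub> C) (B \<odot>\<^bsub>Times finord\<^esub> C) \<cdot>\<^bsub>finord\<^esub> RDist finord A B C"
    by (rule finord_rsum_eqI[of _ _ A B C]) (auto simp: fin_value distrib_left distrib_right)
next
  fix A B C D :: nat
  show "(bimonoidal_notation.mid_swap finord (A \<odot>\<^bsub>Times finord\<^esub> C) (A \<odot>\<^bsub>Times finord\<^esub> D)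
        (B \<odot>\<^bsub>Times finord\<^esub> C) (B \<odot>\<^bsub>Times finord\<^esub> D)) \<cdot>\<^bsub>finord\<^esub> 
      (LDist finord A C D \<odot>\<^sub>a\<^bsub>Plus finord\<^esub> LDist finord B C D) \<cdot>\<^bsub>finord\<^esub> RDist finord A B (C \<odot>\<^bsub>Plus finord\<^esub> D)
    = (RDist finord A B C \<odot>\<^sub>a\<^bsub>Plus finord\<^esub> RDist finord A B D) \<cdot>\<^bsub>finord\<^esub> LDist finord (A \<odot>\<^bsub>Plus finord\<^esub> B) C D"
    (is "?l = ?r")
  proof (rule finord_rsum_eqI[of _ _ A B "C + D"])
    fix i j assume "0 < i" "i \<le> A" "0 < j" "j \<le> C + D"
    then show "snd ?l (pair_ix (C + D) i j) = snd ?r (pair_ix (C + D) i j)"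
      using pair_ix_bounds[of i A j C] pair_ix_bounds[of i A "j - C" D]
      by (cases "j \<le> C") (auto simp: finord_mid_swap fin_value distrib_right)
  next
    fix i j assume "0 < i" "i \<le> B" "0 < j" "j \<le> C + D"
    then show "snd ?l (A * (C + D) + pair_ix (C + D) i j) = snd ?r (A * (C + D) + pair_ix (C + D) i j)"
      using pair_ix_bounds[of i B j C] pair_ix_bounds[of i B "j - C" D]
      by (cases "j \<le> C") (auto simp: finord_mid_swap fin_value distrib_right snd_left_distr_add, simp_all add: distrib_left fin_value)
  qed (auto simp: finord_mid_swap distrib_left distrib_right)
qed (auto simp: homset_iff finord_is_iso finord_is_mono algebra_simps left_distr_zero left_distr_one
    left_distr_add left_distr_mult perm_prod_left_distr intro!: finord_zero)

lemma finord_flat_class: "f \<in> flat_class finord \<Longrightarrow> f \<in> Arr finord"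
  by (induction rule: flat_class.induct) auto

text \<open>Flatness holds since every arrow of this category is invertible.\<close>

lemma flat_symmetric_bimonoidal_finord: "flat_symmetric_bimonoidal_category finord"
proof unfold_locales
  fix A B C :: nat
  show "LDist finord C A B \<cdot>\<^bsub>finord\<^esub> TimesSym finord (A \<odot>\<^bsub>Plus finord\<^esub> B) C
    = (TimesSym finord A C \<odot>\<^sub>a\<^bsub>Plus finord\<^esub> TimesSym finord B C) \<cdot>\<^bsub>finord\<^esub> RDist finord A B C"
    by (rule finord_rsum_eqI[of _ _ A B C])
      (auto simp: fin_value snd_pair_swap_add mult.commute distrib_right, (simp_all add: distrib_left)?)
qed (auto simp: finord_flat_class finord_is_mono intro!: finord_zero)

section \<open>The free symmetric monoidal category on one object\<close>
lemma perm_of_pos [simp]: "0 < perm_of w k \<longleftrightarrow> 0 < k"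
  using inj_eq[OF inj_perm_of, of w k 0] by auto

lemma perm_of_map_add: "perm_of (map ((+) m) w) k = (if k \<le> m then k else m + perm_of w (k - m))"
  by (induction w arbitrary: k) (auto simp: transpose_def)

lemma block_sum_word:
  assumes "letters_below m v" "letters_below n w"
  shows "block_sum (m, perm_of v) (n, perm_of w) = (m + n, perm_of (v @ map ((+) m) w))"
proof (rule prod_eqI)
  have v: "(m, perm_of v) \<in> Arr finord" and w: "(n, perm_of w) \<in> Arr finord"
    using assms perm_of_permutes by (auto simp: finord_Arr)
  have "perm_of v (m + Suc k) = m + Suc k" for k
    using permutes_not_in[OF perm_of_permutes[OF assms(1)]] by auto
  then have "perm_of v (m + perm_of w (k - m)) = m + perm_of w (k - m)" if "\<not> k \<le> m" for k
    using that perm_of_pos[of w "k - m"] by (metis gr0_conv_Suc not_le zero_less_diff)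
  then show "snd (block_sum (m, perm_of v) (n, perm_of w)) = snd (m + n, perm_of (v @ map ((+) m) w))"
    using v w by (auto simp: fun_eq_iff snd_block_sum perm_of_append perm_of_map_add)
qed simp

lemma letters_below_mono: "letters_below m w \<Longrightarrow> m \<le> n \<Longrightarrow> letters_below n w"
  by (auto simp: letters_below_def)

lemma letters_below_map_add [simp]: "letters_below (m + n) (map ((+) m) w) \<longleftrightarrow> letters_below n w"
  by (auto simp: letters_below_def)

lemma block_swap_one: "block_swap (Suc 0) (Suc 0) = (Suc (Suc 0), perm_of [0])"
  by (auto simp: block_swap_def perm_arr_def fun_eq_iff transpose_def)

locale object_powers = symmetric_monoidal_category +
  fixes e
  assumes base_obj [simp]: "e \<in> Obj K"
begin

primrec pow :: "nat \<Rightarrow> 'a" where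
  "pow 0 = Unit M"
| "pow (Suc n) = e \<odot>\<^bsub>M\<^esub> pow n"

lemma pow_obj [simp]: "pow n \<in> Obj K"
  by (induction n) auto

text \<open>The exchange of the factors \<open>k\<close> and \<open>k + 1\<close> of \<open>pow n\<close>. The rank \<open>n\<close> is an
  argument because the arrow contains the identity of the remaining factors; the values matter only
  for \<open>k + 1 < n\<close>.\<close>

primrec gen :: "nat \<Rightarrow> nat \<Rightarrow> 'b" where
  "gen 0 = (\<lambda>n. braid e e (pow (n - 2)))"
| "gen (Suc k) = (\<lambda>n. Idn K e \<odot>\<^sub>a\<^bsub>M\<^esub> gen k (n - 1))"

primrec word_arr :: "nat \<Rightarrow> nat list \<Rightarrow> 'b" where
  "word_arr n [] = Idn K (pow n)"
| "word_arr n (k # w) = gen k n \<cdot> word_arr n w"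

primrec juxt :: "nat \<Rightarrow> nat \<Rightarrow> 'b" where
  "juxt 0 = (\<lambda>n. LUnit M (pow n))"
| "juxt (Suc m) = (\<lambda>n. (Idn K e \<odot>\<^sub>a\<^bsub>M\<^esub> juxt m n) \<cdot> Assoc M e (pow m) (pow n))"

definition free_arr :: "nat \<times> (nat \<Rightarrow> nat) \<Rightarrow> 'b" where
  "free_arr f = word_arr (fst f) (SOME w. letters_below (fst f) w \<and> perm_of w = snd f)"

lemma gen_hom: "Suc k < n \<Longrightarrow> gen k n \<in> Arr K \<and> Dom K (gen k n) = pow n \<and> Cod K (gen k n) = pow n"
proof (induction k arbitrary: n)
  case 0
  then obtain m where "n = Suc (Suc m)" by (auto dest: less_imp_Suc_add)
  then show ?case by simp
next
  case (Suc k)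
  then obtain m where "n = Suc m" "Suc k < m" by (cases n) auto
  then show ?case using Suc.IH[of m] by simp
qed

lemma gen_arr [simp]:
  "Suc k < n \<Longrightarrow> gen k n \<in> Arr K" "Suc k < n \<Longrightarrow> Dom K (gen k n) = pow n" 
  "Suc k < n \<Longrightarrow> Cod K (gen k n) = pow n"
  using gen_hom by auto

lemma word_arr_hom: "letters_below n w \<Longrightarrow> word_arr n w \<in> Arr K \<and> Dom K (word_arr n w) = pow n \<and> Cod K (word_arr n w) = pow n"
  by (induction w) auto

lemma word_arr_typing [simp]:
  "letters_below n w \<Longrightarrow> word_arr n w \<in> Arr K" "letters_below n w \<Longrightarrow> Dom K (word_arr n w) = pow n" 
  "letters_below n w \<Longrightarrow> Cod K (word_arr n w) = pow n"
  using word_arr_hom by auto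

lemma word_arr_append: "\<lbrakk>letters_below n v; letters_below n w\<rbrakk> \<Longrightarrow> word_arr n (v @ w) = word_arr n v \<cdot> word_arr n w"
  by (induction v) auto

lemma word_arr_map_Suc: "letters_below n w \<Longrightarrow> word_arr (Suc n) (map Suc w) = Idn K e \<odot>\<^sub>a\<^bsub>M\<^esub> word_arr n w"
  by (induction w) (auto simp: merge)

lemma gen_square: "Suc k < n \<Longrightarrow> gen k n \<cdot> gen k n = Idn K (pow n)"
proof (induction k arbitrary: n)
  case 0
  then obtain m where "n = Suc (Suc m)" by (auto dest: less_imp_Suc_add)
  then show ?case by (simp add: braid_braid)
next
  case (Suc k)
  then obtain m where "n = Suc m" "Suc k < m" by (cases n) auto
  then show ?case using Suc.IH[of m] by (simp add: merge)
qed

lemma gen_braid: "Suc (Suc k) < n 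
  \<Longrightarrow> gen k n \<cdot> gen (Suc k) n \<cdot> gen k n = gen (Suc k) n \<cdot> gen k n \<cdot> gen (Suc k) n"
proof (induction k arbitrary: n)
  case 0
  then obtain m where "n = Suc (Suc (Suc m))" by (auto dest: less_imp_Suc_add)
  then show ?case by (simp add: yang_baxter)
next
  case (Suc k)
  then obtain m where m: "n = Suc m" "Suc (Suc k) < m" by (cases n) auto
  then have "gen (Suc k) n = Idn K e \<odot>\<^sub>a\<^bsub>M\<^esub> gen k m"
    and "gen (Suc (Suc k)) n = Idn K e \<odot>\<^sub>a\<^bsub>M\<^esub> gen (Suc k) m"
    by simp_all
  with m show ?case using Suc.IH[of m] by (simp add: merge del: gen.simps)
qed

lemma gen_commute: "\<lbrakk>Suc k < l; Suc l < n\<rbrakk> \<Longrightarrow> gen k n \<cdot> gen l n = gen l n \<cdot> gen k n"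
proof (induction k arbitrary: l n)
  case 0
  then obtain j where l: "l = Suc (Suc j)" by (auto dest: less_imp_Suc_add)
  then obtain m where "n = Suc (Suc m)" "Suc j < m" using 0 by (cases n; cases "n - 1") auto
  then show ?case by (simp add: l nat_braid)
next
  case (Suc k)
  then obtain m j where "n = Suc m" "l = Suc j" "Suc k < j" "Suc j < m" by (cases n; cases l) auto
  then show ?case using Suc.IH[of j m] by (simp add: merge)
qed

lemma word_arr_coxeter: "coxeter u v \<Longrightarrow> letters_below n u \<Longrightarrow> word_arr n u = word_arr n v"
proof (induction rule: coxeter.induct)
  case (within u v x y)
  then show ?case using coxeter_letters_below[of u v n] by (simp add: word_arr_append)
next
  case (chain u v w)
  then show ?case using coxeter_letters_below by metis
next
  case (far k l)
  then show ?case using gen_commute[of k l n] gen_commute[of l k n] by auto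
next
  case (triple k)
  then show ?case using gen_braid[of k n] by (simp del: gen.simps)
qed (auto simp: gen_square)

text \<open>The choice of a word does not matter: the words involved are joined by Coxeter relations, which
  hold between the arrows that the words represent.\<close>

lemma free_arr_word:
  assumes "letters_below n w" shows "free_arr (n, perm_of w) = word_arr n w"
proof -
  let ?v = "SOME v. letters_below n v \<and> perm_of v = perm_of w"
  have v: "letters_below n ?v \<and> perm_of ?v = perm_of w"
    using someI[of "\<lambda>v. letters_below n v \<and> perm_of v = perm_of w" w] assms by simp
  then obtain u where "coxeter ?v u" "coxeter w u" using perm_of_faithful[of n ?v w] assms by auto
  then have "word_arr n ?v = word_arr n w" using word_arr_coxeter v assms by metis
  then show ?thesis by (simp add: free_arr_def)
qed

lemma finord_word:
  assumes "f \<in> Arr finord"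
  obtains w where "letters_below (fst f) w" "f = (fst f, perm_of w)"
  using assms permutation_word[of "snd f" "fst f"] by (metis finord_Arr prod.collapse)

lemma free_arr_arr [simp]:
  assumes "f \<in> Arr finord"
  shows "free_arr f \<in> Arr K" "Dom K (free_arr f) = pow (fst f)" "Cod K (free_arr f) = pow (fst f)"
  using finord_word[OF assms] free_arr_word by (metis word_arr_typing)+

lemma free_arr_id [simp]: "free_arr (n, id) = Idn K (pow n)"
  using free_arr_word[of n "[]"] by simp

lemma free_arr_cmp:
  assumes f: "f \<in> Arr finord" and g: "g \<in> Arr finord" and eq: "fst f = fst g"
  shows "free_arr (g \<cdot>\<^bsub>finord\<^esub> f) = free_arr g \<cdot> free_arr f"
proof -
  obtain v w where v: "letters_below (fst f) v" "f = (fst f, perm_of v)" 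
    and w: "letters_below (fst g) w" "g = (fst g, perm_of w)"
    using finord_word[OF f] finord_word[OF g] by metis
  have "snd g \<circ> snd f = perm_of (w @ v)" using v(2) w(2) by (metis perm_of_append snd_conv)
  then have "free_arr (g \<cdot>\<^bsub>finord\<^esub> f) = free_arr (fst f, perm_of (w @ v))"
    by (simp add: finord_cmp)
  also have "\<dots> = word_arr (fst f) w \<cdot> word_arr (fst f) v" using v w eq by (simp add: free_arr_word word_arr_append)
  also have "\<dots> = free_arr g \<cdot> free_arr f"
    using free_arr_word[OF v(1)] free_arr_word[OF w(1)] v(2) w(2) eq by simp
  finally show ?thesis .
qed

lemma juxt_hom: "juxt m n \<in> Arr K \<and> Dom K (juxt m n) = pow m \<odot>\<^bsub>M\<^esub> pow n \<and> Cod K (juxt m n) = pow (m + n)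
  \<and> is_iso K (juxt m n)"
  by (induction m) auto

lemma juxt_arr [simp]: "juxt m n \<in> Arr K" "Dom K (juxt m n) = pow m \<odot>\<^bsub>M\<^esub> pow n"
  "Cod K (juxt m n) = pow (m + n)" "is_iso K (juxt m n)"
  using juxt_hom by auto

lemma juxt_assoc: "juxt m (n + p) \<cdot> (Idn K (pow m) \<odot>\<^sub>a\<^bsub>M\<^esub> juxt n p) \<cdot> Assoc M (pow m) (pow n) (pow p)
  = juxt (m + n) p \<cdot> (juxt m n \<odot>\<^sub>a\<^bsub>M\<^esub> Idn K (pow p))"
proof (induction m)
  case 0
  have "juxt 0 (n + p) \<cdot> (Idn K (pow 0) \<odot>\<^sub>a\<^bsub>M\<^esub> juxt n p) \<cdot> Assoc M (pow 0) (pow n) (pow p)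
    = (LUnit M (pow (n + p)) \<cdot> (Idn K (Unit M) \<odot>\<^sub>a\<^bsub>M\<^esub> juxt n p)) \<cdot> Assoc M (pow 0) (pow n) (pow p)"
    by simp
  also have "\<dots> = juxt n p \<cdot> LUnit M (pow n \<odot>\<^bsub>M\<^esub> pow p) \<cdot> Assoc M (Unit M) (pow n) (pow p)"
    by (subst nat_lunit) auto
  finally show ?case by (simp add: lunit_tensor)
next
  case (Suc m)
  have "juxt (Suc m) (n + p) \<cdot> (Idn K (pow (Suc m)) \<odot>\<^sub>a\<^bsub>M\<^esub> juxt n p) \<cdot> Assoc M (pow (Suc m)) (pow n) (pow p)
    = (Idn K e \<odot>\<^sub>a\<^bsub>M\<^esub> juxt m (n + p)) \<cdot> (Assoc M e (pow m) (pow (n + p)) 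
        \<cdot> ((Idn K e \<odot>\<^sub>a\<^bsub>M\<^esub> Idn K (pow m)) \<odot>\<^sub>a\<^bsub>M\<^esub> juxt n p)) \<cdot> Assoc M (e \<odot>\<^bsub>M\<^esub> pow m) (pow n) (pow p)"
    by simp
  also have "\<dots> = (Idn K e \<odot>\<^sub>a\<^bsub>M\<^esub> juxt m (n + p)) \<cdot> (Idn K e \<odot>\<^sub>a\<^bsub>M\<^esub> (Idn K (pow m) \<odot>\<^sub>a\<^bsub>M\<^esub> juxt n p))
      \<cdot> (Assoc M e (pow m) (pow n \<odot>\<^bsub>M\<^esub> pow p) \<cdot> Assoc M (e \<odot>\<^bsub>M\<^esub> pow m) (pow n) (pow p))"
    by (subst nat_assoc) auto
  also have "\<dots> = (Idn K e \<odot>\<^sub>a\<^bsub>M\<^esub> (juxt m (n + p) \<cdot> (Idn K (pow m) \<odot>\<^sub>a\<^bsub>M\<^esub> juxt n p) \<cdot> Assoc M (pow m) (pow n) (pow p)))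
      \<cdot> Assoc M e (pow m \<odot>\<^bsub>M\<^esub> pow n) (pow p) \<cdot> (Assoc M e (pow m) (pow n) \<odot>\<^sub>a\<^bsub>M\<^esub> Idn K (pow p))"
    unfolding pentagon[symmetric, OF base_obj pow_obj pow_obj pow_obj] by (simp add: merge_chain)
  also have "\<dots> = (Idn K e \<odot>\<^sub>a\<^bsub>M\<^esub> juxt (m + n) p) \<cdot> ((Idn K e \<odot>\<^sub>a\<^bsub>M\<^esub> (juxt m n \<odot>\<^sub>a\<^bsub>M\<^esub> Idn K (pow p)))
      \<cdot> Assoc M e (pow m \<odot>\<^bsub>M\<^esub> pow n) (pow p)) \<cdot> (Assoc M e (pow m) (pow n) \<odot>\<^sub>a\<^bsub>M\<^esub> Idn K (pow p))"
    unfolding Suc.IH by (simp add: merge_chain)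
  also have "\<dots> = (Idn K e \<odot>\<^sub>a\<^bsub>M\<^esub> juxt (m + n) p) \<cdot> (Assoc M e (pow (m + n)) (pow p) \<cdot>
      ((Idn K e \<odot>\<^sub>a\<^bsub>M\<^esub> juxt m n) \<odot>\<^sub>a\<^bsub>M\<^esub> Idn K (pow p))) \<cdot> (Assoc M e (pow m) (pow n) \<odot>\<^sub>a\<^bsub>M\<^esub> Idn K (pow p))"
    by (subst nat_assoc) auto
  also have "\<dots> = juxt (Suc m + n) p \<cdot> (juxt (Suc m) n \<odot>\<^sub>a\<^bsub>M\<^esub> Idn K (pow p))"
    by (simp add: merge)
  finally show ?case .
qed

lemma juxt_zero: "juxt m 0 = RUnit M (pow m)"
  by (induction m) (auto simp: lunit_unit runit_tensor)

lemma gen_juxt: "Suc k < m \<Longrightarrow> gen k (m + n) \<cdot> juxt m n = juxt m n \<cdot> (gen k m \<odot>\<^sub>a\<^bsub>M\<^esub> Idn K (pow n))"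
proof (induction k arbitrary: m)
  case 0
  then obtain l where m: "m = Suc (Suc l)" by (auto dest: less_imp_Suc_add)
  have "gen 0 (m + n) \<cdot> juxt m n = (braid e e (pow (l + n)) \<cdot> (Idn K e \<odot>\<^sub>a\<^bsub>M\<^esub> (Idn K e \<odot>\<^sub>a\<^bsub>M\<^esub> juxt l n)))
     \<cdot> (Idn K e \<odot>\<^sub>a\<^bsub>M\<^esub> Assoc M e (pow l) (pow n)) \<cdot> Assoc M e (e \<odot>\<^bsub>M\<^esub> pow l) (pow n)"
    by (simp add: m merge_chain)
  also have "\<dots> = (Idn K e \<odot>\<^sub>a\<^bsub>M\<^esub> (Idn K e \<odot>\<^sub>a\<^bsub>M\<^esub> juxt l n)) \<cdot> (braid e e (pow l \<odot>\<^bsub>M\<^esub> pow n)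
     \<cdot> (Idn K e \<odot>\<^sub>a\<^bsub>M\<^esub> Assoc M e (pow l) (pow n)) \<cdot> Assoc M e (e \<odot>\<^bsub>M\<^esub> pow l) (pow n))"
    by (subst nat_braid) auto
  also have "\<dots> = juxt m n \<cdot> (gen 0 m \<odot>\<^sub>a\<^bsub>M\<^esub> Idn K (pow n))"
    by (subst braid_tensor) (auto simp: m merge_chain)
  finally show ?case .
next
  case (Suc k)
  then obtain l where m: "m = Suc l" and l: "Suc k < l" by (cases m) auto
  have "gen (Suc k) (m + n) \<cdot> juxt m n = (Idn K e \<odot>\<^sub>a\<^bsub>M\<^esub> (gen k (l + n) \<cdot> juxt l n)) \<cdot> Assoc M e (pow l) (pow n)"
    using l by (simp add: m merge_chain)
  also have "\<dots> = (Idn K e \<odot>\<^sub>a\<^bsub>M\<^esub> juxt l n) \<cdot> ((Idn K e \<odot>\<^sub>a\<^bsub>M\<^esub> (gen k l \<odot>\<^sub>a\<^bsub>M\<^esub> Idn K (pow n))) \<cdot> Assoc M e (pow l) (pow n))"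
    using l by (simp add: Suc.IH merge_chain)
  also have "\<dots> = (Idn K e \<odot>\<^sub>a\<^bsub>M\<^esub> juxt l n) \<cdot> Assoc M e (pow l) (pow n) \<cdot> ((Idn K e \<odot>\<^sub>a\<^bsub>M\<^esub> gen k l) \<odot>\<^sub>a\<^bsub>M\<^esub> Idn K (pow n))"
    using l by (subst nat_assoc) auto
  finally show ?case using l by (simp add: m)
qed

lemma word_arr_juxt_left: 
  "letters_below m w \<Longrightarrow> word_arr (m + n) w \<cdot> juxt m n = juxt m n \<cdot> (word_arr m w \<odot>\<^sub>a\<^bsub>M\<^esub> Idn K (pow n))"
proof (induction w)
  case (Cons k w)
  then have k: "Suc k < m" and w: "letters_below m w" by auto
  have w': "letters_below (m + n) w" using letters_below_mono[OF w] by simp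
  have "word_arr (m + n) (k # w) \<cdot> juxt m n = gen k (m + n) \<cdot> (word_arr (m + n) w \<cdot> juxt m n)"
    using k w' by simp
  also have "\<dots> = (gen k (m + n) \<cdot> juxt m n) \<cdot> (word_arr m w \<odot>\<^sub>a\<^bsub>M\<^esub> Idn K (pow n))"
    using k w Cons.IH by simp
  also have "\<dots> = juxt m n \<cdot> (word_arr m (k # w) \<odot>\<^sub>a\<^bsub>M\<^esub> Idn K (pow n))"
    using k w by (simp add: gen_juxt merge)
  finally show ?case .
qed simp

lemma word_arr_juxt_right: 
  "letters_below n w \<Longrightarrow> word_arr (m + n) (map ((+) m) w) \<cdot> juxt m n = juxt m n \<cdot> (Idn K (pow m) \<odot>\<^sub>a\<^bsub>M\<^esub> word_arr n w)"
proof (induction m)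
  case 0
  have "map ((+) 0) w = w" by (induction w) auto
  then show ?case using 0 by (simp add: nat_lunit)
next
  case (Suc m)
  have w: "map ((+) (Suc m)) w = map Suc (map ((+) m) w)" by simp
  have "word_arr (Suc m + n) (map ((+) (Suc m)) w) \<cdot> juxt (Suc m) n
    = (Idn K e \<odot>\<^sub>a\<^bsub>M\<^esub> (word_arr (m + n) (map ((+) m) w) \<cdot> juxt m n)) \<cdot> Assoc M e (pow m) (pow n)"
    unfolding w using Suc.prems by (simp add: word_arr_map_Suc merge_chain del: map_map)
  also have "\<dots> = (Idn K e \<odot>\<^sub>a\<^bsub>M\<^esub> juxt m n) \<cdot> ((Idn K e \<odot>\<^sub>a\<^bsub>M\<^esub> (Idn K (pow m) \<odot>\<^sub>a\<^bsub>M\<^esub> word_arr n w)) \<cdot> Assoc M e (pow m) (pow n))"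
    using Suc by (simp add: merge_chain)
  also have "\<dots> = (Idn K e \<odot>\<^sub>a\<^bsub>M\<^esub> juxt m n) \<cdot> (Assoc M e (pow m) (pow n) \<cdot> ((Idn K e \<odot>\<^sub>a\<^bsub>M\<^esub> Idn K (pow m)) \<odot>\<^sub>a\<^bsub>M\<^esub> word_arr n w))"
    using Suc.prems by (subst nat_assoc) auto
  also have "\<dots> = juxt (Suc m) n \<cdot> (Idn K (pow (Suc m)) \<odot>\<^sub>a\<^bsub>M\<^esub> word_arr n w)"
    using Suc.prems by simp
  finally show ?case .
qed

lemma free_arr_sum:
  assumes f: "f \<in> Arr finord" and g: "g \<in> Arr finord" and m: "fst f = m" and n: "fst g = n"
  shows "free_arr (block_sum f g) \<cdot> juxt m n = juxt m n \<cdot> (free_arr f \<odot>\<^sub>a\<^bsub>M\<^esub> free_arr g)"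
proof -
  obtain v w where v: "letters_below m v" "f = (m, perm_of v)" 
    and w: "letters_below n w" "g = (n, perm_of w)"
    using finord_word[OF f] finord_word[OF g] m n by metis
  have v': "letters_below (m + n) v" using letters_below_mono[OF v(1)] by simp
  have "free_arr (block_sum f g) \<cdot> juxt m n = word_arr (m + n) v \<cdot> (word_arr (m + n) (map ((+) m) w) \<cdot> juxt m n)"
    using v v' w by (simp add: block_sum_word free_arr_word word_arr_append)
  also have "\<dots> = (word_arr (m + n) v \<cdot> juxt m n) \<cdot> (Idn K (pow m) \<odot>\<^sub>a\<^bsub>M\<^esub> word_arr n w)"
    using v' w v by (simp add: word_arr_juxt_right)
  also have "\<dots> = juxt m n \<cdot> (word_arr m v \<odot>\<^sub>a\<^bsub>M\<^esub> word_arr n w)"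
    using v w by (simp add: word_arr_juxt_left merge)
  finally show ?thesis using v w by (simp add: free_arr_word)
qed

end

lemma block_swap_zero: "block_swap 0 n = (n, id)" "block_swap n 0 = (n, id)"
  by (auto intro!: finord_arr_eqI simp: snd_block_swap)

lemma block_swap_add: "block_swap m (n + p) =
    block_sum (n, id) (block_swap m p) \<cdot>\<^bsub>finord\<^esub> block_sum (block_swap m n) (p, id)"
  using finord_plus.hexagon[of m n p] by (simp add: ac_simps)

lemma block_swap_swap: "block_swap n m \<cdot>\<^bsub>finord\<^esub> block_swap m n = (m + n, id)"
  using finord_plus.sym_inv[of m n] by simp

context object_powers begin

text \<open>Compatibility of the rebracketings with the symmetries, as a property of \<open>m\<close> and \<open>n\<close>. It
  is symmetric because symmetries are involutions and additive in \<open>n\<close> by the hexagons of both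
  categories, so only \<open>n = 0\<close> and \<open>m = n = 1\<close> are left.\<close>

definition swap_natural :: "nat \<Rightarrow> nat \<Rightarrow> bool" where
  "swap_natural m n \<longleftrightarrow> free_arr (block_swap m n) \<cdot> juxt m n = juxt n m \<cdot> z (pow m) (pow n)"

lemma swap_natural_zero: "swap_natural m 0"
  by (simp add: swap_natural_def block_swap_zero juxt_zero sym_unit)

lemma swap_natural_sym: assumes "swap_natural m n" shows "swap_natural n m"
proof -
  have [simp]: "n + m = m + n" by simp
  have g: "juxt n m \<cdot> z (pow m) (pow n) = free_arr (block_swap m n) \<cdot> juxt m n"
    using assms by (simp add: swap_natural_def)
  have "free_arr (block_swap n m) \<cdot> juxt n m = free_arr (block_swap n m) \<cdot> (juxt n m \<cdot> z (pow m) (pow n)) \<cdot> z (pow n) (pow m)"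
    by simp
  also have "\<dots> = (free_arr (block_swap n m) \<cdot> free_arr (block_swap m n)) \<cdot> juxt m n \<cdot> z (pow n) (pow m)"
    unfolding g by simp
  also have "\<dots> = juxt m n \<cdot> z (pow n) (pow m)"
    by (simp add: free_arr_cmp[symmetric] block_swap_swap)
  finally show ?thesis by (simp add: swap_natural_def)
qed

lemma swap_natural_add: assumes "swap_natural m n" "swap_natural m p" shows "swap_natural m (n + p)"
  unfolding swap_natural_def
proof (rule iso_cancel_right)
  let ?P = "(Idn K (pow m) \<odot>\<^sub>a\<^bsub>M\<^esub> juxt n p) \<cdot> Assoc M (pow m) (pow n) (pow p)"
  let ?F1 = "free_arr (block_sum (n, id) (block_swap m p))"
  let ?F2 = "free_arr (block_sum (block_swap m n) (p, id))"
  have [simp]: "m + (n + p) = n + (m + p)" "m + n + p = n + (m + p)" "n + m + p = n + (m + p)" "p + m = m + p"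
    by simp_all
  have "(free_arr (block_swap m (n + p)) \<cdot> juxt m (n + p)) \<cdot> ?P =
    free_arr (block_swap m (n + p)) \<cdot> juxt (m + n) p \<cdot> (juxt m n \<odot>\<^sub>a\<^bsub>M\<^esub> Idn K (pow p))"
    using juxt_assoc[of m n p] by simp
  also have "\<dots> = ?F1 \<cdot> (?F2 \<cdot> juxt (m + n) p) \<cdot> (juxt m n \<odot>\<^sub>a\<^bsub>M\<^esub> Idn K (pow p))"
    by (simp add: block_swap_add free_arr_cmp)
  also have "\<dots> = ?F1 \<cdot> juxt (n + m) p \<cdot> ((free_arr (block_swap m n) \<cdot> juxt m n) \<odot>\<^sub>a\<^bsub>M\<^esub> Idn K (pow p))"
    by (subst free_arr_sum[of _ _ "m + n" p]) (auto simp: merge add.commute[of m n])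
  also have "\<dots> = ?F1 \<cdot> (juxt (n + m) p \<cdot> (juxt n m \<odot>\<^sub>a\<^bsub>M\<^esub> Idn K (pow p))) \<cdot> (z (pow m) (pow n) \<odot>\<^sub>a\<^bsub>M\<^esub> Idn K (pow p))"
    using assms(1) by (simp add: swap_natural_def merge)
  also have "\<dots> = (?F1 \<cdot> juxt n (m + p)) \<cdot> (Idn K (pow n) \<odot>\<^sub>a\<^bsub>M\<^esub> juxt m p) \<cdot> Assoc M (pow n) (pow m) (pow p) 
      \<cdot> (z (pow m) (pow n) \<odot>\<^sub>a\<^bsub>M\<^esub> Idn K (pow p))"
    by (subst juxt_assoc[symmetric]) auto
  also have "\<dots> = juxt n (p + m) \<cdot> (Idn K (pow n) \<odot>\<^sub>a\<^bsub>M\<^esub> (free_arr (block_swap m p) \<cdot> juxt m p)) \<cdot> Assoc M (pow n) (pow m) (pow p) 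
      \<cdot> (z (pow m) (pow n) \<odot>\<^sub>a\<^bsub>M\<^esub> Idn K (pow p))"
    by (subst free_arr_sum[of _ _ n "m + p"]) (auto simp: merge_chain)
  also have "\<dots> = juxt n (p + m) \<cdot> (Idn K (pow n) \<odot>\<^sub>a\<^bsub>M\<^esub> juxt p m) \<cdot> (Idn K (pow n) \<odot>\<^sub>a\<^bsub>M\<^esub> z (pow m) (pow p)) \<cdot> Assoc M (pow n) (pow m) (pow p) 
      \<cdot> (z (pow m) (pow n) \<odot>\<^sub>a\<^bsub>M\<^esub> Idn K (pow p))"
    using assms(2) by (simp add: swap_natural_def merge_chain)
  also have "\<dots> = (juxt n (p + m) \<cdot> (Idn K (pow n) \<odot>\<^sub>a\<^bsub>M\<^esub> juxt p m) \<cdot> Assoc M (pow n) (pow p) (pow m)) 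
      \<cdot> z (pow m) (pow n \<odot>\<^bsub>M\<^esub> pow p) \<cdot> Assoc M (pow m) (pow n) (pow p)"
    by (subst hexagon[symmetric]) auto
  also have "\<dots> = juxt (n + p) m \<cdot> ((juxt n p \<odot>\<^sub>a\<^bsub>M\<^esub> Idn K (pow m)) 
      \<cdot> z (pow m) (pow n \<odot>\<^bsub>M\<^esub> pow p)) \<cdot> Assoc M (pow m) (pow n) (pow p)"
    by (subst juxt_assoc) auto
  also have "\<dots> = juxt (n + p) m \<cdot> (z (pow m) (pow (n + p)) \<cdot> (Idn K (pow m) \<odot>\<^sub>a\<^bsub>M\<^esub> juxt n p)) \<cdot> Assoc M (pow m) (pow n) (pow p)"
    by (subst nat_sym) auto
  finally show "(free_arr (block_swap m (n + p)) \<cdot> juxt m (n + p)) \<cdot> ?P 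
    = (juxt (n + p) m \<cdot> z (pow m) (pow (n + p))) \<cdot> ?P"
    by simp
qed auto

text \<open>The right unit law turns the exchange of two factors of \<open>e \<odot> (e \<odot> I)\<close> into the symmetry of
  \<open>e \<odot> e\<close>.\<close>

lemma swap_natural_one: "swap_natural (Suc 0) (Suc 0)"
proof -
  let ?e = "Idn K e" and ?R = "RUnit M e"
  have j: "juxt (Suc 0) (Suc 0) = ?R \<odot>\<^sub>a\<^bsub>M\<^esub> Idn K (e \<odot>\<^bsub>M\<^esub> Unit M)"
    using triangle[of e "e \<odot>\<^bsub>M\<^esub> Unit M"] by simp
  have "(?e \<odot>\<^sub>a\<^bsub>M\<^esub> ?R) \<cdot> braid e e (Unit M) = RUnit M (e \<odot>\<^bsub>M\<^esub> e) \<cdot> (z e e \<odot>\<^sub>a\<^bsub>M\<^esub> Idn K (Unit M)) \<cdot> inv_arr K (Assoc M e e (Unit M))"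
    by (simp add: braid_def runit_tensor[symmetric])
  also have "\<dots> = z e e \<cdot> RUnit M (e \<odot>\<^bsub>M\<^esub> e) \<cdot> inv_arr K (Assoc M e e (Unit M))"
    by (simp add: in_chain[OF nat_runit])
  also have "\<dots> = z e e \<cdot> (?e \<odot>\<^sub>a\<^bsub>M\<^esub> ?R)" by (simp add: runit_tensor[symmetric])
  finally have b: "(?e \<odot>\<^sub>a\<^bsub>M\<^esub> ?R) \<cdot> braid e e (Unit M) = z e e \<cdot> (?e \<odot>\<^sub>a\<^bsub>M\<^esub> ?R)" .
  have "(?e \<odot>\<^sub>a\<^bsub>M\<^esub> ?R) \<cdot> braid e e (Unit M) \<cdot> (?R \<odot>\<^sub>a\<^bsub>M\<^esub> Idn K (e \<odot>\<^bsub>M\<^esub> Unit M))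
    = z e e \<cdot> (?R \<odot>\<^sub>a\<^bsub>M\<^esub> ?R)"
    by (simp add: in_chain[OF b] merge)
  also have "\<dots> = (?e \<odot>\<^sub>a\<^bsub>M\<^esub> ?R) \<cdot> (?R \<odot>\<^sub>a\<^bsub>M\<^esub> Idn K (e \<odot>\<^bsub>M\<^esub> Unit M)) \<cdot> z (e \<odot>\<^bsub>M\<^esub> Unit M) (e \<odot>\<^bsub>M\<^esub> Unit M)"
    by (simp add: nat_sym merge_chain)
  finally have "braid e e (Unit M) \<cdot> (?R \<odot>\<^sub>a\<^bsub>M\<^esub> Idn K (e \<odot>\<^bsub>M\<^esub> Unit M)) 
    = (?R \<odot>\<^sub>a\<^bsub>M\<^esub> Idn K (e \<odot>\<^bsub>M\<^esub> Unit M)) \<cdot> z (e \<odot>\<^bsub>M\<^esub> Unit M) (e \<odot>\<^bsub>M\<^esub> Unit M)"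
    by (rule iso_cancel_left) auto
  then show ?thesis unfolding swap_natural_def j block_swap_one
    by (subst free_arr_word) auto
qed

lemma swap_natural: "swap_natural m n"
proof -
  have one: "swap_natural (Suc 0) n" for n
    by (induction n) (use swap_natural_zero swap_natural_add[OF swap_natural_one] in auto)
  show ?thesis
    by (induction n) (use swap_natural_zero swap_natural_add[OF swap_natural_sym[OF one]] in auto)
qed

theorem free_symmetric_monoidal_functor:
  assumes "FObj F = pow" "FArr F = restrict free_arr (Arr finord)"
  shows "symmetric_monoidal_functor finord (Plus finord) (PlusSym finord) K M z F juxt (Idn K (Unit M))"
proof unfold_locales
qed (use assms swap_natural in \<open>auto simp: homset_iff free_arr_cmp free_arr_sum juxt_assoc juxt_zero swap_natural_def\<close>)

end

section \<open>The bimonoidal functor of sums of the multiplicative unit\<close>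
context symmetric_monoidal_category begin

definition mid where
  "mid W X Y Z = inv_arr K (Assoc M W Y (X \<odot>\<^bsub>M\<^esub> Z)) \<cdot> (Idn K W \<odot>\<^sub>a\<^bsub>M\<^esub> braid X Y Z) \<cdot> Assoc M W X (Y \<odot>\<^bsub>M\<^esub> Z)"

lemma mid_arr [simp]: 
  assumes "W \<in> Obj K" "X \<in> Obj K" "Y \<in> Obj K" "Z \<in> Obj K"
  shows "mid W X Y Z \<in> Arr K" "Dom K (mid W X Y Z) = (W \<odot>\<^bsub>M\<^esub> X) \<odot>\<^bsub>M\<^esub> (Y \<odot>\<^bsub>M\<^esub> Z)"
    "Cod K (mid W X Y Z) = (W \<odot>\<^bsub>M\<^esub> Y) \<odot>\<^bsub>M\<^esub> (X \<odot>\<^bsub>M\<^esub> Z)"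
  using assms by (simp_all add: mid_def)

lemma nat_mid:
  assumes [simp]: "f \<in> Arr K" "g \<in> Arr K" "h \<in> Arr K" "k \<in> Arr K" 
    "Cod K f = W" "Cod K g = X" "Cod K h = Y" "Cod K k = Z"
  shows "mid W X Y Z \<cdot> ((f \<odot>\<^sub>a\<^bsub>M\<^esub> g) \<odot>\<^sub>a\<^bsub>M\<^esub> (h \<odot>\<^sub>a\<^bsub>M\<^esub> k))
    = ((f \<odot>\<^sub>a\<^bsub>M\<^esub> h) \<odot>\<^sub>a\<^bsub>M\<^esub> (g \<odot>\<^sub>a\<^bsub>M\<^esub> k)) \<cdot> mid (Dom K f) (Dom K g) (Dom K h) (Dom K k)"
proof -
  have [simp]: "W \<in> Obj K" "X \<in> Obj K" "Y \<in> Obj K" "Z \<in> Obj K" using assms cod_obj by blast+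
  have "mid W X Y Z \<cdot> ((f \<odot>\<^sub>a\<^bsub>M\<^esub> g) \<odot>\<^sub>a\<^bsub>M\<^esub> (h \<odot>\<^sub>a\<^bsub>M\<^esub> k)) = inv_arr K (Assoc M W Y (X \<odot>\<^bsub>M\<^esub> Z))
     \<cdot> (f \<odot>\<^sub>a\<^bsub>M\<^esub> (braid X Y Z \<cdot> (g \<odot>\<^sub>a\<^bsub>M\<^esub> (h \<odot>\<^sub>a\<^bsub>M\<^esub> k)))) \<cdot> Assoc M (Dom K f) (Dom K g) (Dom K h \<odot>\<^bsub>M\<^esub> Dom K k)"
    by (simp add: mid_def nat_assoc merge_chain)
  also have "\<dots> = (inv_arr K (Assoc M W Y (X \<odot>\<^bsub>M\<^esub> Z)) \<cdot> (f \<odot>\<^sub>a\<^bsub>M\<^esub> (h \<odot>\<^sub>a\<^bsub>M\<^esub> (g \<odot>\<^sub>a\<^bsub>M\<^esub> k)))) 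
      \<cdot> (Idn K (Dom K f) \<odot>\<^sub>a\<^bsub>M\<^esub> braid (Dom K g) (Dom K h) (Dom K k)) \<cdot> Assoc M (Dom K f) (Dom K g) (Dom K h \<odot>\<^bsub>M\<^esub> Dom K k)"
    by (simp add: nat_braid merge_chain)
  also have "\<dots> = ((f \<odot>\<^sub>a\<^bsub>M\<^esub> h) \<odot>\<^sub>a\<^bsub>M\<^esub> (g \<odot>\<^sub>a\<^bsub>M\<^esub> k)) \<cdot> mid (Dom K f) (Dom K g) (Dom K h) (Dom K k)"
    using nat_assoc_inv[of f h "g \<odot>\<^sub>a\<^bsub>M\<^esub> k"] by (simp add: mid_def)
  finally show ?thesis .
qed

end

context object_powers begin

lemma juxt_braid:
  "free_arr (block_sum (block_swap b c) (d, id)) \<cdot> juxt b (c + d) \<cdot> (Idn K (pow b) \<odot>\<^sub>a\<^bsub>M\<^esub> juxt c d)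
    = juxt c (b + d) \<cdot> (Idn K (pow c) \<odot>\<^sub>a\<^bsub>M\<^esub> juxt b d) \<cdot> braid (pow b) (pow c) (pow d)" (is "?l = ?r")
proof (rule iso_cancel_right)
  let ?A = "Assoc M (pow b) (pow c) (pow d)"
  have [simp]: "b + (c + d) = c + (b + d)" "b + c + d = c + (b + d)" "c + b + d = c + (b + d)" by simp_all
  have "?l \<cdot> ?A = (free_arr (block_sum (block_swap b c) (d, id)) \<cdot> juxt (b + c) d) \<cdot> (juxt b c \<odot>\<^sub>a\<^bsub>M\<^esub> Idn K (pow d))"
    using juxt_assoc[of b c d] by simp
  also have "\<dots> = juxt (c + b) d \<cdot> ((free_arr (block_swap b c) \<cdot> juxt b c) \<odot>\<^sub>a\<^bsub>M\<^esub> Idn K (pow d))"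
    by (subst free_arr_sum[of _ _ "b + c" d]) (auto simp: merge add.commute[of b c])
  also have "\<dots> = (juxt (c + b) d \<cdot> (juxt c b \<odot>\<^sub>a\<^bsub>M\<^esub> Idn K (pow d))) \<cdot> (z (pow b) (pow c) \<odot>\<^sub>a\<^bsub>M\<^esub> Idn K (pow d))"
    using swap_natural[of b c] by (simp add: swap_natural_def merge)
  also have "\<dots> = ?r \<cdot> ?A"
    by (subst juxt_assoc[symmetric]) (simp add: braid_def)
  finally show "?l \<cdot> ?A = ?r \<cdot> ?A" .
qed (auto simp: ac_simps)

text \<open>The exchange of the two middle summands, needed where the two distributivities meet.\<close>

lemma juxt_mid:
  "free_arr (block_sum (a, id) (block_sum (block_swap b c) (d, id)))
      \<cdot> juxt (a + b) (c + d) \<cdot> (juxt a b \<odot>\<^sub>a\<^bsub>M\<^esub> juxt c d)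
    = juxt (a + c) (b + d) \<cdot> (juxt a c \<odot>\<^sub>a\<^bsub>M\<^esub> juxt b d) \<cdot> mid (pow a) (pow b) (pow c) (pow d)"
proof -
  let ?I = "Idn K (pow a)" and ?G = "block_sum (block_swap b c) (d, id)"
  let ?A = "Assoc M (pow a) (pow b) (pow c \<odot>\<^bsub>M\<^esub> pow d)"
  have [simp]: "b + (c + d) = c + (b + d)" "b + c + d = c + (b + d)" by simp_all
  have split: "juxt (a + m) (k + l) \<cdot> (juxt a m \<odot>\<^sub>a\<^bsub>M\<^esub> juxt k l) = juxt a (m + (k + l)) 
      \<cdot> (?I \<odot>\<^sub>a\<^bsub>M\<^esub> (juxt m (k + l) \<cdot> (Idn K (pow m) \<odot>\<^sub>a\<^bsub>M\<^esub> juxt k l))) \<cdot> Assoc M (pow a) (pow m) (pow k \<odot>\<^bsub>M\<^esub> pow l)"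
    for m k l
  proof -
    have "juxt (a + m) (k + l) \<cdot> (juxt a m \<odot>\<^sub>a\<^bsub>M\<^esub> juxt k l)
      = (juxt (a + m) (k + l) \<cdot> (juxt a m \<odot>\<^sub>a\<^bsub>M\<^esub> Idn K (pow (k + l)))) \<cdot> ((?I \<odot>\<^sub>a\<^bsub>M\<^esub> Idn K (pow m)) \<odot>\<^sub>a\<^bsub>M\<^esub> juxt k l)"
      by (simp add: merge)
    also have "\<dots> = juxt a (m + (k + l)) \<cdot> (?I \<odot>\<^sub>a\<^bsub>M\<^esub> juxt m (k + l)) \<cdot> (Assoc M (pow a) (pow m) (pow (k + l))
       \<cdot> ((?I \<odot>\<^sub>a\<^bsub>M\<^esub> Idn K (pow m)) \<odot>\<^sub>a\<^bsub>M\<^esub> juxt k l))"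
      by (subst juxt_assoc[symmetric]) simp
    also have "\<dots> = juxt a (m + (k + l)) \<cdot> (?I \<odot>\<^sub>a\<^bsub>M\<^esub> juxt m (k + l)) \<cdot> ((?I \<odot>\<^sub>a\<^bsub>M\<^esub> (Idn K (pow m) \<odot>\<^sub>a\<^bsub>M\<^esub> juxt k l))
       \<cdot> Assoc M (pow a) (pow m) (pow k \<odot>\<^bsub>M\<^esub> pow l))"
      by (subst nat_assoc) auto
    finally show ?thesis by (simp add: merge_chain)
  qed
  have "free_arr (block_sum (a, id) ?G) \<cdot> juxt (a + b) (c + d) \<cdot> (juxt a b \<odot>\<^sub>a\<^bsub>M\<^esub> juxt c d)
    = (free_arr (block_sum (a, id) ?G) \<cdot> juxt a (c + (b + d)))
      \<cdot> (?I \<odot>\<^sub>a\<^bsub>M\<^esub> (juxt b (c + d) \<cdot> (Idn K (pow b) \<odot>\<^sub>a\<^bsub>M\<^esub> juxt c d))) \<cdot> ?A"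
    by (simp add: split)
  also have "\<dots> = juxt a (c + (b + d))
      \<cdot> (?I \<odot>\<^sub>a\<^bsub>M\<^esub> (free_arr ?G \<cdot> juxt b (c + d) \<cdot> (Idn K (pow b) \<odot>\<^sub>a\<^bsub>M\<^esub> juxt c d))) \<cdot> ?A"
    by (subst free_arr_sum[of _ _ a "c + (b + d)"]) (auto simp: merge_chain)
  also have "\<dots> = (juxt a (c + (b + d)) \<cdot> (?I \<odot>\<^sub>a\<^bsub>M\<^esub> (juxt c (b + d) \<cdot> (Idn K (pow c) \<odot>\<^sub>a\<^bsub>M\<^esub> juxt b d)))
     \<cdot> Assoc M (pow a) (pow c) (pow b \<odot>\<^bsub>M\<^esub> pow d)) \<cdot> mid (pow a) (pow b) (pow c) (pow d)"
    unfolding juxt_braid by (simp add: mid_def merge_chain)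
  also have "\<dots> = (juxt (a + c) (b + d) \<cdot> (juxt a c \<odot>\<^sub>a\<^bsub>M\<^esub> juxt b d)) \<cdot> mid (pow a) (pow b) (pow c) (pow d)"
    unfolding split by simp
  finally show ?thesis by simp
qed

end

context bimonoidal_category begin

lemma null_arr [simp]:
  "A \<in> Obj K \<Longrightarrow> \<lambda>\<^sup>\<bullet> A \<in> Arr K" "A \<in> Obj K \<Longrightarrow> Dom K (\<lambda>\<^sup>\<bullet> A) = \<zero> \<otimes> A" "A \<in> Obj K \<Longrightarrow> Cod K (\<lambda>\<^sup>\<bullet> A) = \<zero>"
  "A \<in> Obj K \<Longrightarrow> \<rho>\<^sup>\<bullet> A \<in> Arr K" "A \<in> Obj K \<Longrightarrow> Dom K (\<rho>\<^sup>\<bullet> A) = A \<otimes> \<zero>" "A \<in> Obj K \<Longrightarrow> Cod K (\<rho>\<^sup>\<bullet> A) = \<zero>"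
  using lnull_hom[of A] rnull_hom[of A] by (auto simp: homset_iff)

lemmas [simp] = lnull_iso rnull_iso

lemma dist_arr [simp]:
  assumes "A \<in> Obj K" "B \<in> Obj K" "C \<in> Obj K"
  shows "\<delta>\<^sup>l A B C \<in> Arr K" "Dom K (\<delta>\<^sup>l A B C) = A \<otimes> (B \<oplus> C)" "Cod K (\<delta>\<^sup>l A B C) = A \<otimes> B \<oplus> A \<otimes> C"
    "\<delta>\<^sup>r A B C \<in> Arr K" "Dom K (\<delta>\<^sup>r A B C) = (A \<oplus> B) \<otimes> C" "Cod K (\<delta>\<^sup>r A B C) = A \<otimes> C \<oplus> B \<otimes> C"
  using ldist_hom[of A B C] rdist_hom[of A B C] assms by (auto simp: homset_iff)

lemma nat_lnull: "\<lbrakk>f \<in> Arr K; Cod K f = A\<rbrakk> \<Longrightarrow> \<lambda>\<^sup>\<bullet> A \<cdot> (\<iota> \<zero> \<otimes>\<^sub>a f) = \<lambda>\<^sup>\<bullet> (Dom K f)"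
  using lnull_nat[of f "Dom K f" A] by (auto simp: homset_iff)

lemma nat_ldist: "\<lbrakk>f \<in> Arr K; g \<in> Arr K; h \<in> Arr K; Cod K f = A; Cod K g = B; Cod K h = C\<rbrakk>
  \<Longrightarrow> \<delta>\<^sup>l A B C \<cdot> (f \<otimes>\<^sub>a (g \<oplus>\<^sub>a h)) = ((f \<otimes>\<^sub>a g) \<oplus>\<^sub>a (f \<otimes>\<^sub>a h)) \<cdot> \<delta>\<^sup>l (Dom K f) (Dom K g) (Dom K h)"
  using ldist_nat[of f "Dom K f" A g "Dom K g" B h "Dom K h" C] by (auto simp: homset_iff)

lemma nat_rdist: "\<lbrakk>f \<in> Arr K; g \<in> Arr K; h \<in> Arr K; Cod K f = A; Cod K g = B; Cod K h = C\<rbrakk>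
  \<Longrightarrow> \<delta>\<^sup>r A B C \<cdot> ((f \<oplus>\<^sub>a g) \<otimes>\<^sub>a h) = ((f \<otimes>\<^sub>a h) \<oplus>\<^sub>a (g \<otimes>\<^sub>a h)) \<cdot> \<delta>\<^sup>r (Dom K f) (Dom K g) (Dom K h)"
  using rdist_nat[of f "Dom K f" A g "Dom K g" B h "Dom K h" C] by (auto simp: homset_iff)

lemma mid_swap_eq: "\<lbrakk>X \<in> Obj K; Y \<in> Obj K; Z \<in> Obj K\<rbrakk> \<Longrightarrow> mid_swap W X Y Z = plus.mid W X Y Z"
  by (simp add: mid_swap_def plus.mid_def plus.braid_def)

end

text \<open>The powers of the multiplicative unit with respect to the sum.\<close>

locale numerals = symmetric_bimonoidal_category

sublocale numerals \<subseteq> object_powers K "Plus K" "PlusSym K" "Unit (Times K)"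
  by unfold_locales auto

context numerals begin

text \<open>The recursion that right distributivity forces on the product with \<open>1 \<oplus> pow m\<close>.\<close>

primrec mul :: "nat \<Rightarrow> nat \<Rightarrow> 'b" where
  "mul 0 = (\<lambda>n. \<lambda>\<^sup>\<bullet> (pow n))"
| "mul (Suc m) = (\<lambda>n. juxt n (m * n) \<cdot> (\<lambda>\<^sup>\<otimes> (pow n) \<oplus>\<^sub>a mul m n) \<cdot> \<delta>\<^sup>r \<one> (pow m) (pow n))"

lemma mul_hom: "mul m n \<in> Arr K \<and> Dom K (mul m n) = pow m \<otimes> pow n \<and> Cod K (mul m n) = pow (m * n)"
  by (induction m) auto

lemma mul_arr [simp]: "mul m n \<in> Arr K" "Dom K (mul m n) = pow m \<otimes> pow n" "Cod K (mul m n) = pow (m * n)"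
  using mul_hom by auto

text \<open>Induction on \<open>m\<close>; the step is the compatibility of the right distributivity with the
  associativity of sums.\<close>

lemma mul_rdist: "mul (m + l) n \<cdot> (juxt m l \<otimes>\<^sub>a \<iota> (pow n)) =
  juxt (m * n) (l * n) \<cdot> (mul m n \<oplus>\<^sub>a mul l n) \<cdot> \<delta>\<^sup>r (pow m) (pow l) (pow n)"
proof (induction m)
  case 0
  have "juxt (0 * n) (l * n) \<cdot> (mul 0 n \<oplus>\<^sub>a mul l n) \<cdot> \<delta>\<^sup>r (pow 0) (pow l) (pow n)
    = (\<lambda>\<^sup>\<oplus> (pow (l * n)) \<cdot> (\<iota> \<zero> \<oplus>\<^sub>a mul l n)) \<cdot> (\<lambda>\<^sup>\<bullet> (pow n) \<oplus>\<^sub>a \<iota> (pow l \<otimes> pow n)) \<cdot> \<delta>\<^sup>r \<zero> (pow l) (pow n)"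
    by (simp add: plus.merge_chain)
  also have "\<dots> = mul l n \<cdot> (\<lambda>\<^sup>\<oplus> (pow l \<otimes> pow n) \<cdot> (\<lambda>\<^sup>\<bullet> (pow n) \<oplus>\<^sub>a \<iota> (pow l \<otimes> pow n)) \<cdot> \<delta>\<^sup>r \<zero> (pow l) (pow n))"
    by (subst plus.nat_lunit) auto
  also have "\<dots> = mul l n \<cdot> (\<lambda>\<^sup>\<oplus> (pow l) \<otimes>\<^sub>a \<iota> (pow n))"
    by (subst rdist_zero_left) auto
  finally show ?case by simp
next
  case (Suc m)
  let ?N = "\<iota> (pow n)" and ?a = "\<alpha>\<^sup>\<oplus> \<one> (pow m) (pow l) \<otimes>\<^sub>a \<iota> (pow n)" and ?L = "\<lambda>\<^sup>\<otimes> (pow n)"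
  have "mul (Suc m + l) n \<cdot> (juxt (Suc m) l \<otimes>\<^sub>a ?N) = juxt n ((m + l) * n) \<cdot> (?L \<oplus>\<^sub>a mul (m + l) n)
    \<cdot> (\<delta>\<^sup>r \<one> (pow (m + l)) (pow n) \<cdot> ((\<iota> \<one> \<oplus>\<^sub>a juxt m l) \<otimes>\<^sub>a ?N)) \<cdot> ?a"
    by (simp add: times.merge)
  also have "\<dots> = juxt n ((m + l) * n) \<cdot> (?L \<oplus>\<^sub>a (mul (m + l) n \<cdot> (juxt m l \<otimes>\<^sub>a ?N)))
     \<cdot> \<delta>\<^sup>r \<one> (pow m \<oplus> pow l) (pow n) \<cdot> ?a"
    by (subst nat_rdist) (auto simp: plus.merge_chain)
  also have "\<dots> = juxt n (m * n + l * n) \<cdot> (\<iota> (pow n) \<oplus>\<^sub>a juxt (m * n) (l * n)) \<cdot> (?L \<oplus>\<^sub>a (mul m n \<oplus>\<^sub>a mul l n))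
      \<cdot> ((\<iota> (\<one> \<otimes> pow n) \<oplus>\<^sub>a \<delta>\<^sup>r (pow m) (pow l) (pow n)) \<cdot> \<delta>\<^sup>r \<one> (pow m \<oplus> pow l) (pow n) \<cdot> ?a)"
    unfolding Suc.IH by (simp add: plus.merge_chain add_mult_distrib)
  also have "\<dots> = juxt n (m * n + l * n) \<cdot> (\<iota> (pow n) \<oplus>\<^sub>a juxt (m * n) (l * n)) 
      \<cdot> ((?L \<oplus>\<^sub>a (mul m n \<oplus>\<^sub>a mul l n)) \<cdot> \<alpha>\<^sup>\<oplus> (\<one> \<otimes> pow n) (pow m \<otimes> pow n) (pow l \<otimes> pow n))
      \<cdot> (\<delta>\<^sup>r \<one> (pow m) (pow n) \<oplus>\<^sub>a \<iota> (pow l \<otimes> pow n)) \<cdot> \<delta>\<^sup>r (\<one> \<oplus> pow m) (pow l) (pow n)"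
    by (subst rdist_plus_assoc[symmetric]) auto
  also have "\<dots> = juxt n (m * n + l * n) \<cdot> (\<iota> (pow n) \<oplus>\<^sub>a juxt (m * n) (l * n)) 
      \<cdot> (\<alpha>\<^sup>\<oplus> (pow n) (pow (m * n)) (pow (l * n)) \<cdot> ((?L \<oplus>\<^sub>a mul m n) \<oplus>\<^sub>a mul l n))
      \<cdot> (\<delta>\<^sup>r \<one> (pow m) (pow n) \<oplus>\<^sub>a \<iota> (pow l \<otimes> pow n)) \<cdot> \<delta>\<^sup>r (\<one> \<oplus> pow m) (pow l) (pow n)"
    by (subst plus.nat_assoc) auto
  also have "\<dots> = (juxt n (m * n + l * n) \<cdot> (\<iota> (pow n) \<oplus>\<^sub>a juxt (m * n) (l * n)) 
      \<cdot> \<alpha>\<^sup>\<oplus> (pow n) (pow (m * n)) (pow (l * n))) \<cdot> ((?L \<oplus>\<^sub>a mul m n) \<oplus>\<^sub>a mul l n)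
      \<cdot> (\<delta>\<^sup>r \<one> (pow m) (pow n) \<oplus>\<^sub>a \<iota> (pow l \<otimes> pow n)) \<cdot> \<delta>\<^sup>r (\<one> \<oplus> pow m) (pow l) (pow n)"
    by simp
  also have "\<dots> = juxt (Suc m * n) (l * n) \<cdot> (mul (Suc m) n \<oplus>\<^sub>a mul l n) \<cdot> \<delta>\<^sup>r (pow (Suc m)) (pow l) (pow n)"
    unfolding juxt_assoc by (simp add: plus.merge_chain)
  finally show ?case .
qed

end

text \<open>Every permutation is a product of adjacent transpositions, and each of these is the transposition
  of \<open>1 + 1\<close> summed with identities on both sides.\<close>

lemma finord_induct [consumes 1, case_names id cmp sum swap]:
  assumes "f \<in> Arr finord"
    and id: "\<And>n. P (n, id)"
    and cmp: "\<And>f g. \<lbrakk>f \<in> Arr finord; g \<in> Arr finord; fst f = fst g; P f; P g\<rbrakk> \<Longrightarrow> P (g \<cdot>\<^bsub>finord\<^esub> f)"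
    and sum: "\<And>f g. \<lbrakk>f \<in> Arr finord; g \<in> Arr finord; P f; P g\<rbrakk> \<Longrightarrow> P (block_sum f g)"
    and swap: "P (block_swap (Suc 0) (Suc 0))"
  shows "P f"
proof -
  obtain w where "letters_below (fst f) w" "f = (fst f, perm_of w)"
    using permutation_word[of "snd f" "fst f"] assms(1) by (metis finord_Arr prod.collapse)
  moreover have "letters_below n w \<Longrightarrow> P (n, perm_of w)" for n w
  proof (induction w)
    case Nil
    then show ?case using id[of n] by (simp add: id_def)
  next
    case (Cons k w)
    then have k: "Suc k < n" and w: "letters_below n w" by auto
    then obtain j where n: "n = k + (2 + j)" by (auto dest: less_imp_Suc_add)
    have "block_sum (block_swap (Suc 0) (Suc 0)) (j, id) = (2 + j, perm_of [0])"
      using block_sum_word[of 2 "[0]" j "[]"] by (simp add: block_swap_one numeral_2_eq_2)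
    then have "block_sum (k, id) (block_sum (block_swap (Suc 0) (Suc 0)) (j, id)) = (n, perm_of [k])"
      using block_sum_word[of k "[]" "2 + j" "[0]"] by (simp add: n)
    moreover have "P (block_sum (k, id) (block_sum (block_swap (Suc 0) (Suc 0)) (j, id)))"
      by (intro sum swap id) simp_all
    ultimately have "P (n, perm_of [k])" by metis
    moreover have "(n, perm_of [k]) \<in> Arr finord"
      using perm_of_permutes[of n "[k]"] k by (simp add: finord_Arr)
    moreover have "(n, perm_of (k # w)) = (n, perm_of [k]) \<cdot>\<^bsub>finord\<^esub> (n, perm_of w)"
      by (simp add: finord_cmp)
    moreover have "(n, perm_of w) \<in> Arr finord"
      using perm_of_permutes[OF w] by (simp add: finord_Arr)
    ultimately show ?case
      using cmp[of "(n, perm_of w)" "(n, perm_of [k])"] Cons.IH[OF w] by (metis fst_conv)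
  qed
  ultimately show ?thesis by metis
qed

interpretation finord_sbi: symmetric_bimonoidal_category finord
  using flat_symmetric_bimonoidal_finord by (rule flat_symmetric_bimonoidal_category.axioms)

text \<open>The axiom that relates the two distributivities, read in \<open>finord\<close> at \<open>1 + m\<close>. It drives the
  induction in \<open>mul_ldist\<close>.\<close>

lemma left_distr_Suc: "left_distr (Suc m) n p =
  block_sum (n, id) (block_sum (block_swap p (m * n)) (m * p, id)) \<cdot>\<^bsub>finord\<^esub> block_sum (n + p, id) (left_distr m n p)"
  using finord_bi.dist_dist[of "Suc 0" m n p]
  by (simp add: left_distr_one finord_mid_swap distrib_left ac_simps)

lemma pair_swap_one_left: "pair_swap (Suc 0) n = (n, id)"
  using pair_swap_swap[of "Suc 0" n] by (simp add: pair_swap_one)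

lemma pair_swap_Suc: 
  "left_distr n (Suc 0) m \<cdot>\<^bsub>finord\<^esub> pair_swap (Suc m) n = block_sum (n, id) (pair_swap m n)"
  using finord_sbi.dist_times_sym[of "Suc 0" m n] by (simp add: pair_swap_one_left mult.commute)

lemma perm_prod_sum:
  assumes "f \<in> Arr finord" "g \<in> Arr finord"
  shows "perm_prod (block_sum f g) (n, id) = block_sum (perm_prod f (n, id)) (perm_prod g (n, id))"
  using finord_bi.nat_rdist[of f g "(n, id)" "fst f" "fst g" n] assms by (simp add: distrib_right)

lemma perm_prod_block_swap: "perm_prod (block_swap m l) (n, id) = block_swap (m * n) (l * n)"
  using finord_bi.rdist_sym[of m l n] by (simp add: distrib_right add.commute)

context object_powers begin

lemma free_arr_iso [simp]:
  assumes f: "f \<in> Arr finord" shows "is_iso K (free_arr f)"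
proof -
  have "is_iso finord f" using f by (rule finord_is_iso)
  then obtain g where g: "g \<in> Arr finord" "fst g = fst f" "g \<cdot>\<^bsub>finord\<^esub> f = (fst f, id)" "f \<cdot>\<^bsub>finord\<^esub> g = (fst f, id)"
    by (metis finord.inv_arr_arr finord.dom_inv finord.inv_left finord.inv_right finord_simps(2-4))
  then show ?thesis using f free_arr_cmp[of f g] free_arr_cmp[of g f]
    by (intro isoI[of _ "free_arr g"]) auto
qed

lemma juxt_one: "juxt (Suc 0) n = RUnit M e \<odot>\<^sub>a\<^bsub>M\<^esub> Idn K (pow n)"
  using triangle[of e "pow n"] by simp

end

context numerals begin

text \<open>Expanding the left factor \<open>1 \<oplus> pow m\<close> by the right distributivity, in \<open>C\<close> as well as in
  \<open>finord\<close>, reduces the step to the axiom that relates the two distributivities.\<close>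

lemma mul_ldist: "free_arr (left_distr m n p) \<cdot> mul m (n + p) \<cdot> (\<iota> (pow m) \<otimes>\<^sub>a juxt n p)
  = juxt (m * n) (m * p) \<cdot> (mul m n \<oplus>\<^sub>a mul m p) \<cdot> \<delta>\<^sup>l (pow m) (pow n) (pow p)"
proof (induction m)
  case 0
  show ?case using lnull_plus[of "pow n" "pow p"] by (simp add: left_distr_zero nat_lnull)
next
  case (Suc m)
  let ?L = "\<lambda>\<^sup>\<otimes> (pow n) \<oplus>\<^sub>a \<lambda>\<^sup>\<otimes> (pow p)" and ?D = "\<delta>\<^sup>r \<one> (pow m) (pow n \<oplus> pow p)"
    and ?M = "free_arr (block_sum (n, id) (block_sum (block_swap p (m * n)) (m * p, id)))"
    and ?F = "free_arr (block_sum (n + p, id) (left_distr m n p))"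
    and ?d = "\<delta>\<^sup>l \<one> (pow n) (pow p)" and ?d' = "\<delta>\<^sup>l (pow m) (pow n) (pow p)"
  have [simp]: "m * (n + p) = m * n + m * p" by (simp add: distrib_left)
  have F: "free_arr (left_distr (Suc m) n p) = ?M \<cdot> ?F"
    unfolding left_distr_Suc by (subst free_arr_cmp) auto
  have [simp]: "?M \<in> Arr K" "?F \<in> Arr K" "Dom K ?M = pow (n + p + (m * n + m * p))"
    "Cod K ?F = pow (n + p + (m * n + m * p))" "Dom K ?F = pow (n + p + (m * n + m * p))"
    by (simp_all add: ac_simps)
  have "free_arr (left_distr (Suc m) n p) \<cdot> mul (Suc m) (n + p) \<cdot> (\<iota> (pow (Suc m)) \<otimes>\<^sub>a juxt n p)
    = ?M \<cdot> ?F \<cdot> juxt (n + p) (m * n + m * p) \<cdot> (\<lambda>\<^sup>\<otimes> (pow (n + p)) \<oplus>\<^sub>a mul m (n + p)) \<cdot> 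
      (\<delta>\<^sup>r \<one> (pow m) (pow (n + p)) \<cdot> ((\<iota> \<one> \<oplus>\<^sub>a \<iota> (pow m)) \<otimes>\<^sub>a juxt n p))"
    by (simp add: F)
  also have "\<dots> = ?M \<cdot> ?F \<cdot> juxt (n + p) (m * n + m * p) \<cdot> ((\<lambda>\<^sup>\<otimes> (pow (n + p)) \<cdot> (\<iota> \<one> \<otimes>\<^sub>a juxt n p))
      \<oplus>\<^sub>a (mul m (n + p) \<cdot> (\<iota> (pow m) \<otimes>\<^sub>a juxt n p))) \<cdot> ?D"
    by (subst nat_rdist) (auto simp: plus.merge_chain)
  also have "\<dots> = ?M \<cdot> (?F \<cdot> juxt (n + p) (m * n + m * p)) \<cdot> ((juxt n p \<cdot> \<lambda>\<^sup>\<otimes> (pow n \<oplus> pow p))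
      \<oplus>\<^sub>a (mul m (n + p) \<cdot> (\<iota> (pow m) \<otimes>\<^sub>a juxt n p))) \<cdot> ?D"
    by (subst times.nat_lunit) auto
  also have "\<dots> = ?M \<cdot> juxt (n + p) (m * n + m * p) \<cdot> ((juxt n p \<cdot> \<lambda>\<^sup>\<otimes> (pow n \<oplus> pow p))
      \<oplus>\<^sub>a (free_arr (left_distr m n p) \<cdot> mul m (n + p) \<cdot> (\<iota> (pow m) \<otimes>\<^sub>a juxt n p))) \<cdot> ?D"
    by (subst free_arr_sum[of _ _ "n + p" "m * n + m * p"]) (auto simp: plus.merge_chain)
  also have "\<dots> = ?M \<cdot> juxt (n + p) (m * n + m * p) \<cdot> ((juxt n p \<cdot> ?L \<cdot> ?d)
      \<oplus>\<^sub>a (juxt (m * n) (m * p) \<cdot> (mul m n \<oplus>\<^sub>a mul m p) \<cdot> ?d')) \<cdot> ?D"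
    unfolding Suc.IH by (simp add: ldist_one)
  also have "\<dots> = (?M \<cdot> juxt (n + p) (m * n + m * p) \<cdot> (juxt n p \<oplus>\<^sub>a juxt (m * n) (m * p))) \<cdot>
      (?L \<oplus>\<^sub>a (mul m n \<oplus>\<^sub>a mul m p)) \<cdot> (?d \<oplus>\<^sub>a ?d') \<cdot> ?D"
    by (simp add: plus.merge_chain)
  also have "\<dots> = juxt (n + m * n) (p + m * p) \<cdot> (juxt n (m * n) \<oplus>\<^sub>a juxt p (m * p)) 
      \<cdot> (plus.mid (pow n) (pow p) (pow (m * n)) (pow (m * p)) \<cdot> (?L \<oplus>\<^sub>a (mul m n \<oplus>\<^sub>a mul m p))) \<cdot> (?d \<oplus>\<^sub>a ?d') \<cdot> ?D"
    unfolding juxt_mid by simp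
  also have "\<dots> = juxt (n + m * n) (p + m * p) \<cdot> (juxt n (m * n) \<oplus>\<^sub>a juxt p (m * p)) 
      \<cdot> ((\<lambda>\<^sup>\<otimes> (pow n) \<oplus>\<^sub>a mul m n) \<oplus>\<^sub>a (\<lambda>\<^sup>\<otimes> (pow p) \<oplus>\<^sub>a mul m p)) 
      \<cdot> (plus.mid (\<one> \<otimes> pow n) (\<one> \<otimes> pow p) (pow m \<otimes> pow n) (pow m \<otimes> pow p) \<cdot> (?d \<oplus>\<^sub>a ?d') \<cdot> ?D)"
    by (subst plus.nat_mid) auto
  also have "\<dots> = juxt (n + m * n) (p + m * p) \<cdot> (juxt n (m * n) \<oplus>\<^sub>a juxt p (m * p)) 
      \<cdot> ((\<lambda>\<^sup>\<otimes> (pow n) \<oplus>\<^sub>a mul m n) \<oplus>\<^sub>a (\<lambda>\<^sup>\<otimes> (pow p) \<oplus>\<^sub>a mul m p)) 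
      \<cdot> ((\<delta>\<^sup>r \<one> (pow m) (pow n) \<oplus>\<^sub>a \<delta>\<^sup>r \<one> (pow m) (pow p)) \<cdot> \<delta>\<^sup>l (\<one> \<oplus> pow m) (pow n) (pow p))"
    using dist_dist[of \<one> "pow m" "pow n" "pow p"] by (simp add: mid_swap_eq)
  also have "\<dots> = juxt (Suc m * n) (Suc m * p) \<cdot> (mul (Suc m) n \<oplus>\<^sub>a mul (Suc m) p) \<cdot> \<delta>\<^sup>l (pow (Suc m)) (pow n) (pow p)"
    by (simp add: plus.merge_chain)
  finally show ?case .
qed

abbreviation unit_arr where "unit_arr \<equiv> inv_arr K (\<rho>\<^sup>\<oplus> \<one>)"

lemma mul_one_left: "mul (Suc 0) n \<cdot> (unit_arr \<otimes>\<^sub>a \<iota> (pow n)) = \<lambda>\<^sup>\<otimes> (pow n)"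
proof -
  have "mul (Suc 0) n = \<rho>\<^sup>\<oplus> (pow n) \<cdot> (\<lambda>\<^sup>\<otimes> (pow n) \<oplus>\<^sub>a \<iota> \<zero>) \<cdot> (\<iota> (\<one> \<otimes> pow n) \<oplus>\<^sub>a \<lambda>\<^sup>\<bullet> (pow n)) \<cdot> \<delta>\<^sup>r \<one> \<zero> (pow n)"
    by (simp add: juxt_zero plus.merge_chain)
  also have "\<dots> = (\<rho>\<^sup>\<oplus> (pow n) \<cdot> (\<lambda>\<^sup>\<otimes> (pow n) \<oplus>\<^sub>a \<iota> \<zero>)) \<cdot> (\<iota> (\<one> \<otimes> pow n) \<oplus>\<^sub>a \<lambda>\<^sup>\<bullet> (pow n)) \<cdot> \<delta>\<^sup>r \<one> \<zero> (pow n)"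
    by simp
  also have "\<dots> = \<lambda>\<^sup>\<otimes> (pow n) \<cdot> (\<rho>\<^sup>\<oplus> \<one> \<otimes>\<^sub>a \<iota> (pow n))"
    by (subst plus.nat_runit) (auto simp: rdist_zero_right)
  finally show ?thesis by (simp add: times.merge)
qed

lemma mul_one_right: "mul m (Suc 0) \<cdot> (\<iota> (pow m) \<otimes>\<^sub>a unit_arr) = \<rho>\<^sup>\<otimes> (pow m)"
proof (induction m)
  case 0
  then show ?case by (simp add: nat_lnull lnull_one)
next
  case (Suc m)
  have "mul (Suc m) (Suc 0) \<cdot> (\<iota> (pow (Suc m)) \<otimes>\<^sub>a unit_arr)
    = juxt (Suc 0) m \<cdot> (\<lambda>\<^sup>\<otimes> (pow (Suc 0)) \<oplus>\<^sub>a mul m (Suc 0)) \<cdot> (\<delta>\<^sup>r \<one> (pow m) (pow (Suc 0)) \<cdot> ((\<iota> \<one> \<oplus>\<^sub>a \<iota> (pow m)) \<otimes>\<^sub>a unit_arr))"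
    by (simp del: juxt.simps)
  also have "\<dots> = juxt (Suc 0) m \<cdot> ((\<lambda>\<^sup>\<otimes> (\<one> \<oplus> \<zero>) \<cdot> (\<iota> \<one> \<otimes>\<^sub>a unit_arr)) \<oplus>\<^sub>a (mul m (Suc 0) \<cdot> (\<iota> (pow m) \<otimes>\<^sub>a unit_arr))) \<cdot> \<delta>\<^sup>r \<one> (pow m) \<one>"
    by (subst nat_rdist) (auto simp: plus.merge_chain)
  also have "\<dots> = (\<rho>\<^sup>\<oplus> \<one> \<oplus>\<^sub>a \<iota> (pow m)) \<cdot> ((unit_arr \<cdot> \<rho>\<^sup>\<otimes> \<one>) \<oplus>\<^sub>a \<rho>\<^sup>\<otimes> (pow m)) \<cdot> \<delta>\<^sup>r \<one> (pow m) \<one>"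
    unfolding Suc.IH juxt_one by (simp add: times.nat_lunit times.lunit_unit)
  also have "\<dots> = \<rho>\<^sup>\<otimes> (pow (Suc m))"
    by (simp add: plus.merge_chain rdist_one)
  finally show ?case .
qed

lemma mul_zero_right: "mul n 0 = \<rho>\<^sup>\<bullet> (pow n)"
proof (induction n)
  case 0
  show ?case using null_zero by simp
next
  case (Suc n)
  then show ?case using rnull_plus[of \<one> "pow n"] by (simp add: rnull_one)
qed

lemma null_times_sym': "A \<in> Obj K \<Longrightarrow> \<rho>\<^sup>\<bullet> A \<cdot> TimesSym K \<zero> A = \<lambda>\<^sup>\<bullet> A"
  by (simp flip: null_times_sym)

text \<open>The step is the compatibility of the right distributivity with the associativity of products.\<close>

lemma mul_assoc: "mul m (n * p) \<cdot> (\<iota> (pow m) \<otimes>\<^sub>a mul n p) \<cdot> \<alpha>\<^sup>\<otimes> (pow m) (pow n) (pow p)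
  = mul (m * n) p \<cdot> (mul m n \<otimes>\<^sub>a \<iota> (pow p))"
proof (induction m)
  case 0
  show ?case using lnull_times[of "pow n" "pow p"] plus.in_chain[OF nat_lnull[of "mul n p" "pow (n * p)"], of "\<alpha>\<^sup>\<otimes> \<zero> (pow n) (pow p)"]
    by simp
next
  case (Suc m)
  let ?a = "\<alpha>\<^sup>\<otimes> (\<one> \<oplus> pow m) (pow n) (pow p)" and ?D = "\<delta>\<^sup>r (\<one> \<otimes> pow n) (pow m \<otimes> pow n) (pow p)"
    and ?d = "\<delta>\<^sup>r \<one> (pow m) (pow n) \<otimes>\<^sub>a \<iota> (pow p)"
  have [simp]: "m * n * p = m * (n * p)" by simp
  have "mul (Suc m) (n * p) \<cdot> (\<iota> (pow (Suc m)) \<otimes>\<^sub>a mul n p) \<cdot> \<alpha>\<^sup>\<otimes> (pow (Suc m)) (pow n) (pow p)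
    = juxt (n * p) (m * (n * p)) \<cdot> (\<lambda>\<^sup>\<otimes> (pow (n * p)) \<oplus>\<^sub>a mul m (n * p)) \<cdot> 
      (\<delta>\<^sup>r \<one> (pow m) (pow (n * p)) \<cdot> ((\<iota> \<one> \<oplus>\<^sub>a \<iota> (pow m)) \<otimes>\<^sub>a mul n p)) \<cdot> ?a"
    by simp
  also have "\<dots> = juxt (n * p) (m * (n * p)) \<cdot> ((\<lambda>\<^sup>\<otimes> (pow (n * p)) \<cdot> (\<iota> \<one> \<otimes>\<^sub>a mul n p)) \<oplus>\<^sub>a (mul m (n * p) \<cdot> (\<iota> (pow m) \<otimes>\<^sub>a mul n p))) \<cdot> 
      (\<delta>\<^sup>r \<one> (pow m) (pow n \<otimes> pow p) \<cdot> ?a)"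
    by (subst nat_rdist) (auto simp: plus.merge_chain)
  also have "\<dots> = juxt (n * p) (m * (n * p)) \<cdot> ((mul n p \<cdot> \<lambda>\<^sup>\<otimes> (pow n \<otimes> pow p)) \<oplus>\<^sub>a (mul m (n * p) \<cdot> (\<iota> (pow m) \<otimes>\<^sub>a mul n p))) \<cdot> 
      (\<alpha>\<^sup>\<otimes> \<one> (pow n) (pow p) \<oplus>\<^sub>a \<alpha>\<^sup>\<otimes> (pow m) (pow n) (pow p)) \<cdot> ?D \<cdot> ?d"
    by (subst rdist_times_assoc) (auto simp: times.nat_lunit)
  also have "\<dots> = juxt (n * p) (m * (n * p)) \<cdot> ((mul n p \<cdot> \<lambda>\<^sup>\<otimes> (pow n \<otimes> pow p) \<cdot> \<alpha>\<^sup>\<otimes> \<one> (pow n) (pow p)) 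
      \<oplus>\<^sub>a (mul m (n * p) \<cdot> (\<iota> (pow m) \<otimes>\<^sub>a mul n p) \<cdot> \<alpha>\<^sup>\<otimes> (pow m) (pow n) (pow p))) \<cdot> ?D \<cdot> ?d"
    by (simp add: plus.merge_chain)
  also have "\<dots> = juxt (n * p) (m * n * p) \<cdot> ((mul n p \<oplus>\<^sub>a mul (m * n) p)
      \<cdot> ((\<lambda>\<^sup>\<otimes> (pow n) \<otimes>\<^sub>a \<iota> (pow p)) \<oplus>\<^sub>a (mul m n \<otimes>\<^sub>a \<iota> (pow p)))) \<cdot> ?D \<cdot> ?d"
    unfolding Suc.IH times.lunit_tensor[OF pow_obj pow_obj] by (simp add: plus.merge)
  also have "\<dots> = juxt (n * p) (m * n * p) \<cdot> (mul n p \<oplus>\<^sub>a mul (m * n) p)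
      \<cdot> (\<delta>\<^sup>r (pow n) (pow (m * n)) (pow p) \<cdot> ((\<lambda>\<^sup>\<otimes> (pow n) \<oplus>\<^sub>a mul m n) \<otimes>\<^sub>a \<iota> (pow p))) \<cdot> ?d"
    by (subst nat_rdist) auto
  also have "\<dots> = (juxt (n * p) (m * n * p) \<cdot> (mul n p \<oplus>\<^sub>a mul (m * n) p) \<cdot> \<delta>\<^sup>r (pow n) (pow (m * n)) (pow p))
      \<cdot> ((\<lambda>\<^sup>\<otimes> (pow n) \<oplus>\<^sub>a mul m n) \<otimes>\<^sub>a \<iota> (pow p)) \<cdot> ?d"
    by simp
  also have "\<dots> = mul (Suc m * n) p \<cdot> (mul (Suc m) n \<otimes>\<^sub>a \<iota> (pow p))"
    by (subst mul_rdist[symmetric]) (simp add: times.merge_chain times.merge distrib_right)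
  finally show ?case .
qed

text \<open>The left distributivity turns the recursion on the left factor into one on the right factor.\<close>

lemma mul_Suc_right: "free_arr (left_distr n (Suc 0) m) \<cdot> mul n (Suc m)
  = juxt n (n * m) \<cdot> (\<rho>\<^sup>\<otimes> (pow n) \<oplus>\<^sub>a mul n m) \<cdot> \<delta>\<^sup>l (pow n) \<one> (pow m)"
proof -
  let ?u = "\<iota> (pow n) \<otimes>\<^sub>a (unit_arr \<oplus>\<^sub>a \<iota> (pow m))" and ?F = "free_arr (left_distr n (Suc 0) m)"
  have "?F \<cdot> mul n (Suc m) = (?F \<cdot> mul n (Suc 0 + m) \<cdot> (\<iota> (pow n) \<otimes>\<^sub>a juxt (Suc 0) m)) \<cdot> ?u"
    by (simp add: juxt_one times.merge plus.merge del: juxt.simps)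
  also have "\<dots> = juxt (n * Suc 0) (n * m) \<cdot> (mul n (Suc 0) \<oplus>\<^sub>a mul n m) \<cdot> \<delta>\<^sup>l (pow n) (pow (Suc 0)) (pow m) \<cdot> ?u"
    unfolding mul_ldist by simp
  also have "\<dots> = juxt n (n * m) \<cdot> ((mul n (Suc 0) \<cdot> (\<iota> (pow n) \<otimes>\<^sub>a unit_arr)) \<oplus>\<^sub>a mul n m) \<cdot> \<delta>\<^sup>l (pow n) \<one> (pow m)"
    by (subst nat_ldist) (auto simp: plus.merge_chain)
  finally show ?thesis by (simp add: mul_one_right)
qed

text \<open>The symmetry carries the right distributivity to the left one, hence the recursion of \<open>mul m n\<close>
  on \<open>m\<close> to the recursion of \<open>mul n m\<close> on \<open>m\<close>.\<close>

lemma mul_sym: "free_arr (pair_swap m n) \<cdot> mul m n = mul n m \<cdot> TimesSym K (pow m) (pow n)"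
proof (induction m)
  case 0
  have "pair_swap 0 n = (0, id)" by (rule finord_zero) auto
  then show ?case by (simp add: mul_zero_right null_times_sym')
next
  case (Suc m)
  let ?F = "free_arr (left_distr n (Suc 0) m)" and ?z = "TimesSym K"
  have [simp]: "n * m = m * n" by simp
  show ?case
  proof (rule plus.iso_cancel_left)
    have "?F \<cdot> free_arr (pair_swap (Suc m) n) \<cdot> mul (Suc m) n
      = (free_arr (block_sum (n, id) (pair_swap m n)) \<cdot> juxt n (m * n)) \<cdot> (\<lambda>\<^sup>\<otimes> (pow n) \<oplus>\<^sub>a mul m n) \<cdot> \<delta>\<^sup>r \<one> (pow m) (pow n)"
      by (simp add: pair_swap_Suc[symmetric] free_arr_cmp)
    also have "\<dots> = juxt n (m * n) \<cdot> (\<lambda>\<^sup>\<otimes> (pow n) \<oplus>\<^sub>a (free_arr (pair_swap m n) \<cdot> mul m n)) \<cdot> \<delta>\<^sup>r \<one> (pow m) (pow n)"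
      by (subst free_arr_sum[of _ _ n "m * n"]) (auto simp: plus.merge_chain)
    also have "\<dots> = juxt n (m * n) \<cdot> (\<rho>\<^sup>\<otimes> (pow n) \<oplus>\<^sub>a mul n m) \<cdot> 
      ((?z \<one> (pow n) \<oplus>\<^sub>a ?z (pow m) (pow n)) \<cdot> \<delta>\<^sup>r \<one> (pow m) (pow n))"
      unfolding Suc.IH by (simp add: plus.merge_chain times.sym_unit_right)
    also have "\<dots> = (juxt n (n * m) \<cdot> (\<rho>\<^sup>\<otimes> (pow n) \<oplus>\<^sub>a mul n m) \<cdot> \<delta>\<^sup>l (pow n) \<one> (pow m)) \<cdot> ?z (\<one> \<oplus> pow m) (pow n)"
      by (subst dist_times_sym[symmetric]) auto
    also have "\<dots> = ?F \<cdot> mul n (Suc m) \<cdot> ?z (pow (Suc m)) (pow n)"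
      unfolding mul_Suc_right[symmetric] by simp
    finally show "?F \<cdot> free_arr (pair_swap (Suc m) n) \<cdot> mul (Suc m) n = ?F \<cdot> mul n (Suc m) \<cdot> ?z (pow (Suc m)) (pow n)" .
  qed (auto simp: ac_simps)
qed

text \<open>On sums of permutations this is the naturality of the right distributivity, and on the
  transposition it is the compatibility of the right distributivity with the symmetry of the sum.\<close>

lemma mul_nat_left:
  assumes "f \<in> Arr finord"
  shows "free_arr (perm_prod f (n, id)) \<cdot> mul (fst f) n = mul (fst f) n \<cdot> (free_arr f \<otimes>\<^sub>a \<iota> (pow n))"
proof -
  \<comment> \<open>As a constant, the identity is not unfolded pointwise by the induction.\<close>
  define J where "J = (n, id :: nat \<Rightarrow> nat)"
  have [simp]: "J \<in> Arr finord" "fst J = n" and JJ: "J \<cdot>\<^bsub>finord\<^esub> J = J" by (simp_all add: J_def)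
  have "free_arr (perm_prod f J) \<cdot> mul (fst f) n = mul (fst f) n \<cdot> (free_arr f \<otimes>\<^sub>a \<iota> (pow n))"
  using assms proof (induction rule: finord_induct)
  case (id m)
  have "perm_prod (m, id) J = (m * n, id)" unfolding J_def by simp
  then show ?case by simp
next
  case (cmp f g)
  have "perm_prod (g \<cdot>\<^bsub>finord\<^esub> f) J = perm_prod g J \<cdot>\<^bsub>finord\<^esub> perm_prod f J"
    using cmp finord_times.merge[of f g J J] by (simp add: JJ)
  then have "free_arr (perm_prod (g \<cdot>\<^bsub>finord\<^esub> f) J) \<cdot> mul (fst f) n 
    = free_arr (perm_prod g J) \<cdot> free_arr (perm_prod f J) \<cdot> mul (fst f) n"
    using cmp by (simp add: free_arr_cmp)
  also have "\<dots> = (free_arr (perm_prod g J) \<cdot> mul (fst g) n) \<cdot> (free_arr f \<otimes>\<^sub>a \<iota> (pow n))"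
    using cmp(1-4) by simp
  also have "\<dots> = (mul (fst g) n \<cdot> (free_arr g \<otimes>\<^sub>a \<iota> (pow n))) \<cdot> (free_arr f \<otimes>\<^sub>a \<iota> (pow n))"
    by (simp only: cmp)
  also have "\<dots> = mul (fst f) n \<cdot> (free_arr (g \<cdot>\<^bsub>finord\<^esub> f) \<otimes>\<^sub>a \<iota> (pow n))"
    using cmp by (simp add: free_arr_cmp times.merge)
  finally show ?case by simp
next
  case (sum f g)
  let ?m = "fst f" and ?l = "fst g" and ?N = "\<iota> (pow n)" and ?D = "\<delta>\<^sup>r (pow (fst f)) (pow (fst g)) (pow n)"
  let ?F = "free_arr (perm_prod f J)" and ?G = "free_arr (perm_prod g J)"
  let ?H = "free_arr (block_sum (perm_prod f J) (perm_prod g J))"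
  have [simp]: "(?m + ?l) * n = ?m * n + ?l * n" by (simp add: distrib_right)
  have [simp]: "f \<in> Arr finord" "g \<in> Arr finord" using sum by auto
  have "free_arr (perm_prod (block_sum f g) J) \<cdot> mul (?m + ?l) n = mul (?m + ?l) n \<cdot> (free_arr (block_sum f g) \<otimes>\<^sub>a ?N)" (is "?lhs = ?rhs")
  proof (rule plus.iso_cancel_right)
    have "(?H \<cdot> mul (?m + ?l) n) \<cdot> (juxt ?m ?l \<otimes>\<^sub>a ?N)
      = (?H \<cdot> juxt (?m * n) (?l * n)) \<cdot> (mul ?m n \<oplus>\<^sub>a mul ?l n) \<cdot> ?D"
      using mul_rdist[of ?m ?l n] by simp
    also have "\<dots> = juxt (?m * n) (?l * n) \<cdot> ((?F \<cdot> mul ?m n) \<oplus>\<^sub>a (?G \<cdot> mul ?l n)) \<cdot> ?D"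
      by (subst free_arr_sum[of _ _ "?m * n" "?l * n"]) (auto simp: plus.merge_chain)
    also have "\<dots> = juxt (?m * n) (?l * n) \<cdot> (mul ?m n \<oplus>\<^sub>a mul ?l n) \<cdot> (((free_arr f \<otimes>\<^sub>a ?N) \<oplus>\<^sub>a (free_arr g \<otimes>\<^sub>a ?N)) \<cdot> ?D)"
      using sum by (simp add: plus.merge_chain)
    also have "\<dots> = (juxt (?m * n) (?l * n) \<cdot> (mul ?m n \<oplus>\<^sub>a mul ?l n) \<cdot> ?D) \<cdot> ((free_arr f \<oplus>\<^sub>a free_arr g) \<otimes>\<^sub>a ?N)"
      using nat_rdist[of "free_arr f" "free_arr g" ?N "pow ?m" "pow ?l" "pow n"] by simp
    also have "\<dots> = mul (?m + ?l) n \<cdot> ((juxt ?m ?l \<cdot> (free_arr f \<oplus>\<^sub>a free_arr g)) \<otimes>\<^sub>a ?N)"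
      unfolding mul_rdist[symmetric] by (simp add: times.merge)
    also have "\<dots> = (mul (?m + ?l) n \<cdot> (free_arr (block_sum f g) \<otimes>\<^sub>a ?N)) \<cdot> (juxt ?m ?l \<otimes>\<^sub>a ?N)"
      by (subst free_arr_sum[symmetric]) (auto simp: times.merge)
    finally show "?lhs \<cdot> (juxt ?m ?l \<otimes>\<^sub>a ?N) = ?rhs \<cdot> (juxt ?m ?l \<otimes>\<^sub>a ?N)"
      by (simp add: perm_prod_sum J_def)
  qed auto
  then show ?case by simp
next
  case swap
  define m l where "m = Suc 0" and "l = Suc 0"
  let ?N = "\<iota> (pow n)" and ?D = "\<delta>\<^sup>r (pow m) (pow l) (pow n)"
  have [simp]: "(m + l) * n = m * n + l * n" "l * n + m * n = m * n + l * n" "l + m = m + l" by (simp_all add: distrib_right)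
  have "free_arr (perm_prod (block_swap m l) J) \<cdot> mul (m + l) n = mul (m + l) n \<cdot> (free_arr (block_swap m l) \<otimes>\<^sub>a ?N)" (is "?lhs = ?rhs")
  proof (rule plus.iso_cancel_right)
    have "(free_arr (block_swap (m * n) (l * n)) \<cdot> mul (m + l) n) \<cdot> (juxt m l \<otimes>\<^sub>a ?N)
      = (free_arr (block_swap (m * n) (l * n)) \<cdot> juxt (m * n) (l * n)) \<cdot> (mul m n \<oplus>\<^sub>a mul l n) \<cdot> ?D"
      using mul_rdist[of m l n] by simp
    also have "\<dots> = juxt (l * n) (m * n) \<cdot> (\<zeta>\<^sup>\<oplus> (pow (m * n)) (pow (l * n)) \<cdot> (mul m n \<oplus>\<^sub>a mul l n)) \<cdot> ?D"
      using swap_natural[of "m * n" "l * n"] by (simp add: swap_natural_def)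
    also have "\<dots> = juxt (l * n) (m * n) \<cdot> (mul l n \<oplus>\<^sub>a mul m n) \<cdot> (\<zeta>\<^sup>\<oplus> (pow m \<otimes> pow n) (pow l \<otimes> pow n) \<cdot> ?D)"
      by (subst plus.nat_sym) auto
    also have "\<dots> = (juxt (l * n) (m * n) \<cdot> (mul l n \<oplus>\<^sub>a mul m n) \<cdot> \<delta>\<^sup>r (pow l) (pow m) (pow n)) \<cdot> (\<zeta>\<^sup>\<oplus> (pow m) (pow l) \<otimes>\<^sub>a ?N)"
      by (subst rdist_sym[symmetric]) auto
    also have "\<dots> = mul (m + l) n \<cdot> ((juxt l m \<cdot> \<zeta>\<^sup>\<oplus> (pow m) (pow l)) \<otimes>\<^sub>a ?N)"
      unfolding mul_rdist[symmetric] by (simp add: times.merge)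
    also have "\<dots> = (mul (m + l) n \<cdot> (free_arr (block_swap m l) \<otimes>\<^sub>a ?N)) \<cdot> (juxt m l \<otimes>\<^sub>a ?N)"
      using swap_natural[of m l] by (simp add: swap_natural_def times.merge)
    finally show "?lhs \<cdot> (juxt m l \<otimes>\<^sub>a ?N) = ?rhs \<cdot> (juxt m l \<otimes>\<^sub>a ?N)"
      by (simp add: perm_prod_block_swap J_def)
  qed auto
  then show ?case by (simp add: m_def l_def del: mul.simps)
qed
  then show ?thesis unfolding J_def .
qed

text \<open>A permutation of the right factor is moved to the left factor by the symmetry of the product.\<close>

lemma mul_nat:
  assumes f: "f \<in> Arr finord" "fst f = m" and g: "g \<in> Arr finord" "fst g = n"
  shows "free_arr (perm_prod f g) \<cdot> mul m n = mul m n \<cdot> (free_arr f \<otimes>\<^sub>a free_arr g)"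
proof -
  have [simp]: "n * m = m * n" by simp
  have "perm_prod f g = perm_prod f (n, id) \<cdot>\<^bsub>finord\<^esub> perm_prod (m, id) g"
    using f g finord_times.merge[of "(m, id)" f g "(n, id)"] by simp
  moreover have "perm_prod (m, id) g = pair_swap n m \<cdot>\<^bsub>finord\<^esub> perm_prod g (m, id) \<cdot>\<^bsub>finord\<^esub> pair_swap m n"
  proof -
    have "perm_prod (m, id) g = (pair_swap n m \<cdot>\<^bsub>finord\<^esub> pair_swap m n) \<cdot>\<^bsub>finord\<^esub> perm_prod (m, id) g"
      using g by (simp add: pair_swap_swap)
    then show ?thesis using g finord_times.nat_sym[of "(m, id)" g m n] by simp
  qed
  ultimately have "free_arr (perm_prod f g) \<cdot> mul m n = free_arr (perm_prod f (n, id)) \<cdot> free_arr (pair_swap n m) 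
      \<cdot> free_arr (perm_prod g (m, id)) \<cdot> free_arr (pair_swap m n) \<cdot> mul m n"
    using f g by (simp add: free_arr_cmp)
  also have "\<dots> = free_arr (perm_prod f (n, id)) \<cdot> free_arr (pair_swap n m) 
      \<cdot> (free_arr (perm_prod g (m, id)) \<cdot> mul n m) \<cdot> TimesSym K (pow m) (pow n)"
    using f g by (simp add: mul_sym)
  also have "\<dots> = free_arr (perm_prod f (n, id)) \<cdot> (free_arr (pair_swap n m) \<cdot> mul n m) 
      \<cdot> ((free_arr g \<otimes>\<^sub>a \<iota> (pow m)) \<cdot> TimesSym K (pow m) (pow n))"
    using f g mul_nat_left[of g m] by simp
  also have "\<dots> = free_arr (perm_prod f (n, id)) \<cdot> (mul m n \<cdot> TimesSym K (pow n) (pow m)) 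
      \<cdot> (TimesSym K (pow m) (pow n) \<cdot> (\<iota> (pow m) \<otimes>\<^sub>a free_arr g))"
    unfolding mul_sym using g by (simp add: times.nat_sym)
  also have "\<dots> = (free_arr (perm_prod f (n, id)) \<cdot> mul m n) \<cdot> (\<iota> (pow m) \<otimes>\<^sub>a free_arr g)"
    using f g by (simp add: plus.in_chain[OF times.sym_inv])
  also have "\<dots> = mul m n \<cdot> (free_arr f \<otimes>\<^sub>a free_arr g)"
    using f g mul_nat_left[of f n] by (simp add: times.merge)
  finally show ?thesis .
qed

definition numeral_functor where
  "numeral_functor = \<lparr>FObj = pow, FArr = restrict free_arr (Arr finord), F2Plus = juxt, F0Plus = \<iota> \<zero>,
     F2Times = mul, F0Times = unit_arr\<rparr>"

lemma numeral_functor_robust: "robust_symmetric_bimonoidal_functor finord K numeral_functor"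
proof -
  interpret plus': symmetric_monoidal_functor finord "Plus finord" "PlusSym finord" K "Plus K" "PlusSym K"
    numeral_functor "F2Plus numeral_functor" "F0Plus numeral_functor"
    using free_symmetric_monoidal_functor[of numeral_functor] by (simp add: numeral_functor_def)
  show ?thesis
  proof unfold_locales
  qed (auto simp: numeral_functor_def homset_iff mul_nat mul_assoc mul_one_left mul_one_right mul_sym mul_ldist 
      simp del: mul.simps(2))
qed

end

section \<open>The unique transformation between robust functors\<close>
locale finord_functor = robust_symmetric_bimonoidal_functor finord K F
  for K :: "('o, 'a, 'm) symmetric_bimonoidal_scheme" (structure) and F
begin

abbreviation I where "I n \<equiv> Idn K (FObj F n)"

lemma F_obj [simp]: "FObj F n \<in> Obj K"
  using plus.fobj[of n] by simp

lemma F_arr [simp]: "f \<in> Arr finord \<Longrightarrow> FArr F f \<in> Arr K"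
  "\<lbrakk>f \<in> Arr finord\<rbrakk> \<Longrightarrow> Dom K (FArr F f) = FObj F (fst f)"
  "\<lbrakk>f \<in> Arr finord\<rbrakk> \<Longrightarrow> Cod K (FArr F f) = FObj F (fst f)"
  using plus.farr[of f "fst f" "fst f"] by (auto simp: homset_iff)

lemma F_id [simp]: "FArr F (n, id) = I n"
  using plus.fidn[of n] by simp

lemma F_cmp: "\<lbrakk>f \<in> Arr finord; g \<in> Arr finord; fst f = fst g\<rbrakk> \<Longrightarrow> FArr F (g \<cdot>\<^bsub>finord\<^esub> f) = FArr F g \<cdot> FArr F f"
  using plus.fcmp[of f "fst f" "fst f" g "fst f"] by (auto simp: homset_iff)

lemma F2_arr [simp]:
  "F2Plus F m n \<in> Arr K" "Dom K (F2Plus F m n) = FObj F m \<odot>\<^bsub>Plus K\<^esub> FObj F n" 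
  "Cod K (F2Plus F m n) = FObj F (m + n)" "is_iso K (F2Plus F m n)"
  "F2Times F m n \<in> Arr K" "Dom K (F2Times F m n) = FObj F m \<odot>\<^bsub>Times K\<^esub> FObj F n" 
  "Cod K (F2Times F m n) = FObj F (m * n)"
  using plus.F2_hom[of m n] times.F2_hom[of m n] F2Plus_iso[of m n] by (auto simp: homset_iff)

lemma F0_arr [simp]:
  "F0Plus F \<in> Arr K" "Dom K (F0Plus F) = Unit (Plus K)" "Cod K (F0Plus F) = FObj F 0" "is_iso K (F0Plus F)"
  "F0Times F \<in> Arr K" "Dom K (F0Times F) = Unit (Times K)" "Cod K (F0Times F) = FObj F (Suc 0)" "is_iso K (F0Times F)"
  using plus.F0_hom times.F0_hom F0Plus_iso F0Times_iso by (auto simp: homset_iff)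

lemma F_sum: "\<lbrakk>f \<in> Arr finord; g \<in> Arr finord; fst f = m; fst g = n\<rbrakk>
  \<Longrightarrow> FArr F (block_sum f g) \<cdot> F2Plus F m n = F2Plus F m n \<cdot> (FArr F f \<odot>\<^sub>a\<^bsub>Plus K\<^esub> FArr F g)"
  using plus.F2_nat[of f m m g n n] by (auto simp: homset_iff)

lemma F_assoc: "F2Plus F (m + n) p \<cdot> (F2Plus F m n \<odot>\<^sub>a\<^bsub>Plus K\<^esub> I p) 
  = F2Plus F m (n + p) \<cdot> (I m \<odot>\<^sub>a\<^bsub>Plus K\<^esub> F2Plus F n p) \<cdot> Assoc (Plus K) (FObj F m) (FObj F n) (FObj F p)"
  using plus.F2_assoc[of m n p] by (simp add: add.assoc)

lemma F_unit: "F2Plus F 0 n \<cdot> (F0Plus F \<odot>\<^sub>a\<^bsub>Plus K\<^esub> I n) = LUnit (Plus K) (FObj F n)"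
  "F2Plus F n 0 \<cdot> (I n \<odot>\<^sub>a\<^bsub>Plus K\<^esub> F0Plus F) = RUnit (Plus K) (FObj F n)"
  "F2Times F n (Suc 0) \<cdot> (I n \<odot>\<^sub>a\<^bsub>Times K\<^esub> F0Times F) = RUnit (Times K) (FObj F n)"
  using plus.F2_lunit[of n] plus.F2_runit[of n] times.F2_runit[of n] by simp_all

lemma F_swap: "FArr F (block_swap m n) \<cdot> F2Plus F m n = F2Plus F n m \<cdot> PlusSym K (FObj F m) (FObj F n)"
  "FArr F (pair_swap m n) \<cdot> F2Times F m n = F2Times F n m \<cdot> TimesSym K (FObj F m) (FObj F n)"
  using plus.F2_sym[of m n] times.F2_sym[of m n] by simp_all

lemma F_null: "F2Times F 0 n \<cdot> (F0Plus F \<odot>\<^sub>a\<^bsub>Times K\<^esub> I n) = F0Plus F \<cdot> LNull K (FObj F n)"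
  using preserves_lnull[of n] by simp

lemma F_dist: "FArr F (left_distr m n p) \<cdot> F2Times F m (n + p) \<cdot> (I m \<odot>\<^sub>a\<^bsub>Times K\<^esub> F2Plus F n p)
  = F2Plus F (m * n) (m * p) \<cdot> (F2Times F m n \<odot>\<^sub>a\<^bsub>Plus K\<^esub> F2Times F m p) \<cdot> LDist K (FObj F m) (FObj F n) (FObj F p)"
  using preserves_ldist[of m n p] by simp

end

locale comparison = F: finord_functor K F + G: finord_functor K G
  for K :: "('o, 'a, 'm) symmetric_bimonoidal_scheme" (structure) and F G
begin

abbreviation plus_arr (infixr "\<oplus>" 65) where "f \<oplus> g \<equiv> f \<odot>\<^sub>a\<^bsub>Plus K\<^esub> g"
abbreviation times_arr (infixr "\<otimes>" 70) where "f \<otimes> g \<equiv> f \<odot>\<^sub>a\<^bsub>Times K\<^esub> g"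

definition compare_one where "compare_one = F0Times G \<cdot> inv_arr K (F0Times F)"

text \<open>The only possible components: the unit axioms force \<open>compare_at 0\<close> and
  \<open>compare_one\<close>, and compatibility with sums at \<open>1 + n\<close> forces the rest.\<close>

primrec compare_at where
  "compare_at 0 = F0Plus G \<cdot> inv_arr K (F0Plus F)"
| "compare_at (Suc n) = F2Plus G (Suc 0) n \<cdot> (compare_one \<oplus> compare_at n) \<cdot> inv_arr K (F2Plus F (Suc 0) n)"

lemma compare_one_arr [simp]: "compare_one \<in> Arr K" "Dom K compare_one = FObj F (Suc 0)" "Cod K compare_one = FObj G (Suc 0)"
  by (simp_all add: compare_one_def)

lemma compare_at_hom: "compare_at n \<in> Arr K \<and> Dom K (compare_at n) = FObj F n \<and> Cod K (compare_at n) = FObj G n"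
  by (induction n) auto

lemma compare_at_arr [simp]: "compare_at n \<in> Arr K" "Dom K (compare_at n) = FObj F n" "Cod K (compare_at n) = FObj G n"
  using compare_at_hom by auto

lemmas pmerge = F.target.plus.merge F.target.plus.merge_chain
lemmas tmerge = F.target.times.merge F.target.times.merge_chain
lemmas cancel_left = F.target.plus.iso_cancel_left and cancel_right = F.target.plus.iso_cancel_right
lemmas in_chain = F.target.plus.in_chain

text \<open>The recursion reaches 1 as \<open>1 + 0\<close>; the right unit law of both functors identifies the two
  descriptions of the component.\<close>

lemma compare_at_one: "compare_at (Suc 0) = compare_one"
proof (rule cancel_right)
  let ?P = "F2Plus F (Suc 0) 0 \<cdot> (Idn K (FObj F (Suc 0)) \<oplus> F0Plus F)"
  have "compare_at (Suc 0) \<cdot> ?P = (F2Plus G (Suc 0) 0 \<cdot> (Idn K (FObj G (Suc 0)) \<oplus> F0Plus G)) \<cdot> (compare_one \<oplus> Idn K (Unit (Plus K)))"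
    by (simp add: pmerge)
  also have "\<dots> = compare_one \<cdot> RUnit (Plus K) (FObj F (Suc 0))"
    by (simp add: G.F_unit F.target.plus.nat_runit)
  also have "\<dots> = compare_one \<cdot> ?P" by (simp add: F.F_unit)
  finally show "compare_at (Suc 0) \<cdot> ?P = compare_one \<cdot> ?P" .
qed auto

lemma compare_at_plus: "compare_at (m + n) \<cdot> F2Plus F m n = F2Plus G m n \<cdot> (compare_at m \<oplus> compare_at n)"
proof (induction m)
  case 0
  let ?P = "F0Plus F \<oplus> Idn K (FObj F n)"
  show ?case
  proof (rule cancel_right)
    have "(compare_at (0 + n) \<cdot> F2Plus F 0 n) \<cdot> ?P = compare_at n \<cdot> LUnit (Plus K) (FObj F n)"
      by (simp add: F.F_unit)
    also have "\<dots> = LUnit (Plus K) (FObj G n) \<cdot> (Idn K (Unit (Plus K)) \<oplus> compare_at n)"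
      by (simp add: F.target.plus.nat_lunit)
    also have "\<dots> = F2Plus G 0 n \<cdot> (F0Plus G \<oplus> Idn K (FObj G n)) \<cdot> (Idn K (Unit (Plus K)) \<oplus> compare_at n)"
      by (simp add: G.F_unit[symmetric])
    also have "\<dots> = (F2Plus G 0 n \<cdot> (compare_at 0 \<oplus> compare_at n)) \<cdot> ?P"
      by (simp add: pmerge)
    finally show "(compare_at (0 + n) \<cdot> F2Plus F 0 n) \<cdot> ?P = (F2Plus G 0 n \<cdot> (compare_at 0 \<oplus> compare_at n)) \<cdot> ?P" .
  qed auto
next
  case (Suc m)
  let ?P = "F2Plus F (Suc 0) m \<oplus> Idn K (FObj F n)"
  let ?A = "Assoc (Plus K) (FObj F (Suc 0)) (FObj F m) (FObj F n)"
  let ?B = "Assoc (Plus K) (FObj G (Suc 0)) (FObj G m) (FObj G n)"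
  show ?case
  proof (rule cancel_right)
    have "(compare_at (Suc m + n) \<cdot> F2Plus F (Suc m) n) \<cdot> ?P = compare_at (Suc (m + n)) \<cdot> F2Plus F (Suc 0) (m + n)
        \<cdot> (Idn K (FObj F (Suc 0)) \<oplus> F2Plus F m n) \<cdot> ?A"
      using F.F_assoc[of "Suc 0" m n] by (simp del: compare_at.simps)
    also have "\<dots> = F2Plus G (Suc 0) (m + n) \<cdot> (compare_one \<oplus> (compare_at (m + n) \<cdot> F2Plus F m n)) \<cdot> ?A"
      by (simp add: pmerge)
    also have "\<dots> = F2Plus G (Suc 0) (m + n) \<cdot> (Idn K (FObj G (Suc 0)) \<oplus> F2Plus G m n) 
        \<cdot> (compare_one \<oplus> (compare_at m \<oplus> compare_at n)) \<cdot> ?A"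
      unfolding Suc.IH by (simp add: pmerge)
    also have "\<dots> = (F2Plus G (Suc 0) (m + n) \<cdot> (Idn K (FObj G (Suc 0)) \<oplus> F2Plus G m n) \<cdot> ?B) 
        \<cdot> ((compare_one \<oplus> compare_at m) \<oplus> compare_at n)"
      by (simp add: F.target.plus.nat_assoc)
    also have "\<dots> = F2Plus G (Suc m) n \<cdot> (F2Plus G (Suc 0) m \<oplus> Idn K (FObj G n)) \<cdot> ((compare_one \<oplus> compare_at m) \<oplus> compare_at n)"
      unfolding G.F_assoc[symmetric] by simp
    also have "\<dots> = (F2Plus G (Suc m) n \<cdot> (compare_at (Suc m) \<oplus> compare_at n)) \<cdot> ?P"
      by (simp add: pmerge)
    finally show "(compare_at (Suc m + n) \<cdot> F2Plus F (Suc m) n) \<cdot> ?P = (F2Plus G (Suc m) n \<cdot> (compare_at (Suc m) \<oplus> compare_at n)) \<cdot> ?P" .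
  qed (auto simp del: compare_at.simps)
qed

lemma compare_at_nat: "f \<in> Arr finord \<Longrightarrow> compare_at (fst f) \<cdot> FArr F f = FArr G f \<cdot> compare_at (fst f)"
proof (induction rule: finord_induct)
  case (id n)
  then show ?case using F.F_id[of n] G.F_id[of n] by simp
next
  case (cmp f g)
  have "compare_at (fst f) \<cdot> FArr F (g \<cdot>\<^bsub>finord\<^esub> f) = (compare_at (fst g) \<cdot> FArr F g) \<cdot> FArr F f"
    using cmp(1-3) by (simp add: F.F_cmp)
  also have "\<dots> = FArr G g \<cdot> compare_at (fst f) \<cdot> FArr F f"
    unfolding cmp(5) using cmp(1-3) by simp
  also have "\<dots> = FArr G (g \<cdot>\<^bsub>finord\<^esub> f) \<cdot> compare_at (fst f)"
    unfolding cmp(4) using cmp(1-3) by (simp add: G.F_cmp)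
  finally show ?case by simp
next
  case (sum f g)
  let ?m = "fst f" and ?n = "fst g"
  note [simp] = sum(1,2)
  have "compare_at (?m + ?n) \<cdot> FArr F (block_sum f g) = FArr G (block_sum f g) \<cdot> compare_at (?m + ?n)" (is "?lhs = ?rhs")
  proof (rule cancel_right)
    have "(compare_at (?m + ?n) \<cdot> FArr F (block_sum f g)) \<cdot> F2Plus F ?m ?n = (compare_at (?m + ?n) \<cdot> F2Plus F ?m ?n) \<cdot> (FArr F f \<oplus> FArr F g)"
      by (simp add: F.F_sum)
    also have "\<dots> = F2Plus G ?m ?n \<cdot> ((compare_at ?m \<cdot> FArr F f) \<oplus> (compare_at ?n \<cdot> FArr F g))"
      unfolding compare_at_plus by (simp add: pmerge)
    also have "\<dots> = (F2Plus G ?m ?n \<cdot> (FArr G f \<oplus> FArr G g)) \<cdot> (compare_at ?m \<oplus> compare_at ?n)"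
      unfolding sum by (simp add: pmerge)
    also have "\<dots> = FArr G (block_sum f g) \<cdot> (F2Plus G ?m ?n \<cdot> (compare_at ?m \<oplus> compare_at ?n))"
      by (subst G.F_sum[symmetric]) auto
    also have "\<dots> = (FArr G (block_sum f g) \<cdot> compare_at (?m + ?n)) \<cdot> F2Plus F ?m ?n"
      unfolding compare_at_plus[symmetric] by simp
    finally show "?lhs \<cdot> F2Plus F ?m ?n = ?rhs \<cdot> F2Plus F ?m ?n" .
  qed auto
  then show ?case by simp
next
  case swap
  define m n where "m = Suc 0" and "n = Suc 0"
  have [simp]: "n + m = m + n" by simp
  have "compare_at (m + n) \<cdot> FArr F (block_swap m n) = FArr G (block_swap m n) \<cdot> compare_at (m + n)" (is "?lhs = ?rhs")
  proof (rule cancel_right)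
    have "(compare_at (m + n) \<cdot> FArr F (block_swap m n)) \<cdot> F2Plus F m n = (compare_at (n + m) \<cdot> F2Plus F n m) \<cdot> PlusSym K (FObj F m) (FObj F n)"
      by (simp add: F.F_swap)
    also have "\<dots> = F2Plus G n m \<cdot> PlusSym K (FObj G m) (FObj G n) \<cdot> (compare_at m \<oplus> compare_at n)"
      unfolding compare_at_plus by (simp add: F.target.plus.nat_sym)
    also have "\<dots> = FArr G (block_swap m n) \<cdot> (F2Plus G m n \<cdot> (compare_at m \<oplus> compare_at n))"
      by (simp add: in_chain[OF G.F_swap(1)])
    also have "\<dots> = (FArr G (block_swap m n) \<cdot> compare_at (m + n)) \<cdot> F2Plus F m n"
      unfolding compare_at_plus[symmetric] by simp
    finally show "?lhs \<cdot> F2Plus F m n = ?rhs \<cdot> F2Plus F m n" .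
  qed auto
  then show ?case by (simp add: m_def n_def del: compare_at.simps)
qed

text \<open>Compatibility with the products, as a property of \<open>m\<close> and \<open>n\<close>. It is symmetric by
  naturality, additive in \<open>n\<close> by the left distributivity, and it holds for the factors 0 and 1.\<close>

definition multiplicative where
  "multiplicative m n \<longleftrightarrow> compare_at (m * n) \<cdot> F2Times F m n = F2Times G m n \<cdot> (compare_at m \<otimes> compare_at n)"

lemma multiplicative_sym:
  assumes "multiplicative m n" shows "multiplicative n m"
  unfolding multiplicative_def
proof (rule cancel_right)
  have [simp]: "n * m = m * n" by simp
  let ?z = "TimesSym K"
  have "(compare_at (n * m) \<cdot> F2Times F n m) \<cdot> ?z (FObj F m) (FObj F n) = (compare_at (m * n) \<cdot> FArr F (pair_swap m n)) \<cdot> F2Times F m n"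
    by (simp add: F.F_swap)
  also have "\<dots> = FArr G (pair_swap m n) \<cdot> (compare_at (m * n) \<cdot> F2Times F m n)"
    using compare_at_nat[of "pair_swap m n"] by simp
  also have "\<dots> = (FArr G (pair_swap m n) \<cdot> F2Times G m n) \<cdot> (compare_at m \<otimes> compare_at n)"
    using assms by (simp add: multiplicative_def)
  also have "\<dots> = (F2Times G n m \<cdot> (compare_at n \<otimes> compare_at m)) \<cdot> ?z (FObj F m) (FObj F n)"
    unfolding G.F_swap by (simp add: F.target.times.nat_sym)
  finally show "(compare_at (n * m) \<cdot> F2Times F n m) \<cdot> ?z (FObj F m) (FObj F n) = (F2Times G n m \<cdot> (compare_at n \<otimes> compare_at m)) \<cdot> ?z (FObj F m) (FObj F n)" .
qed (auto simp: mult.commute)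

lemma multiplicative_zero: "multiplicative 0 n"
  unfolding multiplicative_def
proof (rule cancel_right)
  let ?P = "F0Plus F \<otimes> Idn K (FObj F n)"
  have "(compare_at (0 * n) \<cdot> F2Times F 0 n) \<cdot> ?P = F0Plus G \<cdot> LNull K (FObj F n)"
    by (simp add: F.F_null)
  also have "\<dots> = (F0Plus G \<cdot> LNull K (FObj G n)) \<cdot> (Idn K (Unit (Plus K)) \<otimes> compare_at n)"
    by (simp add: F.target.nat_lnull)
  also have "\<dots> = (F2Times G 0 n \<cdot> (compare_at 0 \<otimes> compare_at n)) \<cdot> ?P"
    unfolding G.F_null[symmetric] by (simp add: tmerge)
  finally show "(compare_at (0 * n) \<cdot> F2Times F 0 n) \<cdot> ?P = (F2Times G 0 n \<cdot> (compare_at 0 \<otimes> compare_at n)) \<cdot> ?P" .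
qed auto

lemma multiplicative_one: "multiplicative m (Suc 0)"
  unfolding multiplicative_def
proof (rule cancel_right)
  let ?P = "Idn K (FObj F m) \<otimes> F0Times F"
  have "(compare_at (m * Suc 0) \<cdot> F2Times F m (Suc 0)) \<cdot> ?P = compare_at m \<cdot> RUnit (Times K) (FObj F m)"
    by (simp add: F.F_unit)
  also have "\<dots> = RUnit (Times K) (FObj G m) \<cdot> (compare_at m \<otimes> Idn K (Unit (Times K)))"
    by (simp add: F.target.times.nat_runit)
  also have "\<dots> = F2Times G m (Suc 0) \<cdot> (Idn K (FObj G m) \<otimes> F0Times G) \<cdot> (compare_at m \<otimes> Idn K (Unit (Times K)))"
    unfolding G.F_unit[symmetric] by simp
  also have "\<dots> = (F2Times G m (Suc 0) \<cdot> (compare_at m \<otimes> compare_at (Suc 0))) \<cdot> ?P"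
    unfolding compare_at_one by (simp add: tmerge compare_one_def)
  finally show "(compare_at (m * Suc 0) \<cdot> F2Times F m (Suc 0)) \<cdot> ?P = (F2Times G m (Suc 0) \<cdot> (compare_at m \<otimes> compare_at (Suc 0))) \<cdot> ?P" .
qed auto

text \<open>The image under \<open>G\<close> of the left distributivity of \<open>finord\<close> is invertible and can be
  cancelled; the left distributivity of the target is only moved along by naturality.\<close>

lemma multiplicative_add:
  assumes n: "multiplicative m n" and p: "multiplicative m p" shows "multiplicative m (n + p)"
proof -
  let ?d = "left_distr m n p" and ?P = "Idn K (FObj F m) \<otimes> F2Plus F n p"
  let ?D = "LDist K (FObj F m) (FObj F n) (FObj F p)"
  have [simp]: "m * (n + p) = m * n + m * p" by (simp add: distrib_left)
  have iso: "is_iso K (FArr G ?d)"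
  proof -
    obtain g where g: "g \<in> Arr finord" "fst g = fst ?d" "g \<cdot>\<^bsub>finord\<^esub> ?d = (fst ?d, id)" "?d \<cdot>\<^bsub>finord\<^esub> g = (fst ?d, id)"
      using finord_is_iso[OF left_distr_Arr[of m n p]]
      by (metis finord.inv_arr_arr finord.dom_inv finord.inv_left finord.inv_right finord_simps(2-4))
    show ?thesis
      using g G.F_cmp[of ?d g] G.F_cmp[of g ?d] by (intro F.target.plus.isoI[of _ "FArr G g"]) auto
  qed
  have "FArr G ?d \<cdot> compare_at (m * (n + p)) \<cdot> F2Times F m (n + p) \<cdot> ?P = (compare_at (fst ?d) \<cdot> FArr F ?d) \<cdot> F2Times F m (n + p) \<cdot> ?P"
    unfolding compare_at_nat[OF left_distr_Arr] by simp
  also have "\<dots> = (compare_at (m * n + m * p) \<cdot> F2Plus F (m * n) (m * p)) \<cdot> (F2Times F m n \<oplus> F2Times F m p) \<cdot> ?D"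
    using F.F_dist[of m n p] by simp
  also have "\<dots> = F2Plus G (m * n) (m * p) \<cdot> ((compare_at (m * n) \<cdot> F2Times F m n) \<oplus> (compare_at (m * p) \<cdot> F2Times F m p)) \<cdot> ?D"
    unfolding compare_at_plus by (simp add: pmerge)
  also have "\<dots> = F2Plus G (m * n) (m * p) \<cdot> (F2Times G m n \<oplus> F2Times G m p) \<cdot> (((compare_at m \<otimes> compare_at n) \<oplus> (compare_at m \<otimes> compare_at p)) \<cdot> ?D)"
    using n p by (simp add: multiplicative_def pmerge)
  also have "\<dots> = (F2Plus G (m * n) (m * p) \<cdot> (F2Times G m n \<oplus> F2Times G m p) \<cdot> LDist K (FObj G m) (FObj G n) (FObj G p))
      \<cdot> (compare_at m \<otimes> (compare_at n \<oplus> compare_at p))"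
    using F.target.nat_ldist[of "compare_at m" "compare_at n" "compare_at p" "FObj G m" "FObj G n" "FObj G p"] by simp
  also have "\<dots> = FArr G ?d \<cdot> F2Times G m (n + p) \<cdot> (compare_at m \<otimes> (F2Plus G n p \<cdot> (compare_at n \<oplus> compare_at p)))"
    unfolding G.F_dist[symmetric] by (simp add: tmerge)
  also have "\<dots> = FArr G ?d \<cdot> (F2Times G m (n + p) \<cdot> (compare_at m \<otimes> compare_at (n + p))) \<cdot> ?P"
    unfolding compare_at_plus[symmetric] by (simp add: tmerge)
  finally have eq: "compare_at (m * (n + p)) \<cdot> F2Times F m (n + p) \<cdot> ?P = (F2Times G m (n + p) \<cdot> (compare_at m \<otimes> compare_at (n + p))) \<cdot> ?P"
    by (rule cancel_left) (use iso in auto)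
  show ?thesis unfolding multiplicative_def
  proof (rule cancel_right)
    show "(compare_at (m * (n + p)) \<cdot> F2Times F m (n + p)) \<cdot> ?P
      = (F2Times G m (n + p) \<cdot> (compare_at m \<otimes> compare_at (n + p))) \<cdot> ?P"
      using eq by simp
  qed auto
qed

lemma multiplicative: "multiplicative m n"
proof (induction n)
  case 0
  show ?case by (rule multiplicative_sym[OF multiplicative_zero])
next
  case (Suc n)
  then show ?case using multiplicative_add[OF multiplicative_one, of m n] by simp
qed

lemma comparison_transformation: "bimonoidal_transformation finord K F G compare_at"
proof unfold_locales
  show "compare_at (Unit (Times finord)) \<cdot> F0Times F = F0Times G"
    using compare_at_one by (simp add: compare_one_def)
qed (use compare_at_nat multiplicative in \<open>auto simp: homset_iff compare_at_plus multiplicative_def\<close>)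

lemma transformation_unique:
  assumes "bimonoidal_transformation finord K F G \<eta>" shows "\<eta> = compare_at"
proof
  interpret bimonoidal_transformation finord K F G \<eta> by fact
  have [simp]: "\<eta> n \<in> Arr K" "Dom K (\<eta> n) = FObj F n" "Cod K (\<eta> n) = FObj G n" for n
    using component[of n] by (auto simp: homset_iff)
  have one: "\<eta> (Suc 0) = compare_one"
    by (rule cancel_right[of _ "F0Times F"]) (use times_0 in \<open>auto simp: compare_one_def\<close>)
  show "\<eta> n = compare_at n" for n
  proof (induction n)
    case 0
    show ?case by (rule cancel_right[of _ "F0Plus F"]) (use plus_0 in auto)
  next
    case (Suc n)
    have "\<eta> (Suc n) \<cdot> F2Plus F (Suc 0) n = compare_at (Suc n) \<cdot> F2Plus F (Suc 0) n"
      using plus_2[of "Suc 0" n] by (simp add: one Suc.IH)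
    then show ?case by (rule cancel_right) (auto simp del: compare_at.simps)
  qed
qed

end

theorem unique_bimonoidal_transformation:
  assumes "robust_symmetric_bimonoidal_functor finord K F" "robust_symmetric_bimonoidal_functor finord K G"
  shows "\<exists>!\<eta>. bimonoidal_transformation finord K F G \<eta>"
proof -
  interpret F: robust_symmetric_bimonoidal_functor finord K F by fact
  interpret G: robust_symmetric_bimonoidal_functor finord K G by fact
  interpret comparison K F G by unfold_locales
  show ?thesis using comparison_transformation transformation_unique by blast
qed

section \<open>Equivalence with the terminal category\<close>
lemma terminal_cat_simps [simp]: 
  "Obj terminal_cat = UNIV" "homset terminal_cat A B = UNIV" 
  by (auto simp: terminal_cat_def homset_def)

lemma category_terminal: "category terminal_cat"
  by unfold_locales auto

lemma functor_to_terminal: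
  assumes "category R" shows "cat_functor R terminal_cat (T :: (_, _, unit, unit) functor_data)
    \<longleftrightarrow> FObj T \<in> extensional (Obj R) \<and> FArr T \<in> extensional (Arr R)"
proof -
  interpret category R by fact
  interpret t: category terminal_cat by (rule category_terminal)
  show ?thesis
    by (auto simp: cat_functor_def cat_functor_axioms_def category_axioms t.category_axioms)
qed

lemma unit_extensional [simp]: "(f :: 'a \<Rightarrow> unit) \<in> extensional A"
  by (auto simp: extensional_def)

lemma is_iso_unique_arrow:
  assumes "category R" and unique: "\<And>A B. \<lbrakk>A \<in> Obj R; B \<in> Obj R\<rbrakk> \<Longrightarrow> \<exists>!f. f \<in> homset R A B"
    and f: "f \<in> Arr R"
  shows "is_iso R f"
proof -
  interpret category R by fact
  obtain g where g: "g \<in> homset R (Cod R f) (Dom R f)" using unique[of "Cod R f" "Dom R f"] f by auto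
  have loop: "h = Idn R A" if "h \<in> Arr R" "Dom R h = A" "Cod R h = A" for h A
    using unique[of A A] idn_hom[of A] that by (auto simp: homset_iff)
  have "g \<cdot>\<^bsub>R\<^esub> f = Idn R (Dom R f)" "f \<cdot>\<^bsub>R\<^esub> g = Idn R (Cod R f)"
    by (rule loop; use f g in \<open>simp add: homset_iff\<close>)+
  then show ?thesis using f g by (intro isoI[of f g]) (auto simp: homset_iff)
qed

lemma equivalence_to_terminal:
  fixes T :: "('o, 'a, unit, unit) functor_data"
  assumes "category R" and unique: "\<And>A B. \<lbrakk>A \<in> Obj R; B \<in> Obj R\<rbrakk> \<Longrightarrow> \<exists>!f. f \<in> homset R A B"
    and X: "X \<in> Obj R" and T: "cat_functor R terminal_cat T"
  shows "equivalence_of_categories R terminal_cat T"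
proof -
  interpret category R by fact
  interpret T: cat_functor R terminal_cat T by fact
  have eq: "f = g" if "f \<in> homset R A B" "g \<in> homset R A B" "A \<in> Obj R" "B \<in> Obj R" for f g A B
    using unique[of A B] that by blast
  define G :: "(unit, unit, 'o, 'a) functor_data" where "G = \<lparr>FObj = (\<lambda>_. X), FArr = (\<lambda>_. Idn R X)\<rparr>"
  have G: "cat_functor terminal_cat R G"
    by unfold_locales (use X in \<open>auto simp: G_def homset_iff terminal_cat_def\<close>)
  define \<eta> where "\<eta> = (\<lambda>A \<in> Obj R. THE f. f \<in> homset R A X)"
  have \<eta>: "\<eta> A \<in> homset R A X" if "A \<in> Obj R" for A
    using theI'[OF unique[OF that X]] that by (simp add: \<eta>_def)
  have id: "cat_functor R R (id_functor R)"
    by unfold_locales (auto simp: id_functor_def homset_iff)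
  have GT: "cat_functor R R (comp_functor R G T)"
    by unfold_locales (use X in \<open>auto simp: comp_functor_def G_def homset_iff\<close>)
  interpret id: cat_functor R R "id_functor R" by fact
  interpret GT: cat_functor R R "comp_functor R G T" by fact
  have "natural_isomorphism R R (id_functor R) (comp_functor R G T) \<eta>"
  proof unfold_locales
    fix A assume A: "A \<in> Obj R"
    show "\<eta> A \<in> homset R (FObj (id_functor R) A) (FObj (comp_functor R G T) A)"
      using \<eta>[OF A] A by (simp add: id_functor_def comp_functor_def G_def)
    show "is_iso R (\<eta> A)"
      using \<eta>[OF A] is_iso_unique_arrow[OF assms(1) unique] by (simp add: homset_iff)
  next
    fix f A B assume f: "f \<in> homset R A B"
    then have "A \<in> Obj R" "B \<in> Obj R" by (auto simp: homset_iff)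
    then show "\<eta> B \<cdot>\<^bsub>R\<^esub> FArr (id_functor R) f = FArr (comp_functor R G T) f \<cdot>\<^bsub>R\<^esub> \<eta> A"
      using f \<eta>[of A] \<eta>[of B] X
      by (intro eq[of _ A X]) (auto simp: id_functor_def comp_functor_def G_def homset_iff)
  qed (simp add: \<eta>_def)
  moreover have "natural_isomorphism terminal_cat terminal_cat (comp_functor terminal_cat T G) (id_functor terminal_cat) (\<lambda>_. ())"
  proof -
    interpret t: category terminal_cat by (rule category_terminal)
    show ?thesis
      by unfold_locales
        (auto simp: is_iso_def inverse_arrows_def homset_def terminal_cat_def)
  qed
  ultimately show ?thesis unfolding equivalence_of_categories_def using T G by blast
qed

lemma identity_transformation:
  assumes "symmetric_bimonoidal_functor K L F"
  shows "bimonoidal_transformation K L F F (\<lambda>A \<in> Obj K. Idn L (FObj F A))"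
proof -
  interpret F: symmetric_bimonoidal_functor K L F by fact
  have [simp]: "FObj F A \<in> Obj L" if "A \<in> Obj K" for A using F.plus.fobj[OF that] .
  show ?thesis
  proof unfold_locales
    fix f A B assume f: "f \<in> homset K A B"
    then show "(\<lambda>A\<in>Obj K. Idn L (FObj F A)) B \<cdot>\<^bsub>L\<^esub> FArr F f = FArr F f \<cdot>\<^bsub>L\<^esub> (\<lambda>A\<in>Obj K. Idn L (FObj F A)) A"
      using F.plus.farr[OF f] by (auto simp: homset_iff)
  qed (use F.plus.F2_hom F.plus.F0_hom F.times.F2_hom F.times.F0_hom in \<open>auto simp: homset_iff\<close>)
qed

lemma composite_transformation:
  assumes "bimonoidal_transformation K L F G \<eta>" "bimonoidal_transformation K L G H \<theta>"
  shows "bimonoidal_transformation K L F H (\<lambda>A \<in> Obj K. \<theta> A \<cdot>\<^bsub>L\<^esub> \<eta> A)"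
proof -
  interpret \<eta>: bimonoidal_transformation K L F G \<eta> by fact
  interpret \<theta>: bimonoidal_transformation K L G H \<theta> by fact
  have \<eta>_arr [simp]: "A \<in> Obj K \<Longrightarrow> \<eta> A \<in> Arr L" "A \<in> Obj K \<Longrightarrow> Dom L (\<eta> A) = FObj F A" 
    "A \<in> Obj K \<Longrightarrow> Cod L (\<eta> A) = FObj G A" for A
    using \<eta>.component[of A] by (auto simp: homset_iff)
  have \<theta>_arr [simp]: "A \<in> Obj K \<Longrightarrow> \<theta> A \<in> Arr L" "A \<in> Obj K \<Longrightarrow> Dom L (\<theta> A) = FObj G A" 
    "A \<in> Obj K \<Longrightarrow> Cod L (\<theta> A) = FObj H A" for A
    using \<theta>.component[of A] by (auto simp: homset_iff)
  note [simp] = \<eta>.F.source.plus.tobj \<eta>.F.source.times.tobj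
  show ?thesis
  proof unfold_locales
    fix A B f assume f: "f \<in> homset K A B"
    have [simp]: "A \<in> Obj K" "B \<in> Obj K" using f by (auto simp: homset_iff)
    have F: "FArr F f \<in> homset L (FObj F A) (FObj F B)" and G: "FArr G f \<in> homset L (FObj G A) (FObj G B)"
      and H: "FArr H f \<in> homset L (FObj H A) (FObj H B)"
      using f \<eta>.F.plus.farr \<eta>.G.plus.farr \<theta>.G.plus.farr by blast+
    have "(\<theta> B \<cdot>\<^bsub>L\<^esub> \<eta> B) \<cdot>\<^bsub>L\<^esub> FArr F f = (\<theta> B \<cdot>\<^bsub>L\<^esub> FArr G f) \<cdot>\<^bsub>L\<^esub> \<eta> A"
      using F G \<eta>.naturality[OF f] by (simp add: homset_iff)
    also have "\<dots> = FArr H f \<cdot>\<^bsub>L\<^esub> (\<theta> A \<cdot>\<^bsub>L\<^esub> \<eta> A)"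
      unfolding \<theta>.naturality[OF f] using H by (simp add: homset_iff)
    finally show "(\<lambda>A\<in>Obj K. \<theta> A \<cdot>\<^bsub>L\<^esub> \<eta> A) B \<cdot>\<^bsub>L\<^esub> FArr F f = FArr H f \<cdot>\<^bsub>L\<^esub> (\<lambda>A\<in>Obj K. \<theta> A \<cdot>\<^bsub>L\<^esub> \<eta> A) A"
      by simp
  next
    fix A B assume [simp]: "A \<in> Obj K" "B \<in> Obj K"
    let ?p = "A \<odot>\<^bsub>Plus K\<^esub> B" and ?t = "A \<odot>\<^bsub>Times K\<^esub> B"
    have "(\<theta> ?p \<cdot>\<^bsub>L\<^esub> \<eta> ?p) \<cdot>\<^bsub>L\<^esub> F2Plus F A B = (\<theta> ?p \<cdot>\<^bsub>L\<^esub> F2Plus G A B) \<cdot>\<^bsub>L\<^esub> (\<eta> A \<odot>\<^sub>a\<^bsub>Plus L\<^esub> \<eta> B)"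
      using \<eta>.plus_2[of A B] \<eta>.F.plus.F2_hom[of A B] \<eta>.G.plus.F2_hom[of A B] by (simp add: homset_iff)
    also have "\<dots> = F2Plus H A B \<cdot>\<^bsub>L\<^esub> ((\<theta> A \<cdot>\<^bsub>L\<^esub> \<eta> A) \<odot>\<^sub>a\<^bsub>Plus L\<^esub> (\<theta> B \<cdot>\<^bsub>L\<^esub> \<eta> B))"
      unfolding \<theta>.plus_2[OF \<open>A \<in> Obj K\<close> \<open>B \<in> Obj K\<close>]
      using \<theta>.G.plus.F2_hom[of A B] by (simp add: homset_iff \<eta>.F.target.plus.merge)
    finally show "(\<lambda>A\<in>Obj K. \<theta> A \<cdot>\<^bsub>L\<^esub> \<eta> A) ?p \<cdot>\<^bsub>L\<^esub> F2Plus F A B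
      = F2Plus H A B \<cdot>\<^bsub>L\<^esub> ((\<lambda>A\<in>Obj K. \<theta> A \<cdot>\<^bsub>L\<^esub> \<eta> A) A \<odot>\<^sub>a\<^bsub>Plus L\<^esub> (\<lambda>A\<in>Obj K. \<theta> A \<cdot>\<^bsub>L\<^esub> \<eta> A) B)"
      by simp
    have "(\<theta> ?t \<cdot>\<^bsub>L\<^esub> \<eta> ?t) \<cdot>\<^bsub>L\<^esub> F2Times F A B = (\<theta> ?t \<cdot>\<^bsub>L\<^esub> F2Times G A B) \<cdot>\<^bsub>L\<^esub> (\<eta> A \<odot>\<^sub>a\<^bsub>Times L\<^esub> \<eta> B)"
      using \<eta>.times_2[of A B] \<eta>.F.times.F2_hom[of A B] \<eta>.G.times.F2_hom[of A B] by (simp add: homset_iff)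
    also have "\<dots> = F2Times H A B \<cdot>\<^bsub>L\<^esub> ((\<theta> A \<cdot>\<^bsub>L\<^esub> \<eta> A) \<odot>\<^sub>a\<^bsub>Times L\<^esub> (\<theta> B \<cdot>\<^bsub>L\<^esub> \<eta> B))"
      unfolding \<theta>.times_2[OF \<open>A \<in> Obj K\<close> \<open>B \<in> Obj K\<close>]
      using \<theta>.G.times.F2_hom[of A B] by (simp add: homset_iff \<eta>.F.target.times.merge)
    finally show "(\<lambda>A\<in>Obj K. \<theta> A \<cdot>\<^bsub>L\<^esub> \<eta> A) ?t \<cdot>\<^bsub>L\<^esub> F2Times F A B
      = F2Times H A B \<cdot>\<^bsub>L\<^esub> ((\<lambda>A\<in>Obj K. \<theta> A \<cdot>\<^bsub>L\<^esub> \<eta> A) A \<odot>\<^sub>a\<^bsub>Times L\<^esub> (\<lambda>A\<in>Obj K. \<theta> A \<cdot>\<^bsub>L\<^esub> \<eta> A) B)"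
      by simp
  qed (use \<eta>.plus_0 \<theta>.plus_0 \<eta>.times_0 \<theta>.times_0 \<eta>.F.plus.F0_hom \<eta>.F.times.F0_hom in
      \<open>auto simp: homset_iff\<close>)
qed

lemma homset_robust_functor_cat:
  "f \<in> homset (robust_functor_cat K L) F G \<longleftrightarrow> (\<exists>\<eta>. f = (F, \<eta>, G) \<and>
     robust_symmetric_bimonoidal_functor K L F \<and> robust_symmetric_bimonoidal_functor K L G \<and>
     bimonoidal_transformation K L F G \<eta>)"
  by (auto simp: homset_def robust_functor_cat_def)

lemma Obj_robust_functor_cat:
  "F \<in> Obj (robust_functor_cat K L) \<longleftrightarrow> robust_symmetric_bimonoidal_functor K L F"
  by (simp add: robust_functor_cat_def)

lemma unique_arrow_robust_functor_cat:
  assumes "F \<in> Obj (robust_functor_cat finord C)" "G \<in> Obj (robust_functor_cat finord C)"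
  shows "\<exists>!f. f \<in> homset (robust_functor_cat finord C) F G"
proof -
  have robust: "robust_symmetric_bimonoidal_functor finord C F" "robust_symmetric_bimonoidal_functor finord C G"
    using assms by (simp_all add: Obj_robust_functor_cat)
  then obtain \<eta> where \<eta>: "bimonoidal_transformation finord C F G \<eta>"
    and unique: "\<And>\<theta>. bimonoidal_transformation finord C F G \<theta> \<Longrightarrow> \<theta> = \<eta>"
    using unique_bimonoidal_transformation by blast
  show ?thesis
  proof (rule ex1I[of _ "(F, \<eta>, G)"])
    show "(F, \<eta>, G) \<in> homset (robust_functor_cat finord C) F G"
      using robust \<eta> by (simp add: homset_robust_functor_cat)
    show "f = (F, \<eta>, G)" if "f \<in> homset (robust_functor_cat finord C) F G" for f
      using that unique by (auto simp: homset_robust_functor_cat)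
  qed
qed

text \<open>Associativity and the unit laws hold because parallel arrows are equal, so only identities and
  composites have to be shown to be bimonoidal transformations.\<close>

lemma category_robust_functor_cat: "category (robust_functor_cat finord C)" (is "category ?R")
proof -
  have obj: "f \<in> Arr ?R \<Longrightarrow> Dom ?R f \<in> Obj ?R \<and> Cod ?R f \<in> Obj ?R" for f
    by (auto simp: robust_functor_cat_def)
  have hom_obj: "f \<in> homset ?R F G \<Longrightarrow> F \<in> Obj ?R \<and> G \<in> Obj ?R" for f F G
    by (auto simp: homset_robust_functor_cat Obj_robust_functor_cat)
  have eq: "f \<in> homset ?R F G \<Longrightarrow> g \<in> homset ?R F G \<Longrightarrow> f = g" for f g F G
    using unique_arrow_robust_functor_cat hom_obj by blast
  have idn: "F \<in> Obj ?R \<Longrightarrow> Idn ?R F \<in> homset ?R F F" for F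
    using identity_transformation[of finord C F]
    by (simp add: homset_robust_functor_cat Obj_robust_functor_cat
        robust_symmetric_bimonoidal_functor.axioms(1)) (simp add: robust_functor_cat_def)
  have cmp: "f \<in> homset ?R F G \<Longrightarrow> g \<in> homset ?R G H \<Longrightarrow> g \<cdot>\<^bsub>?R\<^esub> f \<in> homset ?R F H" for f g F G H
    using composite_transformation[of finord C F G _ H]
    by (auto simp: homset_robust_functor_cat) (auto simp: robust_functor_cat_def)
  show ?thesis
  proof
    fix f g h A B C' D assume "f \<in> homset ?R A B" "g \<in> homset ?R B C'" "h \<in> homset ?R C' D"
    then show "(h \<cdot>\<^bsub>?R\<^esub> g) \<cdot>\<^bsub>?R\<^esub> f = h \<cdot>\<^bsub>?R\<^esub> g \<cdot>\<^bsub>?R\<^esub> f" by (blast intro: eq cmp)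
  next
    fix f A B assume f: "f \<in> homset ?R A B"
    then show "Idn ?R B \<cdot>\<^bsub>?R\<^esub> f = f" "f \<cdot>\<^bsub>?R\<^esub> Idn ?R A = f"
      using hom_obj by (blast intro: eq cmp idn)+
  qed (use obj idn cmp in auto)
qed

theorem theoremI7p8p3:
  shows "flat_symmetric_bimonoidal_category finord \<and>
    (\<forall>C :: ('o, 'a) symmetric_bimonoidal. flat_symmetric_bimonoidal_category C \<longrightarrow>
       (\<exists>!T :: (_, _, unit, unit) functor_data.
          cat_functor (robust_functor_cat finord C) terminal_cat T) \<and>
       (\<forall>T. cat_functor (robust_functor_cat finord C) terminal_cat T \<longrightarrow>
          equivalence_of_categories (robust_functor_cat finord C) terminal_cat T))"
proof (intro conjI allI impI)
  show "flat_symmetric_bimonoidal_category finord"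
    by (rule flat_symmetric_bimonoidal_finord)
next
  fix C :: "('o, 'a) symmetric_bimonoidal"
  note R = category_robust_functor_cat[of C]
  show "\<exists>!T :: (_, _, unit, unit) functor_data. cat_functor (robust_functor_cat finord C) terminal_cat T"
  proof
    show "cat_functor (robust_functor_cat finord C) terminal_cat \<lparr>FObj = (\<lambda>_. ()), FArr = (\<lambda>_. ())\<rparr>"
      by (simp add: functor_to_terminal[OF R])
  qed (rule functor_data.equality; simp add: fun_eq_iff)
next
  fix C :: "('o, 'a) symmetric_bimonoidal" and T :: "(_, _, unit, unit) functor_data"
  assume "flat_symmetric_bimonoidal_category C" and T: "cat_functor (robust_functor_cat finord C) terminal_cat T"
  then interpret flat_symmetric_bimonoidal_category C by simp
  interpret numerals C by unfold_locales
  show "equivalence_of_categories (robust_functor_cat finord C) terminal_cat T"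
  proof (rule equivalence_to_terminal[OF category_robust_functor_cat unique_arrow_robust_functor_cat _ T])
    show "numeral_functor \<in> Obj (robust_functor_cat finord C)"
      using numeral_functor_robust by (simp add: robust_functor_cat_def)
  qed
qed

end
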